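(* Let $\Sigma$ be a monoidal signature, let $\mathsf{Free}_\Sigma$ be the PROP freely generated by $\Sigma$, and let $\mathsf{Har}_\Sigma$ be the PROP whose morphisms $n\to m$ are equivalence classes of hypergraph adjacency representations (HARs) of type $n\to m$ over $\Sigma$ modulo permutation equivalence $\sim$, with the identities, symmetries, composition and tensor product given in the context. Let $[\![\cdot]\!]:\mathsf{Free}_\Sigma\to\mathsf{Har}_\Sigma$ be the identity-on-objects symmetric monoidal functor freely obtained by sending each operation $g\in\Sigma$ to the (class of the) singleton HAR of $g$. Then $[\![\cdot]\!]$ is an isomorphism of PROPs.
   Context: A monoidal signature $\Sigma$ is a set of operations $o:n\to m$, each with an arity $n\in\mathbb N$ and a coarity $m\in\mathbb N$. A PROP is a (strict) symmetric monoidal category whose objects are the natural numbers, with tensor product on objects given by addition; an isomorphism of PROPs is an invertible identity-on-objects (strict) symmetric monoidal functor. $\mathsf{Free}_\Sigma$ is the PROP whose morphisms are freely generated by the operations of $\Sigma$. Matrix conventions. $\mathsf{Mat}_S(n,m)$ is the set of $m\times n$ matrices over the semiring $S$ ($S=\mathbb B$ or $\mathbb N$), regarded as maps $n\to m$; composition is written in diagrammatic order, so $A;B$ is the ordinary matrix product $BA$. $A\oplus B$ is the block-diagonal direct sum, and $\sigma_{a,b}:a+b\to b+a$ is the permutation matrix $\begin{pmatrix}0&\mathrm{id}_b\\ \mathrm{id}_a&0\end{pmatrix}$. Boolean permutation matrices are also used as matrices over $\mathbb N$. If $P$ is the $K\times K$ permutation matrix of a bijection $p$ (so $P_{p(j),j}=1$)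 and $N$ is a length-$K$ list of labels, then $N;P$ is the list with $(N;P)_{p(j)}=N_j$. A matrix $M\in\mathsf{Mat}_{\mathbb N}(K,K)$ represents a directed graph with edge labels on vertices $1,\dots,K$: there is an edge $j\to i$ exactly when $M_{ij}\neq 0$, and its label is $M_{ij}$ (column $j$ lists the outgoing edges of $j$). HARs. A HAR $f$ of type $n\to m$ over $\Sigma$ consists of a size $f_K=K\in\mathbb N$, a matrix $f_M=M\in\mathsf{Mat}_{\mathbb N}(K,K)$, permutation matrices $f_L=L,\ f_R=R\in\mathsf{Mat}_{\mathbb B}(K,K)$, and node labels $f_N=N\in(\{\bullet\}+(\{\circ\}\times\Sigma))^K$, such that: the graph of $M$ is acyclic and bipartite (every edge joins a $\bullet$-vertex and a $\circ$-vertex); every $\bullet$-vertex has at most one incoming and at most one outgoing edge; calling the $\bullet$-vertices without incoming edges the left interface nodes and the $\bullet$-vertices without outgoing edges the right interface nodes, there are exactly $n$ left interface nodes and they are the first $n$ vertices in the reordered matrix $L^T;M;L$, and there are exactly $m$ right interface nodes and they are the last $m$ vertices in the reordered matrix $R^T;M;R$ (so a $\bullet$-vertex that is not an interface node has exactly one incoming and one outgoing edge); and each vertex labeled $(\circ,g)$ with $g:a\to b$ in $\Sigma$ has exactly $a$ incoming edges, labeled $1,\dots,a$, and exactly $b$ outgoing edges, labeled $1,\dots,b$ (each label occurring once). Permutation equivalence. For HARs $f,g$ of type $n\to m$, $f\sim g$ iff $f_K=g_K=K$ and there is a $K\times K$ permutation matrix $P$ with $g_M=P^T;f_M;P$, $g_L=P^T;f_L$,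 $g_R=P^T;f_R$ and $g_N=f_N;P$. Boundary orders. $L(f)$ has $L(f)_M=f_L^T;f_M;f_L$, $L(f)_L=\mathrm{id}$, $L(f)_R=f_L^T;f_R$, $L(f)_N=f_N;f_L$. $R(f)$ has $R(f)_M=f_R^T;f_M;f_R$, $R(f)_L=f_R^T;f_L$, $R(f)_R=\mathrm{id}$, $R(f)_N=f_N;f_R$. Operations (HARs written as $(M,L,R,N)$). - Identity on $n$: $(0,\mathrm{id}_n,\mathrm{id}_n,(\bullet,\dots,\bullet))$ of size $n$. - Symmetry $n+m\to m+n$: $(0,\mathrm{id}_{n+m},\sigma_{n,m},(\bullet,\dots,\bullet))$ of size $n+m$. - Singleton HAR of $g:n\to m$ in $\Sigma$: size $n+1+m$, $L=R=\mathrm{id}$, $N$ is $n$ copies of $\bullet$, then $(\circ,g)$, then $m$ copies of $\bullet$, and $M=\begin{pmatrix}0&0&0\\ S&0&0\\ 0&T&0\end{pmatrix}$ in blocks of sizes $n,1,m$, where $S$ is the row vector $(1,\dots,n)$ and $T$ is the column vector $(1,\dots,m)^T$. - Tensor product of $f:n_1\to m_1$ and $g:n_2\to m_2$: $(f\otimes g)_M=f_M\oplus g_M$; $(f\otimes g)_L=(f_L\oplus g_L);(\mathrm{id}_{n_1}\oplus\sigma_{f_K-n_1,\,n_2}\oplus\mathrm{id}_{g_K-n_2})$; $(f\otimes g)_R=(f_R\oplus g_R);(\mathrm{id}_{f_K-m_1}\oplus\sigma_{m_1,\,g_K-m_2}\oplus\mathrm{id}_{m_2})$; $(f\otimes g)_N$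 is $f_N$ followed by $g_N$. - Composition of $f:n\to m$ and $g:m\to l$, of size $f_K+g_K-m$: $(f;g)_M=A\oplus B$, where $A$ is the $f_K\times(f_K-m)$ matrix of the first $f_K-m$ columns of $R(f)_M$ and $B$ is the $(g_K-m)\times g_K$ matrix of the last $g_K-m$ rows of $L(g)_M$; $(f;g)_L=R(f)_L\oplus\mathrm{id}_{g_K-m}$; $(f;g)_R=\mathrm{id}_{f_K-m}\oplus L(g)_R$; $(f;g)_N$ is $R(f)_N$ followed by $L(g)_N$ with its first $m$ entries removed.
   Formalization: Permutation equivalence compares L only on the first n and R only on the last m positions (other positions may be permuted freely); with literal equality g_L = P^T;f_L, g_R = P^T;f_R, a;b and b;a for distinct a,b: 0→0 are inequivalent, so Har is not a PROP. *)

theory Defs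
  imports "Jordan_Normal_Form.Matrix" "HOL-Combinatorics.Permutations"
begin

section \<open>Monoidal signatures\<close>

record 'o signature =
  ops :: "'o set"
  arity :: "'o \<Rightarrow> nat"
  coarity :: "'o \<Rightarrow> nat"


section \<open>PROPs and identity-on-objects symmetric monoidal functors\<close>

text \<open>The operations on morphisms carry the objects explicitly, so hom-sets need not be disjoint:
  \<open>cmp C n m l f g\<close> is \<open>f;g\<close> (diagrammatic order) for \<open>f : n \<rightarrow> m\<close>, \<open>g : m \<rightarrow> l\<close>, and
  \<open>tns C n1 m1 n2 m2 f g\<close> is \<open>f \<otimes> g\<close> for \<open>f : n1 \<rightarrow> m1\<close>, \<open>g : n2 \<rightarrow> m2\<close>.\<close>

record 'a prop_data =
  mor :: "nat \<Rightarrow> nat \<Rightarrow> 'a set"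
  idt :: "nat \<Rightarrow> 'a"
  symm :: "nat \<Rightarrow> nat \<Rightarrow> 'a"
  cmp :: "nat \<Rightarrow> nat \<Rightarrow> nat \<Rightarrow> 'a \<Rightarrow> 'a \<Rightarrow> 'a"
  tns :: "nat \<Rightarrow> nat \<Rightarrow> nat \<Rightarrow> nat \<Rightarrow> 'a \<Rightarrow> 'a \<Rightarrow> 'a"

locale prop_category =
  fixes C :: "'a prop_data"
  assumes idt_mor: "idt C n \<in> mor C n n"
    and sym_mor: "symm C n m \<in> mor C (n + m) (m + n)"
    and cmp_mor: "\<lbrakk>f \<in> mor C n m; g \<in> mor C m l\<rbrakk> \<Longrightarrow> cmp C n m l f g \<in> mor C n l"
    and tns_mor: "\<lbrakk>f \<in> mor C n1 m1; g \<in> mor C n2 m2\<rbrakk>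
        \<Longrightarrow> tns C n1 m1 n2 m2 f g \<in> mor C (n1 + n2) (m1 + m2)"
    and idt_left: "f \<in> mor C n m \<Longrightarrow> cmp C n n m (idt C n) f = f"
    and idt_right: "f \<in> mor C n m \<Longrightarrow> cmp C n m m f (idt C m) = f"
    and cmp_assoc: "\<lbrakk>f \<in> mor C n m; g \<in> mor C m l; h \<in> mor C l k\<rbrakk>
        \<Longrightarrow> cmp C n l k (cmp C n m l f g) h = cmp C n m k f (cmp C m l k g h)"
    and tns_idt: "tns C n n m m (idt C n) (idt C m) = idt C (n + m)"
    and interchange: "\<lbrakk>f1 \<in> mor C n1 m1; g1 \<in> mor C m1 l1; f2 \<in> mor C n2 m2; g2 \<in> mor C m2 l2\<rbrakk>
        \<Longrightarrow> tns C n1 l1 n2 l2 (cmp C n1 m1 l1 f1 g1) (cmp C n2 m2 l2 f2 g2)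
          = cmp C (n1 + n2) (m1 + m2) (l1 + l2) (tns C n1 m1 n2 m2 f1 f2) (tns C m1 l1 m2 l2 g1 g2)"
    and unit_left: "f \<in> mor C n m \<Longrightarrow> tns C 0 0 n m (idt C 0) f = f"
    and unit_right: "f \<in> mor C n m \<Longrightarrow> tns C n m 0 0 f (idt C 0) = f"
    and tns_assoc: "\<lbrakk>f \<in> mor C n1 m1; g \<in> mor C n2 m2; h \<in> mor C n3 m3\<rbrakk>
        \<Longrightarrow> tns C (n1 + n2) (m1 + m2) n3 m3 (tns C n1 m1 n2 m2 f g) h
          = tns C n1 m1 (n2 + n3) (m2 + m3) f (tns C n2 m2 n3 m3 g h)"
    and sym_natural: "\<lbrakk>f \<in> mor C n1 m1; g \<in> mor C n2 m2\<rbrakk>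
        \<Longrightarrow> cmp C (n1 + n2) (m1 + m2) (m2 + m1) (tns C n1 m1 n2 m2 f g) (symm C m1 m2)
          = cmp C (n1 + n2) (n2 + n1) (m2 + m1) (symm C n1 n2) (tns C n2 m2 n1 m1 g f)"
    and sym_sym: "cmp C (n + m) (m + n) (n + m) (symm C n m) (symm C m n)
          = idt C (n + m)"
    and hexagon: "symm C n (m + k)
          = cmp C (n + m + k) (m + n + k) (m + k + n)
              (tns C (n + m) (m + n) k k (symm C n m) (idt C k))
              (tns C m m (n + k) (k + n) (idt C m) (symm C n k))"

locale prop_functor = dom: prop_category C + cod: prop_category D
  for C :: "'a prop_data" and D :: "'b prop_data" +
  fixes F :: "nat \<Rightarrow> nat \<Rightarrow> 'a \<Rightarrow> 'b"
  assumes F_mor: "f \<in> mor C n m \<Longrightarrow> F n m f \<in> mor D n m"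
    and F_idt: "F n n (idt C n) = idt D n"
    and F_sym: "F (n + m) (m + n) (symm C n m) = symm D n m"
    and F_cmp: "\<lbrakk>f \<in> mor C n m; g \<in> mor C m l\<rbrakk>
        \<Longrightarrow> F n l (cmp C n m l f g) = cmp D n m l (F n m f) (F m l g)"
    and F_tns: "\<lbrakk>f \<in> mor C n1 m1; g \<in> mor C n2 m2\<rbrakk>
        \<Longrightarrow> F (n1 + n2) (m1 + m2) (tns C n1 m1 n2 m2 f g)
          = tns D n1 m1 n2 m2 (F n1 m1 f) (F n2 m2 g)"

definition prop_isomorphism ::
    "'a prop_data \<Rightarrow> 'b prop_data \<Rightarrow> (nat \<Rightarrow> nat \<Rightarrow> 'a \<Rightarrow> 'b) \<Rightarrow> bool" where
  "prop_isomorphism C D F \<longleftrightarrow> prop_functor C D F \<and>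
     (\<exists>G. prop_functor D C G \<and>
        (\<forall>n m. \<forall>f \<in> mor C n m. G n m (F n m f) = f) \<and>
        (\<forall>n m. \<forall>g \<in> mor D n m. F n m (G n m g) = g))"


section \<open>The free PROP on a signature\<close>

datatype 'o pterm =
    TId nat
  | TSym nat nat
  | TGen 'o
  | TComp "'o pterm" "'o pterm"
  | TTens "'o pterm" "'o pterm"

primrec tdom :: "'o signature \<Rightarrow> 'o pterm \<Rightarrow> nat" where
  "tdom Sg (TId n) = n"
| "tdom Sg (TSym n m) = n + m"
| "tdom Sg (TGen g) = arity Sg g"
| "tdom Sg (TComp s t) = tdom Sg s"
| "tdom Sg (TTens s t) = tdom Sg s + tdom Sg t"

primrec tcod :: "'o signature \<Rightarrow> 'o pterm \<Rightarrow> nat" where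
  "tcod Sg (TId n) = n"
| "tcod Sg (TSym n m) = m + n"
| "tcod Sg (TGen g) = coarity Sg g"
| "tcod Sg (TComp s t) = tcod Sg t"
| "tcod Sg (TTens s t) = tcod Sg s + tcod Sg t"

primrec wf_term :: "'o signature \<Rightarrow> 'o pterm \<Rightarrow> bool" where
  "wf_term Sg (TId n) \<longleftrightarrow> True"
| "wf_term Sg (TSym n m) \<longleftrightarrow> True"
| "wf_term Sg (TGen g) \<longleftrightarrow> g \<in> ops Sg"
| "wf_term Sg (TComp s t) \<longleftrightarrow> wf_term Sg s \<and> wf_term Sg t \<and> tcod Sg s = tdom Sg t"
| "wf_term Sg (TTens s t) \<longleftrightarrow> wf_term Sg s \<and> wf_term Sg t"

definition pterms :: "'o signature \<Rightarrow> nat \<Rightarrow> nat \<Rightarrow> 'o pterm set" where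
  "pterms Sg n m = {t. wf_term Sg t \<and> tdom Sg t = n \<and> tcod Sg t = m}"

text \<open>The least congruence on typed terms containing the laws of \<^locale>\<open>prop_category\<close>.\<close>

inductive free_eq :: "'o signature \<Rightarrow> nat \<Rightarrow> nat \<Rightarrow> 'o pterm \<Rightarrow> 'o pterm \<Rightarrow> bool"
  for Sg :: "'o signature" where
  refl: "t \<in> pterms Sg n m \<Longrightarrow> free_eq Sg n m t t"
| sym: "free_eq Sg n m s t \<Longrightarrow> free_eq Sg n m t s"
| trans: "\<lbrakk>free_eq Sg n m s t; free_eq Sg n m t u\<rbrakk> \<Longrightarrow> free_eq Sg n m s u"
| cong_comp: "\<lbrakk>free_eq Sg n m f f'; free_eq Sg m l g g'\<rbrakk>
    \<Longrightarrow> free_eq Sg n l (TComp f g) (TComp f' g')"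
| cong_tens: "\<lbrakk>free_eq Sg n1 m1 f f'; free_eq Sg n2 m2 g g'\<rbrakk>
    \<Longrightarrow> free_eq Sg (n1 + n2) (m1 + m2) (TTens f g) (TTens f' g')"
| id_left: "f \<in> pterms Sg n m \<Longrightarrow> free_eq Sg n m (TComp (TId n) f) f"
| id_right: "f \<in> pterms Sg n m \<Longrightarrow> free_eq Sg n m (TComp f (TId m)) f"
| comp_assoc: "\<lbrakk>f \<in> pterms Sg n m; g \<in> pterms Sg m l; h \<in> pterms Sg l k\<rbrakk>
    \<Longrightarrow> free_eq Sg n k (TComp (TComp f g) h) (TComp f (TComp g h))"
| tens_id: "free_eq Sg (n + m) (n + m) (TTens (TId n) (TId m)) (TId (n + m))"
| interchange: "\<lbrakk>f1 \<in> pterms Sg n1 m1; g1 \<in> pterms Sg m1 l1; f2 \<in> pterms Sg n2 m2; g2 \<in> pterms Sg m2 l2\<rbrakk>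
    \<Longrightarrow> free_eq Sg (n1 + n2) (l1 + l2)
          (TTens (TComp f1 g1) (TComp f2 g2)) (TComp (TTens f1 f2) (TTens g1 g2))"
| unit_left: "f \<in> pterms Sg n m \<Longrightarrow> free_eq Sg n m (TTens (TId 0) f) f"
| unit_right: "f \<in> pterms Sg n m \<Longrightarrow> free_eq Sg n m (TTens f (TId 0)) f"
| tens_assoc: "\<lbrakk>f \<in> pterms Sg n1 m1; g \<in> pterms Sg n2 m2; h \<in> pterms Sg n3 m3\<rbrakk>
    \<Longrightarrow> free_eq Sg (n1 + n2 + n3) (m1 + m2 + m3) (TTens (TTens f g) h) (TTens f (TTens g h))"
| sym_natural: "\<lbrakk>f \<in> pterms Sg n1 m1; g \<in> pterms Sg n2 m2\<rbrakk>
    \<Longrightarrow> free_eq Sg (n1 + n2) (m2 + m1)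
          (TComp (TTens f g) (TSym m1 m2)) (TComp (TSym n1 n2) (TTens g f))"
| sym_sym: "free_eq Sg (n + m) (n + m) (TComp (TSym n m) (TSym m n)) (TId (n + m))"
| hexagon: "free_eq Sg (n + m + k) (m + k + n) (TSym n (m + k))
    (TComp (TTens (TSym n m) (TId k)) (TTens (TId m) (TSym n k)))"

definition free_rel :: "'o signature \<Rightarrow> nat \<Rightarrow> nat \<Rightarrow> ('o pterm \<times> 'o pterm) set" where
  "free_rel Sg n m = {(s, t). s \<in> pterms Sg n m \<and> t \<in> pterms Sg n m \<and> free_eq Sg n m s t}"

definition free_class :: "'o signature \<Rightarrow> nat \<Rightarrow> nat \<Rightarrow> 'o pterm \<Rightarrow> 'o pterm set" where
  "free_class Sg n m t = free_rel Sg n m `` {t}"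

definition Free :: "'o signature \<Rightarrow> 'o pterm set prop_data" where
  "Free Sg = \<lparr>
     mor = (\<lambda>n m. pterms Sg n m // free_rel Sg n m),
     idt = (\<lambda>n. free_class Sg n n (TId n)),
     symm = (\<lambda>n m. free_class Sg (n + m) (m + n) (TSym n m)),
     cmp = (\<lambda>n m l X Y. \<Union>s\<in>X. \<Union>t\<in>Y. free_class Sg n l (TComp s t)),
     tns = (\<lambda>n1 m1 n2 m2 X Y. \<Union>s\<in>X. \<Union>t\<in>Y. free_class Sg (n1 + n2) (m1 + m2) (TTens s t)) \<rparr>"

primrec eval_term :: "'o signature \<Rightarrow> 'a prop_data \<Rightarrow> ('o \<Rightarrow> 'a) \<Rightarrow> 'o pterm \<Rightarrow> 'a" where
  "eval_term Sg C \<gamma> (TId n) = idt C n"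
| "eval_term Sg C \<gamma> (TSym n m) = symm C n m"
| "eval_term Sg C \<gamma> (TGen g) = \<gamma> g"
| "eval_term Sg C \<gamma> (TComp s t) =
     cmp C (tdom Sg s) (tcod Sg s) (tcod Sg t) (eval_term Sg C \<gamma> s) (eval_term Sg C \<gamma> t)"
| "eval_term Sg C \<gamma> (TTens s t) =
     tns C (tdom Sg s) (tcod Sg s) (tdom Sg t) (tcod Sg t) (eval_term Sg C \<gamma> s) (eval_term Sg C \<gamma> t)"

text \<open>The functor out of \<open>Free Sg\<close> freely obtained from \<open>\<gamma>\<close>: the common value of the terms in a
  class. (If \<open>C\<close> is a PROP and \<open>\<gamma>\<close> respects types, all terms in a class have the same value.)\<close>

definition free_lift ::
    "'o signature \<Rightarrow> 'a prop_data \<Rightarrow> ('o \<Rightarrow> 'a) \<Rightarrow> nat \<Rightarrow> nat \<Rightarrow> 'o pterm set \<Rightarrow> 'a" where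
  "free_lift Sg C \<gamma> n m X = the_elem (eval_term Sg C \<gamma> ` X)"


section \<open>Matrix conventions\<close>

text \<open>Vertices are numbered from \<open>0\<close>. Permutation matrices have entries \<open>0\<close> and \<open>1\<close> and the product
  of two of them is the same over the Booleans as over \<^typ>\<open>nat\<close>, so all matrices are over \<^typ>\<open>nat\<close>.\<close>

definition dcomp :: "nat mat \<Rightarrow> nat mat \<Rightarrow> nat mat" (infixl "\<Zsemi>" 70) where
  "A \<Zsemi> B = B * A"

definition dsum :: "nat mat \<Rightarrow> nat mat \<Rightarrow> nat mat" (infixl "\<oplus>\<^sub>d" 75) where
  "A \<oplus>\<^sub>d B = four_block_mat A (0\<^sub>m (dim_row A) (dim_col B)) (0\<^sub>m (dim_row B) (dim_col A)) B"

definition sigma_mat :: "nat \<Rightarrow> nat \<Rightarrow> nat mat" where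
  "sigma_mat a b = four_block_mat (0\<^sub>m b a) (1\<^sub>m b) (1\<^sub>m a) (0\<^sub>m a b)"

definition perm_mat :: "nat \<Rightarrow> (nat \<Rightarrow> nat) \<Rightarrow> nat mat" where
  "perm_mat K p = mat K K (\<lambda>(i, j). if i = p j then 1 else 0)"

definition is_perm_mat :: "nat \<Rightarrow> nat mat \<Rightarrow> bool" where
  "is_perm_mat K P \<longleftrightarrow> (\<exists>p. p permutes {..<K} \<and> P = perm_mat K p)"

text \<open>\<open>N;P\<close> for a label list \<open>N\<close>: entry \<open>i\<close> is \<open>N ! j\<close> for the \<open>j\<close> with \<open>P $$ (i, j) = 1\<close>,
  i.e. \<open>i = p j\<close> if \<open>P = perm_mat K p\<close>.\<close>

definition permute_labels :: "'a list \<Rightarrow> nat mat \<Rightarrow> 'a list" (infixl "\<Zsemi>\<^sub>l" 70) where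
  "N \<Zsemi>\<^sub>l P = map (\<lambda>i. N ! (THE j. j < length N \<and> P $$ (i, j) = 1)) [0..<length N]"

definition first_cols :: "nat \<Rightarrow> nat mat \<Rightarrow> nat mat" where
  "first_cols c A = mat (dim_row A) c (\<lambda>(i, j). A $$ (i, j))"

definition last_rows :: "nat \<Rightarrow> nat mat \<Rightarrow> nat mat" where
  "last_rows r A = mat r (dim_col A) (\<lambda>(i, j). A $$ (dim_row A - r + i, j))"

text \<open>\<open>(j, i)\<close> is an edge iff \<open>M $$ (i, j) \<noteq> 0\<close>: columns list outgoing edges.\<close>

definition edges :: "nat mat \<Rightarrow> (nat \<times> nat) set" where
  "edges M = {(j, i). i < dim_row M \<and> j < dim_col M \<and> M $$ (i, j) \<noteq> 0}"

definition preds :: "nat mat \<Rightarrow> nat \<Rightarrow> nat set" where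
  "preds M v = {u. (u, v) \<in> edges M}"

definition succs :: "nat mat \<Rightarrow> nat \<Rightarrow> nat set" where
  "succs M v = {w. (v, w) \<in> edges M}"


section \<open>Hypergraph adjacency representations\<close>

datatype 'o node = Bullet | Circ 'o

record 'o har =
  hK :: nat
  hM :: "nat mat"
  hL :: "nat mat"
  hR :: "nat mat"
  hN :: "'o node list"

definition left_nodes :: "nat mat \<Rightarrow> 'o node list \<Rightarrow> nat set" where
  "left_nodes M N = {v. v < length N \<and> N ! v = Bullet \<and> preds M v = {}}"

definition right_nodes :: "nat mat \<Rightarrow> 'o node list \<Rightarrow> nat set" where
  "right_nodes M N = {v. v < length N \<and> N ! v = Bullet \<and> succs M v = {}}"

definition is_har :: "'o signature \<Rightarrow> nat \<Rightarrow> nat \<Rightarrow> 'o har \<Rightarrow> bool" where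
  "is_har Sg n m f \<longleftrightarrow>
    (let K = hK f; M = hM f; L = hL f; R = hR f; N = hN f in
      M \<in> carrier_mat K K \<and> is_perm_mat K L \<and> is_perm_mat K R \<and>
      length N = K \<and> (\<forall>g. Circ g \<in> set N \<longrightarrow> g \<in> ops Sg) \<and>
      acyclic (edges M) \<and>
      (\<forall>(j, i) \<in> edges M. (N ! j = Bullet) \<noteq> (N ! i = Bullet)) \<and>
      (\<forall>v < K. N ! v = Bullet \<longrightarrow> card (preds M v) \<le> 1 \<and> card (succs M v) \<le> 1) \<and>
      card (left_nodes M N) = n \<and>
      left_nodes (L\<^sup>T \<Zsemi> M \<Zsemi> L) (N \<Zsemi>\<^sub>l L) = {0..<n} \<and>
      card (right_nodes M N) = m \<and>
      right_nodes (R\<^sup>T \<Zsemi> M \<Zsemi> R) (N \<Zsemi>\<^sub>l R) = {K - m..<K} \<and>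
      (\<forall>v < K. \<forall>g. N ! v = Circ g \<longrightarrow>
         bij_betw (\<lambda>u. M $$ (v, u)) (preds M v) {1..arity Sg g} \<and>
         bij_betw (\<lambda>w. M $$ (w, v)) (succs M v) {1..coarity Sg g}))"

text \<open>
  Permutation equivalence. Of the orders \<open>L\<close> and \<open>R\<close>, only the positions of the interface nodes
  (the first \<open>n\<close> in \<open>L\<close>, the last \<open>m\<close> in \<open>R\<close>) carry information, so \<open>g_L\<close> and \<open>P\<^sup>T;f_L\<close> are compared
  up to a permutation \<open>Q\<close> of the remaining positions, and likewise for \<open>R\<close>. Demanding
  \<open>g_L = P\<^sup>T;f_L\<close> and \<open>g_R = P\<^sup>T;f_R\<close> on the nose (\<open>strict_har_equiv\<close> below) does not give a
  PROP, since composition of morphisms \<open>0 \<rightarrow> 0\<close> is then not commutative; see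
  \<open>strict_har_equiv_scalars_not_commute\<close>.
\<close>

definition har_equiv :: "nat \<Rightarrow> nat \<Rightarrow> 'o har \<Rightarrow> 'o har \<Rightarrow> bool" where
  "har_equiv n m f g \<longleftrightarrow> hK f = hK g \<and>
    (\<exists>P Q Q'. is_perm_mat (hK f) P \<and> is_perm_mat (hK f - n) Q \<and> is_perm_mat (hK f - m) Q' \<and>
       hM g = P\<^sup>T \<Zsemi> hM f \<Zsemi> P \<and>
       hL g = P\<^sup>T \<Zsemi> hL f \<Zsemi> (1\<^sub>m n \<oplus>\<^sub>d Q) \<and>
       hR g = P\<^sup>T \<Zsemi> hR f \<Zsemi> (Q' \<oplus>\<^sub>d 1\<^sub>m m) \<and>
       hN g = hN f \<Zsemi>\<^sub>l P)"

definition har_rel :: "'o signature \<Rightarrow> nat \<Rightarrow> nat \<Rightarrow> ('o har \<times> 'o har) set" where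
  "har_rel Sg n m = {(f, g). is_har Sg n m f \<and> is_har Sg n m g \<and> har_equiv n m f g}"

definition har_class :: "'o signature \<Rightarrow> nat \<Rightarrow> nat \<Rightarrow> 'o har \<Rightarrow> 'o har set" where
  "har_class Sg n m f = har_rel Sg n m `` {f}"

definition left_order :: "'o har \<Rightarrow> 'o har" where
  "left_order f = \<lparr>hK = hK f, hM = (hL f)\<^sup>T \<Zsemi> hM f \<Zsemi> hL f, hL = 1\<^sub>m (hK f),
     hR = (hL f)\<^sup>T \<Zsemi> hR f, hN = hN f \<Zsemi>\<^sub>l hL f\<rparr>"

definition right_order :: "'o har \<Rightarrow> 'o har" where
  "right_order f = \<lparr>hK = hK f, hM = (hR f)\<^sup>T \<Zsemi> hM f \<Zsemi> hR f, hL = (hR f)\<^sup>T \<Zsemi> hL f,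
     hR = 1\<^sub>m (hK f), hN = hN f \<Zsemi>\<^sub>l hR f\<rparr>"

definition har_id :: "nat \<Rightarrow> 'o har" where
  "har_id n = \<lparr>hK = n, hM = 0\<^sub>m n n, hL = 1\<^sub>m n, hR = 1\<^sub>m n, hN = replicate n Bullet\<rparr>"

definition har_sym :: "nat \<Rightarrow> nat \<Rightarrow> 'o har" where
  "har_sym n m = \<lparr>hK = n + m, hM = 0\<^sub>m (n + m) (n + m), hL = 1\<^sub>m (n + m), hR = sigma_mat n m,
     hN = replicate (n + m) Bullet\<rparr>"

text \<open>Vertex \<open>n\<close> is the \<open>\<circ>\<close>-vertex; its incoming edges, from the vertices \<open>0, \<dots>, n - 1\<close>, are labelled
  \<open>1, \<dots>, n\<close> and its outgoing edges, to the vertices \<open>n + 1, \<dots>, n + m\<close>, are labelled \<open>1, \<dots>, m\<close>.\<close>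

definition har_gen :: "'o signature \<Rightarrow> 'o \<Rightarrow> 'o har" where
  "har_gen Sg g = (let n = arity Sg g; m = coarity Sg g; K = n + 1 + m in
     \<lparr>hK = K,
      hM = mat K K (\<lambda>(i, j). if i = n \<and> j < n then j + 1 else if n < i \<and> j = n then i - n else 0),
      hL = 1\<^sub>m K, hR = 1\<^sub>m K,
      hN = replicate n Bullet @ [Circ g] @ replicate m Bullet\<rparr>)"

definition har_tensor :: "nat \<Rightarrow> nat \<Rightarrow> nat \<Rightarrow> nat \<Rightarrow> 'o har \<Rightarrow> 'o har \<Rightarrow> 'o har" where
  "har_tensor n1 m1 n2 m2 f g =
    \<lparr>hK = hK f + hK g,
     hM = hM f \<oplus>\<^sub>d hM g,
     hL = (hL f \<oplus>\<^sub>d hL g) \<Zsemi> (1\<^sub>m n1 \<oplus>\<^sub>d sigma_mat (hK f - n1) n2 \<oplus>\<^sub>d 1\<^sub>m (hK g - n2)),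
     hR = (hR f \<oplus>\<^sub>d hR g) \<Zsemi> (1\<^sub>m (hK f - m1) \<oplus>\<^sub>d sigma_mat m1 (hK g - m2) \<oplus>\<^sub>d 1\<^sub>m m2),
     hN = hN f @ hN g\<rparr>"

definition har_comp :: "nat \<Rightarrow> 'o har \<Rightarrow> 'o har \<Rightarrow> 'o har" where
  "har_comp m f g = (let Rf = right_order f; Lg = left_order g in
    \<lparr>hK = hK f + hK g - m,
     hM = first_cols (hK f - m) (hM Rf) \<oplus>\<^sub>d last_rows (hK g - m) (hM Lg),
     hL = hL Rf \<oplus>\<^sub>d 1\<^sub>m (hK g - m),
     hR = 1\<^sub>m (hK f - m) \<oplus>\<^sub>d hR Lg,
     hN = hN Rf @ drop m (hN Lg)\<rparr>)"

definition Har :: "'o signature \<Rightarrow> 'o har set prop_data" where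
  "Har Sg = \<lparr>
     mor = (\<lambda>n m. {f. is_har Sg n m f} // har_rel Sg n m),
     idt = (\<lambda>n. har_class Sg n n (har_id n)),
     symm = (\<lambda>n m. har_class Sg (n + m) (m + n) (har_sym n m)),
     cmp = (\<lambda>n m l X Y. \<Union>f\<in>X. \<Union>g\<in>Y. har_class Sg n l (har_comp m f g)),
     tns = (\<lambda>n1 m1 n2 m2 X Y. \<Union>f\<in>X. \<Union>g\<in>Y.
              har_class Sg (n1 + n2) (m1 + m2) (har_tensor n1 m1 n2 m2 f g)) \<rparr>"

definition free_gen :: "'o signature \<Rightarrow> 'o \<Rightarrow> 'o pterm set" where
  "free_gen Sg g = free_class Sg (arity Sg g) (coarity Sg g) (TGen g)"

definition singleton_class :: "'o signature \<Rightarrow> 'o \<Rightarrow> 'o har set" where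
  "singleton_class Sg g = har_class Sg (arity Sg g) (coarity Sg g) (har_gen Sg g)"

definition har_interp :: "'o signature \<Rightarrow> nat \<Rightarrow> nat \<Rightarrow> 'o pterm set \<Rightarrow> 'o har set" where
  "har_interp Sg = free_lift Sg (Har Sg) (singleton_class Sg)"


section \<open>Comparing the orders of all vertices is too strict\<close>

definition strict_har_equiv :: "'o har \<Rightarrow> 'o har \<Rightarrow> bool" where
  "strict_har_equiv f g \<longleftrightarrow> hK f = hK g \<and>
    (\<exists>P. is_perm_mat (hK f) P \<and> hM g = P\<^sup>T \<Zsemi> hM f \<Zsemi> P \<and>
       hL g = P\<^sup>T \<Zsemi> hL f \<and> hR g = P\<^sup>T \<Zsemi> hR f \<and> hN g = hN f \<Zsemi>\<^sub>l P)"

lemma strict_har_equiv_scalars_not_commute: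
  fixes Sg :: "'o signature"
  assumes "arity Sg a = 0" "coarity Sg a = 0" "arity Sg b = 0" "coarity Sg b = 0" "a \<noteq> b"
  shows "\<not> strict_har_equiv (har_comp 0 (har_gen Sg a) (har_gen Sg b))
                             (har_comp 0 (har_gen Sg b) (har_gen Sg a))"
proof
  let ?f = "har_comp 0 (har_gen Sg a) (har_gen Sg b)"
  let ?g = "har_comp 0 (har_gen Sg b) (har_gen Sg a)"
  have one: "(1\<^sub>m (Suc 0) :: nat mat) \<oplus>\<^sub>d 1\<^sub>m (Suc 0) = 1\<^sub>m 2"
    by (auto simp: dsum_def numeral_2_eq_2)
  have lab: "[x] \<Zsemi>\<^sub>l 1\<^sub>m (Suc 0) = [x]" for x :: "'o node"
  proof -
    have "(THE j. j < Suc 0 \<and> (1\<^sub>m (Suc 0) :: nat mat) $$ (0, j) = 1) = 0"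
      by (rule the_equality) auto
    then show ?thesis by (simp add: permute_labels_def)
  qed
  have f: "hK ?f = 2" "hL ?f = 1\<^sub>m 2" "hN ?f = [Circ a, Circ b]"
    and g: "hL ?g = 1\<^sub>m 2" "hN ?g = [Circ b, Circ a]"
    using assms one lab
    by (auto simp: har_comp_def har_gen_def left_order_def right_order_def Let_def dcomp_def)
  assume "strict_har_equiv ?f ?g"
  then obtain P where P: "is_perm_mat 2 P" "1\<^sub>m 2 = P\<^sup>T \<Zsemi> 1\<^sub>m 2"
    and N: "[Circ b, Circ a] = [Circ a, Circ b] \<Zsemi>\<^sub>l P"
    unfolding strict_har_equiv_def f g by auto
  from P(1) have "P \<in> carrier_mat 2 2" by (auto simp: is_perm_mat_def perm_mat_def)
  with P(2) have "P\<^sup>T = 1\<^sub>m 2" by (simp add: dcomp_def)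
  then have "P = 1\<^sub>m 2" by (metis transpose_one transpose_transpose)
  moreover have "(THE j. j < 2 \<and> (1\<^sub>m 2 :: nat mat) $$ (0, j) = 1) = 0"
    by (rule the_equality) (auto split: if_splits)
  ultimately have "hd ([Circ a, Circ b] \<Zsemi>\<^sub>l P) = Circ a"
    by (simp add: permute_labels_def upt_rec numeral_2_eq_2)
  with N have "Circ b = Circ a" by (metis list.sel(1))
  with \<open>a \<noteq> b\<close> show False by simp
qed

end

theory Submission
  imports Defs
begin

text \<open>
  Name the wires. A morphism is then a diagram \<open>(xs, E, ys)\<close>: two lists of wires and a multiset of
  hyperedges \<open>(g, as, bs)\<close>, such that every wire is produced once and consumed once. A HAR is such a
  diagram on its \<open>\<bullet>\<close>-vertices, permutation equivalence is renaming of wires, and composition and tensor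
  product of HARs are concatenation of diagrams after renaming.

  A term denotes all diagrams of one renaming class, and under this reading each law of a PROP becomes
  a triviality about lists and multisets. Conversely, list the hyperedges of an acyclic diagram in an
  order in which every wire is produced before it is consumed. Such a list can be evaluated in every
  PROP, by permuting the live wires, applying one operation, and going on. The value does not depend on
  the order, because two admissible orders differ by exchanges of independent neighbours, and every
  term equals the value of any diagram it denotes. So two terms that denote the same diagram are equal
  in the free PROP. All that is used about symmetries is that the morphisms permuting named wires
  compose as permutations do.

  The laws of the PROP of HARs are never checked on matrices: its operations are images of the
  operations on terms.
\<close>

section \<open>Permutation morphisms in a PROP\<close>

text \<open>The hard direction is injectivity: a HAR consists of matrices, while equality of two
  terms can only be reached through the rules of \<open>free_eq\<close>. The way across is to regard
  the classes of terms as a PROP and to evaluate listed diagrams in it; a value is then itself a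
  class of terms, so equality of values is derivability. Evaluation needs the wires in a definite
  order although a diagram has none. This is why permutation morphisms are indexed by lists of
  names: coherence of the symmetries is condensed into \<open>P_comp\<close>,
  \<open>P_tensor\<close> and \<open>P_sym\<close>. Denotation is a relation because there are no
  canonical names; it is unique up to injective renaming, and a HAR supplies its vertex numbers as
  names. Each class of HARs is described as the set of all HARs representing some term.
  Compatibility of the matrix operations with \<open>har_equiv\<close> has the same source: if
  \<open>f\<close> and \<open>g\<close> represent \<open>s\<close> and \<open>t\<close>, their
  composite represents \<open>TComp s t\<close>, whichever \<open>f\<close> and \<open>g\<close> are
  taken. The permutations \<open>Q\<close> and \<open>Q'\<close> in \<open>har_equiv\<close> are
  invisible to a diagram, which records interface positions only.\<close>

text \<open>A one-sorted PROP. Composition is total and associative without typing conditions; in the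
  instance below, ill-typed composites are empty.\<close>

locale prop_algebra =
  fixes mo :: "'a \<Rightarrow> bool" and dm cd :: "'a \<Rightarrow> nat" and I :: "nat \<Rightarrow> 'a"
    and S :: "nat \<Rightarrow> nat \<Rightarrow> 'a" and cp :: "'a \<Rightarrow> 'a \<Rightarrow> 'a" (infixr "\<then>" 60)
    and tn :: "'a \<Rightarrow> 'a \<Rightarrow> 'a" (infixr "\<parallel>" 70)
  assumes mo_I[simp]: "mo (I n)" and dm_I[simp]: "dm (I n) = n" and cd_I[simp]: "cd (I n) = n"
    and mo_S[simp]: "mo (S n m)" and dm_S[simp]: "dm (S n m) = n + m" and cd_S[simp]: "cd (S n m) = m + n"
    and mo_cp[simp]: "\<lbrakk>mo f; mo g; cd f = dm g\<rbrakk> \<Longrightarrow> mo (f \<then> g)"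
    and dm_cp[simp]: "\<lbrakk>mo f; mo g; cd f = dm g\<rbrakk> \<Longrightarrow> dm (f \<then> g) = dm f"
    and cd_cp[simp]: "\<lbrakk>mo f; mo g; cd f = dm g\<rbrakk> \<Longrightarrow> cd (f \<then> g) = cd g"
    and mo_tn[simp]: "\<lbrakk>mo f; mo g\<rbrakk> \<Longrightarrow> mo (f \<parallel> g)"
    and dm_tn[simp]: "\<lbrakk>mo f; mo g\<rbrakk> \<Longrightarrow> dm (f \<parallel> g) = dm f + dm g"
    and cd_tn[simp]: "\<lbrakk>mo f; mo g\<rbrakk> \<Longrightarrow> cd (f \<parallel> g) = cd f + cd g"
    and cp_assoc[simp]: "(f \<then> g) \<then> h = f \<then> g \<then> h"
    and tn_assoc[simp]: "(f \<parallel> g) \<parallel> h = f \<parallel> g \<parallel> h"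
    and I_cp[simp]: "\<lbrakk>mo f; dm f = n\<rbrakk> \<Longrightarrow> I n \<then> f = f"
    and cp_I[simp]: "\<lbrakk>mo f; cd f = n\<rbrakk> \<Longrightarrow> f \<then> I n = f"
    and tn_I[simp]: "I n \<parallel> I m = I (n + m)"
    and I0_tn[simp]: "mo f \<Longrightarrow> I 0 \<parallel> f = f"
    and tn_I0[simp]: "mo f \<Longrightarrow> f \<parallel> I 0 = f"
    and interchange: "\<lbrakk>mo f1; mo g1; mo f2; mo g2; cd f1 = dm g1; cd f2 = dm g2\<rbrakk>
      \<Longrightarrow> (f1 \<then> g1) \<parallel> (f2 \<then> g2) = (f1 \<parallel> f2) \<then> (g1 \<parallel> g2)"
    and S_natural: "\<lbrakk>mo f; mo g\<rbrakk> \<Longrightarrow> (f \<parallel> g) \<then> S (cd f) (cd g) = S (dm f) (dm g) \<then> (g \<parallel> f)"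
    and S_S[simp]: "S n m \<then> S m n = I (n + m)"
    and hexagon: "S n (m + k) = (S n m \<parallel> I k) \<then> (I m \<parallel> S n k)"
begin

text \<open>Complements \<open>tn_I\<close>: once products are nested to the right, two adjacent
  identities in front of \<open>f\<close> no longer form a subterm.\<close>

lemma tn_I_cp [simp]: "I n \<parallel> I m \<parallel> f = I (n + m) \<parallel> f"
  by (metis tn_assoc tn_I)

lemma cp_tn_I: "\<lbrakk>mo f; mo g; cd f = dm g\<rbrakk> \<Longrightarrow> (f \<then> g) \<parallel> I n = (f \<parallel> I n) \<then> (g \<parallel> I n)"
  using interchange[of f g "I n" "I n"] by simp

lemma I_tn_cp: "\<lbrakk>mo f; mo g; cd f = dm g\<rbrakk> \<Longrightarrow> I n \<parallel> (f \<then> g) = (I n \<parallel> f) \<then> (I n \<parallel> g)"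
  using interchange[of "I n" "I n" f g] by simp

text \<open>Morphisms side by side may be performed one after the other, in either order;
  \<open>slide\<close> combines the two forms and is the source of all order independence below. The
  widths \<open>n\<close> and \<open>m\<close> are variables tied by equations, so that the rule
  still matches after the types have been simplified.\<close>

lemma slide1:
  assumes "mo f" "mo g" "n = dm g" "m = cd f"
  shows "(f \<parallel> I n) \<then> (I m \<parallel> g) = f \<parallel> g"
  unfolding assms(3,4) using assms(1,2) by (subst interchange[symmetric]) simp_all

lemma slide2:
  assumes "mo f" "mo g" "n = dm f" "m = cd g"
  shows "(I n \<parallel> g) \<then> (f \<parallel> I m) = f \<parallel> g"
  unfolding assms(3,4) using assms(1,2) by (subst interchange[symmetric]) simp_all

lemma slide: "\<lbrakk>mo f; mo g\<rbrakk> \<Longrightarrow> (f \<parallel> I (dm g)) \<then> (I (cd f) \<parallel> g) = (I (dm f) \<parallel> g) \<then> (f \<parallel> I (cd g))"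
  by (simp add: slide1 slide2)

text \<open>The hexagon with two empty blocks makes \<open>S n 0\<close> idempotent, and an
  invertible idempotent is an identity.\<close>

lemma S_n0 [simp]: "S n 0 = I n"
proof -
  have "S n 0 = S n 0 \<then> S n 0"
    using hexagon[of n 0 0] by simp
  then have "S n 0 \<then> S 0 n = S n 0 \<then> S n 0 \<then> S 0 n"
    by (metis cp_assoc)
  then show ?thesis by simp
qed

lemma S_0n [simp]: "S 0 n = I n"
proof -
  have "S n 0 \<then> S 0 n = I n" by (simp only: S_S add_0_right)
  then show ?thesis by simp
qed

lemma S_S_reassoc [simp]: "\<lbrakk>mo f; dm f = n + m\<rbrakk> \<Longrightarrow> S n m \<then> S m n \<then> f = f"
  by (metis cp_assoc S_S I_cp)

text \<open>The mirror image of \<open>hexagon\<close>, by inversion: \<open>?A\<close> is the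
  hexagon expansion of \<open>S k (n + m)\<close>, whose inverse is \<open>S (n + m) k\<close>, and
  \<open>?B\<close> followed by \<open>?A\<close> is the identity.\<close>

lemma hexagon2: "S (n + m) k = (I n \<parallel> S m k) \<then> (S n k \<parallel> I m)"
proof -
  let ?A = "(S k n \<parallel> I m) \<then> (I n \<parallel> S k m)" and ?B = "(I n \<parallel> S m k) \<then> (S n k \<parallel> I m)"
  have 1: "?B \<then> ?A = I (n + m + k)"
  proof -
    have "?B \<then> ?A = (I n \<parallel> S m k) \<then> ((S n k \<then> S k n) \<parallel> I m) \<then> (I n \<parallel> S k m)"
      by (subst cp_tn_I) simp_all
    also have "\<dots> = (I n \<parallel> S m k) \<then> (I n \<parallel> S k m)" by simp
    also have "\<dots> = I n \<parallel> (S m k \<then> S k m)" by (rule I_tn_cp[symmetric]) simp_all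
    finally show ?thesis by (simp add: add.assoc)
  qed
  have "S (n + m) k = (?B \<then> ?A) \<then> S (n + m) k" unfolding 1 by simp
  also have "\<dots> = ?B \<then> ?A \<then> S (n + m) k" by (rule cp_assoc)
  also have "?A \<then> S (n + m) k = S k (n + m) \<then> S (n + m) k" by (simp only: hexagon)
  also have "\<dots> = I (k + (n + m))" by (rule S_S)
  also have "?B \<then> I (k + (n + m)) = ?B" by (rule cp_I) simp_all
  finally show ?thesis .
qed

text \<open>\<open>P xs ys\<close> connects equal names; its first wire is routed last.\<close>

fun P :: "'w list \<Rightarrow> 'w list \<Rightarrow> 'a" where
  "P [] ys = I 0"
| "P (x # xs) ys = (I 1 \<parallel> P xs (remove1 x ys)) \<then>
     (S 1 (length (takeWhile (\<lambda>y. y \<noteq> x) ys)) \<parallel> I (length ys - Suc (length (takeWhile (\<lambda>y. y \<noteq> x) ys))))"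

text \<open>The working form of the recursion: when the target list is given already split at
  \<open>x\<close>, the position computed by \<open>takeWhile\<close> is just
  \<open>length a\<close>.\<close>

lemma P_Cons: "x \<notin> set a \<Longrightarrow>
    P (x # xs) (a @ x # b) = (I 1 \<parallel> P xs (a @ b)) \<then> (S 1 (length a) \<parallel> I (length b))"
  by (simp add: remove1_append takeWhile_append)

declare P.simps(2) [simp del]

lemma split_distinct:
  assumes "mset (x # xs) = mset ys" "distinct ys"
  obtains a b where "ys = a @ x # b" "x \<notin> set a" "mset xs = mset (a @ b)" "distinct (a @ b)" "x \<notin> set b"
proof -
  have "x \<in> set ys" using assms(1) by (metis list.set_intros(1) set_mset_mset)
  then obtain a b where "ys = a @ x # b" by (meson split_list)
  with assms show ?thesis by (intro that[of a b]) auto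
qed

lemma P_type:
  assumes "mset xs = mset ys" "distinct ys"
  shows "mo (P xs ys) \<and> dm (P xs ys) = length xs \<and> cd (P xs ys) = length xs"
  using assms
proof (induction xs arbitrary: ys)
  case (Cons x xs)
  obtain a b where ab: "ys = a @ x # b" "x \<notin> set a" "mset xs = mset (a @ b)" "distinct (a @ b)"
    using split_distinct[OF Cons.prems] by metis
  have l: "length xs = length a + length b" using ab(3) by (metis length_append size_mset)
  show ?case using Cons.IH[OF ab(3,4)] ab(1,2) l by (simp add: P_Cons)
qed simp

lemma mo_P [simp]: "\<lbrakk>mset xs = mset ys; distinct ys\<rbrakk> \<Longrightarrow> mo (P xs ys)"
  and dm_P [simp]: "\<lbrakk>mset xs = mset ys; distinct ys\<rbrakk> \<Longrightarrow> dm (P xs ys) = length xs"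
  and cd_P [simp]: "\<lbrakk>mset xs = mset ys; distinct ys\<rbrakk> \<Longrightarrow> cd (P xs ys) = length ys"
  using P_type[of xs ys] mset_eq_length[of xs ys] by simp_all

lemma P_refl [simp]: "distinct xs \<Longrightarrow> P xs xs = I (length xs)"
proof (induction xs)
  case (Cons x xs)
  then show ?case using P_Cons[of x "[]" xs xs] by simp
qed simp

text \<open>Naturality of the symmetry that takes one wire past the block containing
  \<open>S 1 c\<close>, with the long symmetry expanded by the hexagon. It says that the order in
  which two wires are routed can be exchanged at the price of crossing them beforehand.\<close>

lemma move_two: "(I 1 \<parallel> S 1 c \<parallel> I e) \<then> S 1 (c + 1 + e)
   = (S 1 1 \<parallel> I (c + e)) \<then> (I 1 \<parallel> S 1 (c + e)) \<then> (S 1 c \<parallel> I (e + 1))"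
proof -
  have "(I 1 \<parallel> (S 1 c \<parallel> I e)) \<then> S (cd (I 1)) (cd (S 1 c \<parallel> I e))
      = S (dm (I 1)) (dm (S 1 c \<parallel> I e)) \<then> ((S 1 c \<parallel> I e) \<parallel> I 1)"
    by (rule S_natural) simp_all
  moreover have "S 1 (1 + (c + e)) = (S 1 1 \<parallel> I (c + e)) \<then> (I 1 \<parallel> S 1 (c + e))"
    by (rule hexagon)
  ultimately show ?thesis by (simp add: add_ac)
qed

text \<open>\<open>move_two\<close> with the crossing moved to the other side, where it meets its
  own inverse.\<close>

lemma move_two': "(S 1 1 \<parallel> I (c + e)) \<then> (I 1 \<parallel> S 1 c \<parallel> I e) \<then> S 1 (c + 1 + e)
   = (I 1 \<parallel> S 1 (c + e)) \<then> (S 1 c \<parallel> I (e + 1))"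
proof -
  have "(S 1 1 \<parallel> I (c + e)) \<then> (I 1 \<parallel> S 1 c \<parallel> I e) \<then> S 1 (c + 1 + e)
     = ((S 1 1 \<parallel> I (c + e)) \<then> (S 1 1 \<parallel> I (c + e))) \<then> (I 1 \<parallel> S 1 (c + e)) \<then> (S 1 c \<parallel> I (e + 1))"
    by (simp only: move_two cp_assoc)
  also have "(S 1 1 \<parallel> I (c + e)) \<then> (S 1 1 \<parallel> I (c + e)) = I (c + e + 2)"
    by (subst cp_tn_I[symmetric]) simp_all
  finally show ?thesis by simp
qed

lemma length_split: "mset xs = mset (a @ b) \<Longrightarrow> length xs = length a + length b"
  by (metis length_append mset_eq_length)

text \<open>Any wire, not only the first, can be the one routed last. This gives functoriality.\<close>

lemma P_extract:
  assumes "mset (a @ b) = mset (c @ d)" "distinct (x # c @ d)"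
  shows "P (a @ x # b) (c @ x # d) =
    (S (length a) 1 \<parallel> I (length b)) \<then> (I 1 \<parallel> P (a @ b) (c @ d)) \<then> (S 1 (length c) \<parallel> I (length d))"
  using assms
proof (induction a arbitrary: c d)
  case Nil
  then show ?case using mset_eq_length[of b "c @ d"] by (simp add: P_Cons)
next
  case (Cons y a)
  have xy: "x \<noteq> y" using Cons.prems by (metis Un_iff distinct.simps(2) list.set_intros(1) mset_eq_setD set_append)
  let ?A = "length a" and ?B = "length b" and ?C = "length c" and ?D = "length d"
  obtain u v where uv: "c @ d = u @ y # v" "y \<notin> set u" "mset (a @ b) = mset (u @ v)" "distinct (u @ v)" "y \<notin> set v"
    using split_distinct[of y "a @ b" "c @ d"] Cons.prems by auto
  have SS: "S (Suc ?A) 1 = (I 1 \<parallel> S ?A 1) \<then> (S 1 1 \<parallel> I ?A)"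
    using hexagon2[of 1 ?A 1] by simp
  have lab: "length (a @ b) = length (u @ v)" using uv(3) by (rule mset_eq_length)
  define Q where "Q = P (a @ b) (u @ v)"
  have Q[simp]: "mo Q" "dm Q = ?A + ?B" "cd Q = length u + length v"
    using uv(3,4) lab by (simp_all add: Q_def)
  have xuv: "x \<notin> set u" "x \<notin> set v" using Cons.prems(2) uv(1) by auto
  \<comment> \<open>The crossing of \<open>x\<close> and \<open>y\<close> involves none of the
    remaining wires, so it passes \<open>Q\<close>.\<close>
  have sl: "(S 1 1 \<parallel> I (?A + ?B)) \<then> (I 2 \<parallel> Q) = (I 2 \<parallel> Q) \<then> (S 1 1 \<parallel> I (length u + length v))"
    using slide[of "S 1 1" Q] by (simp add: numeral_2_eq_2)
  have "c @ d = u @ y # v" by (fact uv)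
  \<comment> \<open>In the target, \<open>y\<close> lies either to the right of \<open>x\<close>
    (case 1) or to the left of it (case 2). In both cases the induction hypothesis routes
    \<open>x\<close> last among the wires other than \<open>y\<close>, and \<open>move_two\<close>
    or \<open>move_two'\<close> then exchanges the routing of \<open>x\<close> and
    \<open>y\<close>.\<close>
  then consider (1) w where "u = c @ w" "d = w @ y # v" | (2) w where "c = u @ y # w" "v = w @ d"
    by (auto simp: append_eq_append_conv2 append_eq_Cons_conv Cons_eq_append_conv)
  then show ?case
  proof cases
    case 1
    let ?W = "length w" and ?V = "length v"
    have "P (a @ x # b) (c @ x # w @ v) = (S ?A 1 \<parallel> I ?B) \<then> (I 1 \<parallel> Q) \<then> (S 1 ?C \<parallel> I (?W + ?V))"
      using Cons.IH[of c "w @ v"] uv(3,4) xuv 1 by (simp add: Q_def)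
    moreover have "P (y # a @ x # b) ((c @ x # w) @ y # v) =
        (I 1 \<parallel> P (a @ x # b) (c @ x # w @ v)) \<then> (S 1 (?C + 1 + ?W) \<parallel> I ?V)"
      by (subst P_Cons) (use uv(2) xy 1 in auto)
    ultimately have L: "P (y # a @ x # b) ((c @ x # w) @ y # v) = (I 1 \<parallel> S ?A 1 \<parallel> I ?B) \<then> (I 2 \<parallel> Q) \<then>
        (I 1 \<parallel> S 1 ?C \<parallel> I (?W + ?V)) \<then> (S 1 (?C + 1 + ?W) \<parallel> I ?V)"
      using 1 lab by (simp add: I_tn_cp numeral_2_eq_2)
    have R: "P (y # a @ b) ((c @ w) @ y # v) = (I 1 \<parallel> Q) \<then> (S 1 (?C + ?W) \<parallel> I ?V)"
      by (subst P_Cons) (use uv(2) 1 in \<open>auto simp: Q_def\<close>)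
    have M: "(I 1 \<parallel> S 1 ?C \<parallel> I (?W + ?V)) \<then> (S 1 (?C + 1 + ?W) \<parallel> I ?V) =
       (S 1 1 \<parallel> I (?C + ?W + ?V)) \<then> (I 1 \<parallel> S 1 (?C + ?W) \<parallel> I ?V) \<then> (S 1 ?C \<parallel> I (?W + 1 + ?V))"
      using arg_cong[OF move_two[of ?C ?W], of "\<lambda>z. z \<parallel> I ?V"] by (simp add: cp_tn_I)
    have "(S (Suc ?A) 1 \<parallel> I ?B) \<then> (I 1 \<parallel> P (y # a @ b) ((c @ w) @ y # v)) \<then> (S 1 ?C \<parallel> I (?W + 1 + ?V)) =
       (I 1 \<parallel> S ?A 1 \<parallel> I ?B) \<then> ((S 1 1 \<parallel> I (?A + ?B)) \<then> (I 2 \<parallel> Q)) \<then>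
       (I 1 \<parallel> S 1 (?C + ?W) \<parallel> I ?V) \<then> (S 1 ?C \<parallel> I (?W + 1 + ?V))"
      unfolding R SS using 1 lab by (simp add: I_tn_cp cp_tn_I numeral_2_eq_2)
    also have "\<dots> = (I 1 \<parallel> S ?A 1 \<parallel> I ?B) \<then> (I 2 \<parallel> Q) \<then> (S 1 1 \<parallel> I (?C + ?W + ?V)) \<then>
       (I 1 \<parallel> S 1 (?C + ?W) \<parallel> I ?V) \<then> (S 1 ?C \<parallel> I (?W + 1 + ?V))"
      unfolding sl using 1 by simp
    also have "\<dots> = P (y # a @ x # b) ((c @ x # w) @ y # v)"
      unfolding L M ..
    finally show ?thesis using 1 by simp
  next
    case 2
    let ?W = "length w" and ?U = "length u"
    have "P (a @ x # b) ((u @ w) @ x # d) = (S ?A 1 \<parallel> I ?B) \<then> (I 1 \<parallel> Q) \<then> (S 1 (?U + ?W) \<parallel> I ?D)"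
      using Cons.IH[of "u @ w" d] uv(3,4) xuv 2 by (simp add: Q_def)
    moreover have "P (y # a @ x # b) (u @ y # w @ x # d) =
        (I 1 \<parallel> P (a @ x # b) ((u @ w) @ x # d)) \<then> (S 1 ?U \<parallel> I (?W + 1 + ?D))"
      by (subst P_Cons) (use uv(2) xy 2 in auto)
    ultimately have L: "P (y # a @ x # b) (u @ y # w @ x # d) = (I 1 \<parallel> S ?A 1 \<parallel> I ?B) \<then> (I 2 \<parallel> Q) \<then>
        (I 1 \<parallel> S 1 (?U + ?W) \<parallel> I ?D) \<then> (S 1 ?U \<parallel> I (?W + 1 + ?D))"
      using 2 lab by (simp add: I_tn_cp numeral_2_eq_2)
    have R: "P (y # a @ b) (u @ y # w @ d) = (I 1 \<parallel> Q) \<then> (S 1 ?U \<parallel> I (?W + ?D))"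
      by (subst P_Cons) (use uv(2) 2 in \<open>auto simp: Q_def\<close>)
    have M: "(I 1 \<parallel> S 1 (?U + ?W) \<parallel> I ?D) \<then> (S 1 ?U \<parallel> I (?W + 1 + ?D)) =
       (S 1 1 \<parallel> I (?U + ?W + ?D)) \<then> (I 1 \<parallel> S 1 ?U \<parallel> I (?W + ?D)) \<then> (S 1 (?U + 1 + ?W) \<parallel> I ?D)"
      using arg_cong[OF move_two'[of ?U ?W], of "\<lambda>z. z \<parallel> I ?D"] by (simp add: cp_tn_I)
    have "(S (Suc ?A) 1 \<parallel> I ?B) \<then> (I 1 \<parallel> P (y # a @ b) (u @ y # w @ d)) \<then> (S 1 (?U + 1 + ?W) \<parallel> I ?D) =
       (I 1 \<parallel> S ?A 1 \<parallel> I ?B) \<then> ((S 1 1 \<parallel> I (?A + ?B)) \<then> (I 2 \<parallel> Q)) \<then>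
       (I 1 \<parallel> S 1 ?U \<parallel> I (?W + ?D)) \<then> (S 1 (?U + 1 + ?W) \<parallel> I ?D)"
      unfolding R SS using 2 lab by (simp add: I_tn_cp cp_tn_I numeral_2_eq_2)
    also have "\<dots> = (I 1 \<parallel> S ?A 1 \<parallel> I ?B) \<then> (I 2 \<parallel> Q) \<then> (S 1 1 \<parallel> I (?U + ?W + ?D)) \<then>
       (I 1 \<parallel> S 1 ?U \<parallel> I (?W + ?D)) \<then> (S 1 (?U + 1 + ?W) \<parallel> I ?D)"
      unfolding sl using 2 by (simp add: add.assoc)
    also have "\<dots> = P (y # a @ x # b) (u @ y # w @ x # d)"
      unfolding L M ..
    finally show ?thesis using 2 by simp
  qed
qed

text \<open>The head \<open>x\<close> is routed last in the first factor by definition, and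
  \<open>P_extract\<close> writes the second factor so that \<open>x\<close> is brought back to the
  front at once. The two symmetries in the middle cancel, and what is left is the claim for the
  lists without \<open>x\<close>.\<close>

lemma P_comp:
  assumes "mset xs = mset ys" "mset ys = mset zs" "distinct zs"
  shows "P xs ys \<then> P ys zs = P xs zs"
  using assms
proof (induction xs arbitrary: ys zs)
  case (Cons x xs)
  have dy: "distinct ys" using Cons.prems by (metis mset_eq_imp_distinct_iff)
  obtain a b where ab: "ys = a @ x # b" "x \<notin> set a" "mset xs = mset (a @ b)" "distinct (a @ b)" "x \<notin> set b"
    using split_distinct[OF Cons.prems(1) dy] by metis
  have "mset (x # xs) = mset zs" using Cons.prems by simp
  then obtain c d where cd: "zs = c @ x # d" "x \<notin> set c" "mset xs = mset (c @ d)" "distinct (c @ d)" "x \<notin> set d"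
    using split_distinct Cons.prems(3) by metis
  have abcd: "mset (a @ b) = mset (c @ d)" using ab(3) cd(3) by simp
  note len = length_split[OF ab(3)] length_split[OF cd(3)]
  define Q Q' where "Q = P xs (a @ b)" and "Q' = P (a @ b) (c @ d)"
  have Q[simp]: "mo Q" "dm Q = length xs" "cd Q = length a + length b" using ab(3,4) by (simp_all add: Q_def)
  have Q'[simp]: "mo Q'" "dm Q' = length a + length b" "cd Q' = length c + length d"
    using abcd cd(4) by (simp_all add: Q'_def)
  have QQ: "Q \<then> Q' = P xs (c @ d)" unfolding Q_def Q'_def
    using Cons.IH[OF ab(3) abcd cd(4)] .
  have "P ys zs = (S (length a) 1 \<parallel> I (length b)) \<then> (I 1 \<parallel> Q') \<then> (S 1 (length c) \<parallel> I (length d))"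
    unfolding ab(1) cd(1) Q'_def by (rule P_extract[OF abcd]) (use cd in auto)
  moreover have "P (x # xs) ys = (I 1 \<parallel> Q) \<then> (S 1 (length a) \<parallel> I (length b))"
    unfolding ab(1) Q_def by (rule P_Cons[OF ab(2)])
  ultimately have "P (x # xs) ys \<then> P ys zs = (I 1 \<parallel> Q) \<then> ((S 1 (length a) \<then> S (length a) 1) \<parallel> I (length b)) \<then>
     (I 1 \<parallel> Q') \<then> (S 1 (length c) \<parallel> I (length d))"
    by (subst cp_tn_I) simp_all
  also have "\<dots> = (I 1 \<parallel> Q) \<then> (I 1 \<parallel> Q') \<then> (S 1 (length c) \<parallel> I (length d))"
    by simp
  also have "\<dots> = ((I 1 \<parallel> Q) \<then> (I 1 \<parallel> Q')) \<then> (S 1 (length c) \<parallel> I (length d))"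
    by simp
  also have "(I 1 \<parallel> Q) \<then> (I 1 \<parallel> Q') = I 1 \<parallel> P xs (c @ d)"
    unfolding QQ[symmetric] by (rule I_tn_cp[symmetric]) simp_all
  also have "\<dots> \<then> (S 1 (length c) \<parallel> I (length d)) = P (x # xs) zs"
    unfolding cd(1) by (rule P_Cons[OF cd(2), symmetric])
  finally show ?case .
qed simp

lemma P_tensor:
  assumes "mset xs = mset ys" "mset xs' = mset ys'" "distinct (ys @ ys')"
  shows "P xs ys \<parallel> P xs' ys' = P (xs @ xs') (ys @ ys')"
  using assms
proof (induction xs arbitrary: ys)
  case (Cons x xs)
  have dy: "distinct ys" using Cons.prems by simp
  obtain a b where ab: "ys = a @ x # b" "x \<notin> set a" "mset xs = mset (a @ b)" "distinct (a @ b)" "x \<notin> set b"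
    using split_distinct[OF Cons.prems(1) dy] by metis
  note len = length_split[OF ab(3)]
  have d': "distinct ys'" using Cons.prems(3) by simp
  have IH: "P xs (a @ b) \<parallel> P xs' ys' = P (xs @ xs') (a @ b @ ys')"
    using Cons.IH[OF ab(3) Cons.prems(2)] Cons.prems(3) ab(1) by auto
  have "P (x # xs) ys \<parallel> P xs' ys' = ((I 1 \<parallel> P xs (a @ b)) \<then> (S 1 (length a) \<parallel> I (length b))) \<parallel>
     (P xs' ys' \<then> I (length ys'))"
    unfolding ab(1) P_Cons[OF ab(2)] using Cons.prems(2) d' by simp
  also have "\<dots> = (I 1 \<parallel> P xs (a @ b) \<parallel> P xs' ys') \<then> (S 1 (length a) \<parallel> I (length (b @ ys')))"
    using Cons.prems(2) d' ab by (subst interchange) simp_all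
  also have "\<dots> = P (x # xs @ xs') (a @ x # (b @ ys'))"
    unfolding IH by (rule P_Cons[OF ab(2), symmetric])
  finally show ?case using ab(1) by simp
qed simp

text \<open>\<open>hexagon2\<close> with a first block of width 1 is exactly the recursion of
  \<open>P\<close> on these lists.\<close>

lemma P_sym: "distinct (xs @ ys) \<Longrightarrow> P (xs @ ys) (ys @ xs) = S (length xs) (length ys)"
proof (induction xs)
  case (Cons x xs)
  have "P ((x # xs) @ ys) (ys @ x # xs) = (I 1 \<parallel> S (length xs) (length ys)) \<then> (S 1 (length ys) \<parallel> I (length xs))"
    using Cons by (simp add: P_Cons)
  also have "\<dots> = S (Suc (length xs)) (length ys)"
    using hexagon2[of 1 "length xs" "length ys"] by simp
  finally show ?case by simp
qed simp

end

section \<open>Evaluating sequences of hyperedges\<close>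

type_synonym 'o hedge = "'o \<times> nat list \<times> nat list"

abbreviation hlab :: "'o hedge \<Rightarrow> 'o" where "hlab e \<equiv> fst e"
abbreviation hsrc :: "'o hedge \<Rightarrow> nat list" where "hsrc e \<equiv> fst (snd e)"
abbreviation htgt :: "'o hedge \<Rightarrow> nat list" where "htgt e \<equiv> snd (snd e)"

section \<open>Admissible sequences of hyperedges\<close>

definition srcs :: "'o hedge multiset \<Rightarrow> nat multiset" where
  "srcs E = (\<Sum>e\<in>#E. mset (hsrc e))"

definition tgts :: "'o hedge multiset \<Rightarrow> nat multiset" where
  "tgts E = (\<Sum>e\<in>#E. mset (htgt e))"

lemma srcs_simps [simp]: "srcs {#} = {#}" "srcs (add_mset e E) = mset (hsrc e) + srcs E" "srcs (E + F) = srcs E + srcs F"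
  and tgts_simps [simp]: "tgts {#} = {#}" "tgts (add_mset e E) = mset (htgt e) + tgts E" "tgts (E + F) = tgts E + tgts F"
  by (simp_all add: srcs_def tgts_def)

text \<open>Wires are produced by the left interface \<open>xs\<close> or as targets, and consumed by the right interface
  \<open>ys\<close> or as sources.\<close>

definition monogamous :: "nat list \<Rightarrow> 'o hedge multiset \<Rightarrow> nat list \<Rightarrow> bool" where
  "monogamous xs E ys \<longleftrightarrow> mset xs + tgts E = mset ys + srcs E \<and> (\<forall>w. count (mset xs + tgts E) w \<le> 1)"

definition well_sorted :: "'o signature \<Rightarrow> 'o hedge multiset \<Rightarrow> bool" where
  "well_sorted Sg E \<longleftrightarrow> (\<forall>e \<in># E. hlab e \<in> ops Sg \<and> length (hsrc e) = arity Sg (hlab e) \<and>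
     length (htgt e) = coarity Sg (hlab e))"

text \<open>\<open>X\<close> collects the wires produced so far and keeps those already consumed,
  which makes the condition monotone in \<open>X\<close>. That no wire is consumed twice is the
  business of \<open>monogamous\<close>.\<close>

primrec linear_from :: "nat set \<Rightarrow> 'o hedge list \<Rightarrow> bool" where
  "linear_from X [] \<longleftrightarrow> True"
| "linear_from X (e # es) \<longleftrightarrow> set (hsrc e) \<subseteq> X \<and> linear_from (X \<union> set (htgt e)) es"

definition prog :: "'o signature \<Rightarrow> nat list \<Rightarrow> 'o hedge list \<Rightarrow> nat list \<Rightarrow> bool" where
  "prog Sg xs es ys \<longleftrightarrow> monogamous xs (mset es) ys \<and> well_sorted Sg (mset es) \<and> linear_from (set xs) es"

lemma well_sorted_simps [simp]: "well_sorted Sg {#}"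
  "well_sorted Sg (add_mset e E) \<longleftrightarrow> hlab e \<in> ops Sg \<and> length (hsrc e) = arity Sg (hlab e) \<and>
     length (htgt e) = coarity Sg (hlab e) \<and> well_sorted Sg E"
  "well_sorted Sg (E + F) \<longleftrightarrow> well_sorted Sg E \<and> well_sorted Sg F"
  by (auto simp: well_sorted_def)

lemma distinct_count: "distinct xs \<longleftrightarrow> (\<forall>w. count (mset xs) w \<le> 1)"
  by (induction xs) (auto simp: not_in_iff[symmetric] le_Suc_eq)

lemma linear_from_mono: "linear_from X es \<Longrightarrow> X \<subseteq> Y \<Longrightarrow> linear_from Y es"
proof (induction es arbitrary: X Y)
  case (Cons e es)
  have "X \<union> set (htgt e) \<subseteq> Y \<union> set (htgt e)" using Cons.prems(2) by blast
  then show ?case using Cons.prems Cons.IH by auto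
qed simp

text \<open>Lets the wires consumed by one hyperedge be dropped from the available set: by monogamy
  no later hyperedge consumes them again.\<close>

lemma linear_from_Diff:
  "linear_from X es \<Longrightarrow> A \<inter> set_mset (srcs (mset es)) = {} \<Longrightarrow> linear_from (X - A) es"
proof (induction es arbitrary: X)
  case (Cons e es)
  then have "linear_from ((X \<union> set (htgt e)) - A) es" by auto
  then have "linear_from (X - A \<union> set (htgt e)) es" by (rule linear_from_mono) auto
  then show ?case using Cons.prems by auto
qed simp

lemma linear_from_append: "linear_from X (es @ fs) \<longleftrightarrow> linear_from X es \<and> linear_from (X \<union> set_mset (tgts (mset es))) fs"
  by (induction es arbitrary: X) (auto simp: Un_assoc)

lemma prog_Nil [simp]: "prog Sg xs [] ys \<longleftrightarrow> mset xs = mset ys \<and> distinct ys"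
  by (auto simp: prog_def monogamous_def distinct_count)

lemma count_le_disjoint:
  assumes "\<forall>w. count (M + N) w \<le> (1::nat)"
  shows "set_mset M \<inter> set_mset N = {}"
proof -
  have "\<not> (w \<in># M \<and> w \<in># N)" for w
    using assms[rule_format, of w] unfolding count_greater_zero_iff[symmetric] by (simp del: count_greater_zero_iff) linarith
  then show ?thesis by blast
qed

lemma count_le_mono: "\<forall>w. count M w \<le> (1::nat) \<Longrightarrow> N \<subseteq># M \<Longrightarrow> \<forall>w. count N w \<le> 1"
  by (meson dual_order.trans mset_subset_eq_count)

lemma monogamous_srcs: "monogamous xs E ys \<Longrightarrow> \<forall>w. count (mset ys + srcs E) w \<le> 1"
  by (metis monogamous_def)

lemma prog_distinct:
  assumes "prog Sg xs es ys"
  shows "distinct xs" "distinct ys"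
proof -
  have m: "monogamous xs (mset es) ys" using assms by (simp add: prog_def)
  show "distinct xs" unfolding distinct_count
    using m unfolding monogamous_def by (meson count_le_mono mset_subset_eq_add_left)
  show "distinct ys" unfolding distinct_count
    using monogamous_srcs[OF m] by (meson count_le_mono mset_subset_eq_add_left)
qed

lemma prog_perm: "prog Sg xs es ys \<Longrightarrow> mset xs = mset xs' \<Longrightarrow> mset ys = mset ys' \<Longrightarrow> prog Sg xs' es ys'"
  unfolding prog_def monogamous_def by (metis mset_eq_setD)

lemma mset_split_off:
  assumes "distinct xs" "distinct as" "set as \<subseteq> set xs"
  shows "\<exists>rest. mset xs = mset (as @ rest)"
proof -
  have "mset as = mset (filter (\<lambda>w. w \<in> set as) xs)"
    using assms by (subst set_eq_iff_mset_eq_distinct[symmetric]) auto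
  then show ?thesis by (metis mset_append mset_filter multiset_partition)
qed

text \<open>Performing the first hyperedge leads to an admissible sequence again. The order of the
  idle wires \<open>rest\<close> is left open because later arguments choose it to suit them. The
  last conclusion, that \<open>e\<close> consumes nothing a later hyperedge consumes, is what allows
  hyperedges to be exchanged.\<close>

lemma prog_Cons:
  assumes "prog Sg xs (e # es) ys"
  shows "\<exists>rest. mset xs = mset (hsrc e @ rest)"
    and "distinct (hsrc e)"
    and "hlab e \<in> ops Sg" "length (hsrc e) = arity Sg (hlab e)" "length (htgt e) = coarity Sg (hlab e)"
    and "mset xs = mset (hsrc e @ rest) \<Longrightarrow> prog Sg (htgt e @ rest) es ys"
    and "mset xs = mset (hsrc e @ rest) \<Longrightarrow> distinct (htgt e @ rest) \<and> distinct (hsrc e @ rest)"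
    and "set (hsrc e) \<inter> set_mset (srcs (mset es)) = {}"
proof -
  have m: "monogamous xs (mset (e # es)) ys" and s: "well_sorted Sg (mset (e # es))"
    and l: "linear_from (set xs) (e # es)"
    using assms by (auto simp: prog_def)
  show "hlab e \<in> ops Sg" "length (hsrc e) = arity Sg (hlab e)" "length (htgt e) = coarity Sg (hlab e)"
    using s by auto
  have c: "\<forall>w. count (mset ys + (mset (hsrc e) + srcs (mset es))) w \<le> 1"
    using monogamous_srcs[OF m] by simp
  show ds: "distinct (hsrc e)" unfolding distinct_count
    using c by (rule count_le_mono) (simp add: add.commute add.left_commute)
  have c': "\<forall>w. count (mset (hsrc e) + srcs (mset es)) w \<le> 1"
    using c by (rule count_le_mono) simp
  then show disj: "set (hsrc e) \<inter> set_mset (srcs (mset es)) = {}"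
    using count_le_disjoint by fastforce
  show "\<exists>rest. mset xs = mset (hsrc e @ rest)"
    using mset_split_off[OF prog_distinct(1)[OF assms] ds] l by simp
  assume r: "mset xs = mset (hsrc e @ rest)"
  have m': "mset (htgt e @ rest) + tgts (mset es) = mset ys + srcs (mset es)"
  proof -
    have "mset (hsrc e) + (mset (htgt e @ rest) + tgts (mset es)) = mset (hsrc e) + (mset ys + srcs (mset es))"
      using m r by (simp add: monogamous_def ac_simps)
    then show ?thesis by simp
  qed
  have "\<forall>w. count (mset ys + srcs (mset es)) w \<le> 1"
    using c by (rule count_le_mono) simp
  with m' have m2: "monogamous (htgt e @ rest) (mset es) ys"
    by (simp add: monogamous_def)
  have dx: "distinct (hsrc e @ rest)" using prog_distinct(1)[OF assms] r by (metis mset_eq_imp_distinct_iff)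
  have "linear_from (set xs \<union> set (htgt e)) es" using l by simp
  then have "linear_from ((set xs \<union> set (htgt e)) - set (hsrc e)) es"
    using disj by (rule linear_from_Diff)
  then have "linear_from (set (htgt e @ rest)) es"
    by (rule linear_from_mono) (use mset_eq_setD[OF r] in auto)
  with m2 s show p: "prog Sg (htgt e @ rest) es ys" by (auto simp: prog_def)
  show "distinct (htgt e @ rest) \<and> distinct (hsrc e @ rest)" using dx prog_distinct[OF p] by simp
qed

section \<open>Values of admissible sequences in a PROP\<close>

locale prop_algebra_gen = prop_algebra mo dm cd I S cp tn
  for mo :: "'a \<Rightarrow> bool" and dm cd I S and cp (infixr "\<then>" 60) and tn (infixr "\<parallel>" 70) +
  fixes Sg :: "'o signature" and G :: "'o \<Rightarrow> 'a"
  assumes mo_G [simp]: "g \<in> ops Sg \<Longrightarrow> mo (G g)"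
    and dm_G [simp]: "g \<in> ops Sg \<Longrightarrow> dm (G g) = arity Sg g"
    and cd_G [simp]: "g \<in> ops Sg \<Longrightarrow> cd (G g) = coarity Sg g"
begin

text \<open>\<open>filter\<close> merely fixes one order of the idle wires so that the value is a
  function of the sequence; \<open>val_step\<close> later admits every other order.\<close>

primrec val :: "nat list \<Rightarrow> 'o hedge list \<Rightarrow> nat list \<Rightarrow> 'a" where
  "val xs [] ys = P xs ys"
| "val xs (e # es) ys = (let rest = filter (\<lambda>w. w \<notin> set (hsrc e)) xs in
     P xs (hsrc e @ rest) \<then> (G (hlab e) \<parallel> I (length rest)) \<then> val (htgt e @ rest) es ys)"

lemma P_sym_tensor:
  assumes "distinct (xs @ ys @ zs)"
  shows "P (xs @ ys @ zs) (ys @ xs @ zs) = S (length xs) (length ys) \<parallel> I (length zs)"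
proof -
  have "distinct (xs @ ys)" "distinct zs" "distinct ((ys @ xs) @ zs)" using assms by auto
  then show ?thesis using P_tensor[of "xs @ ys" "ys @ xs" zs zs] P_sym[of xs ys] by simp
qed

lemma prog_filter:
  assumes "prog Sg xs (e # es) ys"
  shows "mset xs = mset (hsrc e @ filter (\<lambda>w. w \<notin> set (hsrc e)) xs)"
proof -
  obtain rest where r: "mset xs = mset (hsrc e @ rest)" using prog_Cons(1)[OF assms] by blast
  have d: "distinct (hsrc e @ rest)" using prog_Cons(7)[OF assms r] by simp
  have "mset (filter (\<lambda>w. w \<notin> set (hsrc e)) xs) = mset (filter (\<lambda>w. w \<notin> set (hsrc e)) (hsrc e @ rest))"
    unfolding mset_filter r ..
  also have "filter (\<lambda>w. w \<notin> set (hsrc e)) (hsrc e @ rest) = rest" using d by (auto simp: filter_id_conv filter_empty_conv)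
  finally show ?thesis using r by simp
qed

lemma val_type:
  "prog Sg xs es ys \<Longrightarrow> mo (val xs es ys) \<and> dm (val xs es ys) = length xs \<and> cd (val xs es ys) = length ys"
proof (induction es arbitrary: xs)
  case (Cons e es)
  let ?r = "filter (\<lambda>w. w \<notin> set (hsrc e)) xs"
  note f = prog_filter[OF Cons.prems]
  note t = prog_Cons(6,7)[OF Cons.prems f] and g = prog_Cons(3-5)[OF Cons.prems]
  show ?case using Cons.IH[OF t(1)] g t(2) f by (simp add: Let_def)
qed simp

lemma mo_val [simp]: "prog Sg xs es ys \<Longrightarrow> mo (val xs es ys)"
  and dm_val [simp]: "prog Sg xs es ys \<Longrightarrow> dm (val xs es ys) = length xs"
  and cd_val [simp]: "prog Sg xs es ys \<Longrightarrow> cd (val xs es ys) = length ys"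
  using val_type by blast+

text \<open>Two claims that need each other, hence one induction. Changing the order of idle wires
  in a step hands a permutation on to the value of the tail, which has to absorb it; absorbing a
  permutation in front of a nonempty sequence in turn needs a step with the same \<open>rest\<close>
  on both sides.\<close>

lemma val_perm_left_step:
  "(prog Sg xs' es ys \<longrightarrow> mset xs = mset xs' \<longrightarrow> P xs xs' \<then> val xs' es ys = val xs es ys) \<and>
   (prog Sg xs (e # es) ys \<longrightarrow> mset xs = mset (hsrc e @ rest) \<longrightarrow>
     val xs (e # es) ys = P xs (hsrc e @ rest) \<then> (G (hlab e) \<parallel> I (length rest)) \<then> val (htgt e @ rest) es ys)"
proof (induction es arbitrary: xs xs' e rest)
  have step: "val xs (e # es) ys = P xs (hsrc e @ rest) \<then> (G (hlab e) \<parallel> I (length rest)) \<then> val (htgt e @ rest) es ys"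
    if IH: "\<And>xs xs'. prog Sg xs' es ys \<Longrightarrow> mset xs = mset xs' \<Longrightarrow> P xs xs' \<then> val xs' es ys = val xs es ys"
      and p: "prog Sg xs (e # es) ys" and r: "mset xs = mset (hsrc e @ rest)" for es xs e rest
  proof -
    let ?r = "filter (\<lambda>w. w \<notin> set (hsrc e)) xs"
    note f = prog_filter[OF p]
    note t = prog_Cons(6,7)[OF p f] prog_Cons(6,7)[OF p r] and g = prog_Cons(3-5)[OF p]
    have rr: "mset ?r = mset rest" using f r by simp
    have d: "distinct rest" "distinct (htgt e)" "distinct (hsrc e)" using t by auto
    let ?Q = "P ?r rest"
    have Q: "mo ?Q" "dm ?Q = length ?r" "cd ?Q = length rest" using d rr by simp_all
    have "P (htgt e @ ?r) (htgt e @ rest) = I (coarity Sg (hlab e)) \<parallel> ?Q"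
      using P_tensor[of "htgt e" "htgt e" ?r rest] rr t(4) g by simp
    moreover have "val (htgt e @ ?r) es ys = P (htgt e @ ?r) (htgt e @ rest) \<then> val (htgt e @ rest) es ys"
      by (rule IH[symmetric]) (use t rr in auto)
    ultimately have "val xs (e # es) ys = P xs (hsrc e @ ?r) \<then>
        ((G (hlab e) \<parallel> I (dm ?Q)) \<then> (I (cd (G (hlab e))) \<parallel> ?Q)) \<then> val (htgt e @ rest) es ys"
      unfolding Q using g by (simp add: Let_def)
    \<comment> \<open>The permutation \<open>?Q\<close> concerns idle wires only, so it slides from
      behind the operation to a place before it, where it merges with the permutation already
      there.\<close>
    also have "\<dots> = (P xs (hsrc e @ ?r) \<then> (I (length (hsrc e)) \<parallel> ?Q)) \<then>
        (G (hlab e) \<parallel> I (length rest)) \<then> val (htgt e @ rest) es ys"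
      using g Q by (subst slide) simp_all
    also have "I (length (hsrc e)) \<parallel> ?Q = P (hsrc e @ ?r) (hsrc e @ rest)"
      using P_tensor[of "hsrc e" "hsrc e" ?r rest] rr t(4) d by simp
    also have "P xs (hsrc e @ ?r) \<then> P (hsrc e @ ?r) (hsrc e @ rest) = P xs (hsrc e @ rest)"
      by (rule P_comp) (use f rr t in auto)
    finally show ?thesis by simp
  qed
  {
    case Nil
    have "P xs xs' \<then> val xs' [] ys = val xs [] ys" if "prog Sg xs' [] ys" "mset xs = mset xs'" for xs xs'
      using that by (simp add: P_comp)
    then show ?case using step[of "[]"] by blast
  next
    case (Cons e' es)
    have IH1: "P xs xs' \<then> val xs' es ys = val xs es ys"
      if "prog Sg xs' es ys" "mset xs = mset xs'" for xs xs' using Cons.IH that by blast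
    have *: "P xs xs' \<then> val xs' (e' # es) ys = val xs (e' # es) ys"
      if p: "prog Sg xs' (e' # es) ys" "mset xs = mset xs'" for xs xs'
    proof -
      obtain r where r: "mset xs' = mset (hsrc e' @ r)" using prog_Cons(1)[OF p(1)] by blast
      have p2: "prog Sg xs (e' # es) ys" using prog_perm[OF p(1)] p(2) by metis
      have r2: "mset xs = mset (hsrc e' @ r)" using p(2) r by simp
      have "P xs xs' \<then> val xs' (e' # es) ys =
        (P xs xs' \<then> P xs' (hsrc e' @ r)) \<then> (G (hlab e') \<parallel> I (length r)) \<then> val (htgt e' @ r) es ys"
        using step[OF IH1 p(1) r] by simp
      also have "P xs xs' \<then> P xs' (hsrc e' @ r) = P xs (hsrc e' @ r)"
        by (rule P_comp) (use p r prog_Cons(7)[OF p(1) r] in auto)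
      finally show ?thesis using step[OF IH1 p2 r2] by simp
    qed
    show ?case using * step[of "e' # es", OF *] by blast
  }
qed

lemma val_perm_left: "prog Sg xs' es ys \<Longrightarrow> mset xs = mset xs' \<Longrightarrow> P xs xs' \<then> val xs' es ys = val xs es ys"
  using val_perm_left_step by blast

lemma val_step: "prog Sg xs (e # es) ys \<Longrightarrow> mset xs = mset (hsrc e @ rest) \<Longrightarrow>
   val xs (e # es) ys = P xs (hsrc e @ rest) \<then> (G (hlab e) \<parallel> I (length rest)) \<then> val (htgt e @ rest) es ys"
  using val_perm_left_step by blast

declare val.simps(2) [simp del]

lemma val_perm_right: "prog Sg xs es ys \<Longrightarrow> mset ys = mset ys' \<Longrightarrow> val xs es ys \<then> P ys ys' = val xs es ys'"
proof (induction es arbitrary: xs)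
  case Nil
  then have "distinct ys'" by (metis mset_eq_imp_distinct_iff prog_distinct(2))
  then show ?case using Nil by (simp add: P_comp)
next
  case (Cons e es)
  obtain r where r: "mset xs = mset (hsrc e @ r)" using prog_Cons(1)[OF Cons.prems(1)] by blast
  have p: "prog Sg xs (e # es) ys'" using prog_perm[OF Cons.prems(1)] Cons.prems(2) by blast
  show ?case
    using Cons.IH[OF prog_Cons(6)[OF Cons.prems(1) r] Cons.prems(2)]
      val_step[OF Cons.prems(1) r] val_step[OF p r] by simp
qed

text \<open>Extra wires on the right simply join \<open>rest\<close> in every step.\<close>

lemma val_tensor_I:
  assumes "prog Sg xs es ys" "prog Sg (xs @ zs) es (ys @ zs)"
  shows "val xs es ys \<parallel> I (length zs) = val (xs @ zs) es (ys @ zs)"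
  using assms
proof (induction es arbitrary: xs)
  case Nil
  then show ?case using P_tensor[of xs ys zs zs] by simp
next
  case (Cons e es)
  note p = Cons.prems(1)
  obtain r where r: "mset xs = mset (hsrc e @ r)" using prog_Cons(1)[OF p] by blast
  have r2: "mset (xs @ zs) = mset (hsrc e @ (r @ zs))" using r by simp
  note t = prog_Cons(6)[OF p r] prog_Cons(7)[OF p r] prog_Cons(6)[OF Cons.prems(2) r2]
    prog_Cons(7)[OF Cons.prems(2) r2]
  note g = prog_Cons(3-5)[OF p]
  have "P xs (hsrc e @ r) \<parallel> I (length zs) = P (xs @ zs) (hsrc e @ r @ zs)"
    using P_tensor[OF r, of zs zs] t(4) by simp
  moreover have "val xs (e # es) ys \<parallel> I (length zs) = (P xs (hsrc e @ r) \<parallel> I (length zs)) \<then>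
      (G (hlab e) \<parallel> I (length r + length zs)) \<then> (val (htgt e @ r) es ys \<parallel> I (length zs))"
    using t g r by (simp add: val_step[OF p r] cp_tn_I)
  moreover have "val (htgt e @ r) es ys \<parallel> I (length zs) = val (htgt e @ r @ zs) es (ys @ zs)"
    using Cons.IH[OF t(1)] t(3) by simp
  ultimately show ?case using val_step[OF Cons.prems(2) r2] by simp
qed

text \<open>A step puts the sources of its hyperedge at the front, so extra wires on the left are
  not a special case of \<open>rest\<close>. Conjugation with symmetries moves them to the right,
  and naturality returns them.\<close>

lemma val_I_tensor:
  assumes "prog Sg xs es ys" "prog Sg (zs @ xs) es (zs @ ys)"
  shows "I (length zs) \<parallel> val xs es ys = val (zs @ xs) es (zs @ ys)"
proof -
  have p: "prog Sg (xs @ zs) es (ys @ zs)" using prog_perm[OF assms(2)] by simp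
  have d: "distinct (zs @ xs)" "distinct (ys @ zs)"
    using prog_distinct[OF assms(2)] prog_distinct[OF p] by auto
  have "val (zs @ xs) es (zs @ ys) = P (zs @ xs) (xs @ zs) \<then> val (xs @ zs) es (ys @ zs) \<then> P (ys @ zs) (zs @ ys)"
    using val_perm_left[OF prog_perm[OF p], of "xs @ zs" "zs @ ys" "zs @ xs"] val_perm_right[OF p, of "zs @ ys"]
    by simp
  also have "\<dots> = S (length zs) (length xs) \<then> (val xs es ys \<parallel> I (length zs)) \<then> S (length ys) (length zs)"
    using d P_sym[of zs xs] P_sym[of ys zs] val_tensor_I[OF assms(1) p] by simp
  also have "\<dots> = S (length zs) (length xs) \<then> S (length xs) (length zs) \<then> (I (length zs) \<parallel> val xs es ys)"
    using S_natural[of "val xs es ys" "I (length zs)"] assms(1) by simp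
  also have "\<dots> = I (length zs) \<parallel> val xs es ys" using assms(1) by simp
  finally show ?thesis ..
qed

lemma val_comp:
  assumes "prog Sg xs es ys" "prog Sg ys fs zs" "prog Sg xs (es @ fs) zs"
  shows "val xs es ys \<then> val ys fs zs = val xs (es @ fs) zs"
  using assms
proof (induction es arbitrary: xs)
  case Nil
  then show ?case by (simp add: val_perm_left)
next
  case (Cons e es)
  obtain r where r: "mset xs = mset (hsrc e @ r)" using prog_Cons(1)[OF Cons.prems(1)] by blast
  have p: "prog Sg xs (e # es @ fs) zs" using Cons.prems(3) by simp
  show ?case using Cons.IH[OF prog_Cons(6)[OF Cons.prems(1) r] Cons.prems(2) prog_Cons(6)[OF p r]]
      val_step[OF Cons.prems(1) r] val_step[OF p r] by simp
qed

text \<open>By \<open>slide1\<close> the two factors run one after the other, each with the wires of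
  the other one idle; then \<open>val_comp\<close> joins the sequences.\<close>

lemma val_tensor:
  assumes "prog Sg xs es ys" "prog Sg xs' fs ys'" "prog Sg (xs @ xs') es (ys @ xs')"
    "prog Sg (ys @ xs') fs (ys @ ys')" "prog Sg (xs @ xs') (es @ fs) (ys @ ys')"
  shows "val xs es ys \<parallel> val xs' fs ys' = val (xs @ xs') (es @ fs) (ys @ ys')"
proof -
  have "val xs es ys \<parallel> val xs' fs ys' = (val xs es ys \<parallel> I (length xs')) \<then> (I (length ys) \<parallel> val xs' fs ys')"
    using assms(1,2) by (simp add: slide1)
  then show ?thesis
    using val_tensor_I[OF assms(1,3)] val_I_tensor[OF assms(2,4)] val_comp[OF assms(3,4,5)] by simp
qed

text \<open>Independence is expressed by \<open>f\<close> finding its sources already in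
  \<open>xs\<close>. Both orders are brought to the same form, in which the two operations stand
  side by side next to the idle wires \<open>u\<close>.\<close>

lemma val_swap:
  assumes p: "prog Sg xs (e # f # es) ys" and s: "set (hsrc f) \<subseteq> set xs"
  shows "prog Sg xs (f # e # es) ys" "val xs (f # e # es) ys = val xs (e # f # es) ys"
proof -
  have "linear_from (set xs \<union> set (htgt f) \<union> set (htgt e)) es"
    using p by (auto simp: prog_def intro: linear_from_mono)
  then show q: "prog Sg xs (f # e # es) ys"
    using p s by (auto simp: prog_def add_mset_commute)
  obtain r where r: "mset xs = mset (hsrc e @ r)" using prog_Cons(1)[OF p] by blast
  note t = prog_Cons(6)[OF p r]
  have "set (hsrc f) \<inter> set (hsrc e) = {}" using prog_Cons(8)[OF p] by auto
  then have "set (hsrc f) \<subseteq> set r" using s mset_eq_setD[OF r] by auto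
  moreover have "distinct r" using prog_Cons(7)[OF p r] by simp
  ultimately obtain u where u: "mset r = mset (hsrc f @ u)"
    using mset_split_off prog_Cons(2)[OF q] by metis
  let ?a = "hsrc e" and ?b = "htgt e" and ?c = "hsrc f" and ?d = "htgt f"
  let ?g = "G (hlab e)" and ?h = "G (hlab f)"
  have xe: "mset xs = mset (?a @ ?c @ u)" and xf: "mset xs = mset (?c @ ?a @ u)" using r u by simp_all
  note t1 = prog_Cons(6,7)[OF p xe] and t2 = prog_Cons(6,7)[OF q xf]
  have b1: "mset (?b @ ?c @ u) = mset (?c @ ?b @ u)" and b2: "mset (?d @ ?a @ u) = mset (?a @ ?d @ u)" by simp_all
  note t3 = prog_Cons(6,7)[OF t1(1) b1] and t4 = prog_Cons(6,7)[OF t2(1) b2]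
  note g = prog_Cons(3-5)[OF p] prog_Cons(3-5)[OF q]
  have len: "length ?a = arity Sg (hlab e)" "length ?b = coarity Sg (hlab e)"
    "length ?c = arity Sg (hlab f)" "length ?d = coarity Sg (hlab f)" using g by auto
  let ?u = "I (length u)" and ?V = "val (?d @ ?b @ u) es ys"
  have P1: "P (?b @ ?c @ u) (?c @ ?b @ u) = S (length ?b) (length ?c) \<parallel> ?u"
    by (rule P_sym_tensor) (use t1 in simp)
  have P2: "P (?d @ ?a @ u) (?a @ ?d @ u) = S (length ?d) (length ?a) \<parallel> ?u"
    by (rule P_sym_tensor) (use t2 in simp)
  have P3: "P (?d @ ?b @ u) (?b @ ?d @ u) = S (length ?d) (length ?b) \<parallel> ?u"
    by (rule P_sym_tensor) (use t3 in simp)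
  have P4: "P xs (?a @ ?c @ u) \<then> (S (length ?a) (length ?c) \<parallel> ?u) = P xs (?c @ ?a @ u)"
  proof -
    have "P (?a @ ?c @ u) (?c @ ?a @ u) = S (length ?a) (length ?c) \<parallel> ?u"
      by (rule P_sym_tensor) (use t1 in simp)
    then show ?thesis using P_comp[OF xe, of "?c @ ?a @ u"] xe t2 by simp
  qed
  \<comment> \<open>Each order needs one application of naturality: \<open>N1\<close> carries the
    operation of \<open>e\<close> across the sources of \<open>f\<close>, and \<open>N2\<close>
    carries it across the targets of \<open>f\<close>.\<close>
  have N1: "(?g \<parallel> I (length ?c)) \<then> S (length ?b) (length ?c) = S (length ?a) (length ?c) \<then> (I (length ?c) \<parallel> ?g)"
    using S_natural[of ?g "I (length ?c)"] g len by simp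
  have N2: "S (length ?d) (length ?a) \<then> (?g \<parallel> I (length ?d)) = (I (length ?d) \<parallel> ?g) \<then> S (length ?d) (length ?b)"
    using S_natural[of "I (length ?d)" ?g] g len by simp
  have "val xs (e # f # es) ys = P xs (?a @ ?c @ u) \<then>
      (((?g \<parallel> I (length ?c)) \<then> S (length ?b) (length ?c)) \<parallel> ?u) \<then> (?h \<parallel> I (length (?b @ u))) \<then> ?V"
    using val_step[OF p xe] val_step[OF t1(1) b1] P1 g len by (simp add: cp_tn_I)
  also have "\<dots> = (P xs (?a @ ?c @ u) \<then> (S (length ?a) (length ?c) \<parallel> ?u)) \<then>
      ((I (length ?c) \<parallel> (?g \<parallel> ?u)) \<then> (?h \<parallel> I (length (?b @ u)))) \<then> ?V"
    unfolding N1 using g len by (simp add: cp_tn_I)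
  also have "\<dots> = P xs (?c @ ?a @ u) \<then> (?h \<parallel> ?g \<parallel> ?u) \<then> ?V"
    unfolding P4 using g len by (subst slide2) simp_all
  finally have L: "val xs (e # f # es) ys = P xs (?c @ ?a @ u) \<then> (?h \<parallel> ?g \<parallel> ?u) \<then> ?V" .
  have V: "?V = (S (length ?d) (length ?b) \<parallel> ?u) \<then> val (?b @ ?d @ u) es ys"
    unfolding P3[symmetric] by (rule val_perm_left[symmetric]) (use t4 in auto)
  have "val xs (f # e # es) ys = P xs (?c @ ?a @ u) \<then> (?h \<parallel> I (length ?a + length u)) \<then>
      ((S (length ?d) (length ?a) \<then> (?g \<parallel> I (length ?d))) \<parallel> ?u) \<then> val (?b @ ?d @ u) es ys"
    using val_step[OF q xf] val_step[OF t2(1) b2] P2 g len by (simp add: cp_tn_I)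
  also have "\<dots> = P xs (?c @ ?a @ u) \<then> ((?h \<parallel> I (length ?a + length u)) \<then> (I (length ?d) \<parallel> (?g \<parallel> ?u))) \<then> ?V"
    unfolding N2 V using g len by (simp add: cp_tn_I)
  also have "\<dots> = P xs (?c @ ?a @ u) \<then> (?h \<parallel> ?g \<parallel> ?u) \<then> ?V"
    using g len by (subst slide1) simp_all
  finally show "val xs (f # e # es) ys = val xs (e # f # es) ys" using L by simp
qed

text \<open>The hyperedges in \<open>pre\<close> do not consume the sources of \<open>e\<close>, so
  these stay available while \<open>e\<close> moves forward. Admissibility is part of the conclusion
  because the exchange with the next hyperedge asks for it.\<close>

lemma val_bubble:
  assumes "prog Sg xs (pre @ e # post) ys" "set (hsrc e) \<subseteq> set xs"
  shows "prog Sg xs (e # pre @ post) ys \<and> val xs (e # pre @ post) ys = val xs (pre @ e # post) ys"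
  using assms
proof (induction pre arbitrary: xs)
  case (Cons f pre)
  have p: "prog Sg xs (f # pre @ e # post) ys" using Cons.prems by simp
  obtain r where r: "mset xs = mset (hsrc f @ r)" using prog_Cons(1)[OF p] by blast
  have "set (hsrc f) \<inter> set (hsrc e) = {}" using prog_Cons(8)[OF p] by auto
  then have s: "set (hsrc e) \<subseteq> set (htgt f @ r)" using Cons.prems(2) mset_eq_setD[OF r] by auto
  note IH = Cons.IH[OF prog_Cons(6)[OF p r] s]
  have "linear_from (set xs) (f # e # pre @ post)"
    using p Cons.prems(2) mset_eq_setD[OF r] IH
    by (auto simp: prog_def elim: linear_from_mono)
  then have p2: "prog Sg xs (f # e # pre @ post) ys" using p by (simp add: prog_def)
  have "val xs (f # e # pre @ post) ys = val xs (f # pre @ e # post) ys"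
    using val_step[OF p r] val_step[OF p2 r] IH by simp
  then show ?case using val_swap[OF p2 Cons.prems(2)] by simp
qed simp

text \<open>The head of the first sequence has all its sources in \<open>xs\<close>. It can
  therefore be moved to the front of the second sequence, after which the heads agree and the tails
  are compared by induction.\<close>

lemma val_mset_eq:
  assumes "prog Sg xs es ys" "prog Sg xs fs ys" "mset es = mset fs"
  shows "val xs es ys = val xs fs ys"
  using assms
proof (induction es arbitrary: xs fs)
  case (Cons e es)
  have "e \<in> set fs" using Cons.prems(3) by (metis list.set_intros(1) set_mset_mset)
  then obtain pre post where fs: "fs = pre @ e # post" by (meson split_list)
  have s: "set (hsrc e) \<subseteq> set xs" using Cons.prems(1) by (simp add: prog_def)
  note b = val_bubble[OF Cons.prems(2)[unfolded fs] s]
  obtain r where r: "mset xs = mset (hsrc e @ r)" using prog_Cons(1)[OF Cons.prems(1)] by blast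
  have "val (htgt e @ r) es ys = val (htgt e @ r) (pre @ post) ys"
    using Cons.IH[OF prog_Cons(6)[OF Cons.prems(1) r], of "pre @ post"] b Cons.prems(3) fs
      prog_Cons(6)[OF conjunct1[OF b] r] by simp
  then have "val xs (e # es) ys = val xs (e # pre @ post) ys"
    using val_step[OF Cons.prems(1) r] val_step[OF conjunct1[OF b] r] by simp
  then show ?case using b fs by simp
qed simp

end

section \<open>Terms and the diagrams they denote\<close>

definition wires :: "nat list \<Rightarrow> 'o hedge multiset \<Rightarrow> nat set" where
  "wires xs E = set xs \<union> set_mset (tgts E)"

text \<open>The names of the wires are arbitrary, so the two parts of a composite must be kept from sharing
  a name by accident.\<close>

primrec denotes :: "'o signature \<Rightarrow> 'o pterm \<Rightarrow> nat list \<Rightarrow> 'o hedge multiset \<Rightarrow> nat list \<Rightarrow> bool" where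
  "denotes Sg (TId n) xs E ys \<longleftrightarrow> length xs = n \<and> distinct xs \<and> E = {#} \<and> ys = xs"
| "denotes Sg (TSym n m) xs E ys \<longleftrightarrow> distinct xs \<and> E = {#} \<and>
     (\<exists>us vs. length us = n \<and> length vs = m \<and> xs = us @ vs \<and> ys = vs @ us)"
| "denotes Sg (TGen g) xs E ys \<longleftrightarrow> length xs = arity Sg g \<and> length ys = coarity Sg g \<and>
     distinct (xs @ ys) \<and> E = {#(g, xs, ys)#}"
| "denotes Sg (TComp s t) xs E zs \<longleftrightarrow> (\<exists>F G ys. denotes Sg s xs F ys \<and> denotes Sg t ys G zs \<and>
     E = F + G \<and> wires xs F \<inter> wires ys G = set ys)"
| "denotes Sg (TTens s t) xs E ys \<longleftrightarrow> (\<exists>xs1 xs2 F G ys1 ys2. denotes Sg s xs1 F ys1 \<and> denotes Sg t xs2 G ys2 \<and>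
     xs = xs1 @ xs2 \<and> E = F + G \<and> ys = ys1 @ ys2 \<and> wires xs1 F \<inter> wires xs2 G = {})"

section \<open>Monogamy and types of denoted diagrams\<close>

lemma denotes_compI:
  "\<lbrakk>denotes Sg s xs F ys; denotes Sg t ys G zs; wires xs F \<inter> wires ys G = set ys\<rbrakk>
    \<Longrightarrow> denotes Sg (TComp s t) xs (F + G) zs"
  unfolding denotes.simps by blast

lemma denotes_tensI:
  "\<lbrakk>denotes Sg s xs F ys; denotes Sg t xs' G ys'; wires xs F \<inter> wires xs' G = {}\<rbrakk>
    \<Longrightarrow> denotes Sg (TTens s t) (xs @ xs') (F + G) (ys @ ys')"
  unfolding denotes.simps by blast

lemma denotes_TSymI:
  "\<lbrakk>distinct (us @ vs); length us = n; length vs = m\<rbrakk> \<Longrightarrow> denotes Sg (TSym n m) (us @ vs) {#} (vs @ us)"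
  by auto

lemma wires_simps [simp]: "wires xs {#} = set xs"
  "wires (xs @ ys) (F + G) = wires xs F \<union> wires ys G"
  by (auto simp: wires_def)

lemma monogamous_wires: "monogamous xs E ys \<Longrightarrow> wires xs E = set ys \<union> set_mset (srcs E)"
  unfolding monogamous_def wires_def by (metis set_mset_mset set_mset_union)

lemma monogamous_count: "monogamous xs E ys \<Longrightarrow> count (mset xs) w + count (tgts E) w \<le> 1"
  by (metis count_union monogamous_def)

lemma notin_wires: "w \<notin> wires xs E \<longleftrightarrow> count (mset xs) w + count (tgts E) w = 0"
  by (simp add: wires_def not_in_iff)

text \<open>In the balance of wires the middle list \<open>ys\<close> cancels. No wire is counted
  twice: one that \<open>G\<close> produces is not in \<open>ys\<close> by monogamy of the second
  part, hence it is not a wire of the first part.\<close>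

lemma monogamous_comp:
  assumes "monogamous xs F ys" "monogamous ys G zs" "wires xs F \<inter> wires ys G = set ys"
  shows "monogamous xs (F + G) zs"
  unfolding monogamous_def
proof
  have 1: "mset xs + tgts F = mset ys + srcs F" "mset ys + tgts G = mset zs + srcs G"
    using assms by (auto simp: monogamous_def)
  have "mset xs + tgts F + tgts G = (mset ys + tgts G) + srcs F" unfolding 1(1) by (simp add: ac_simps)
  then show "mset xs + tgts (F + G) = mset zs + srcs (F + G)" unfolding 1(2) by (simp add: ac_simps)
  show "\<forall>w. count (mset xs + tgts (F + G)) w \<le> 1"
  proof
    fix w
    note a = monogamous_count[OF assms(1), of w] and b = monogamous_count[OF assms(2), of w]
    show "count (mset xs + tgts (F + G)) w \<le> 1"
    proof (cases "w \<in># tgts G")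
      case True
      then have "count (tgts G) w \<ge> 1" by simp
      then have "count (mset ys) w = 0" using b by linarith
      then have "w \<notin> set ys" by (metis not_in_iff set_mset_mset)
      then have "w \<notin> wires xs F" using True assms(3) by (auto simp: wires_def)
      then show ?thesis using b unfolding notin_wires tgts_simps count_union by linarith
    next
      case False
      then show ?thesis using a by (simp add: not_in_iff)
    qed
  qed
qed

lemma monogamous_tensor:
  assumes "monogamous xs F ys" "monogamous xs' G ys'" "wires xs F \<inter> wires xs' G = {}"
  shows "monogamous (xs @ xs') (F + G) (ys @ ys')"
  unfolding monogamous_def
proof
  show "mset (xs @ xs') + tgts (F + G) = mset (ys @ ys') + srcs (F + G)"
    using assms(1,2) by (simp add: monogamous_def) (metis add.assoc add.left_commute)
  show "\<forall>w. count (mset (xs @ xs') + tgts (F + G)) w \<le> 1"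
  proof
    fix w
    note monogamous_count[OF assms(1), of w] monogamous_count[OF assms(2), of w]
    moreover have "w \<notin> wires xs F \<or> w \<notin> wires xs' G" using assms(3) by blast
    ultimately show "count (mset (xs @ xs') + tgts (F + G)) w \<le> 1"
      unfolding notin_wires tgts_simps count_union mset_append by linarith
  qed
qed

lemma monogamous_empty: "monogamous xs {#} ys \<longleftrightarrow> mset xs = mset ys \<and> distinct xs"
  by (auto simp: monogamous_def distinct_count)

lemma denotes_props:
  "denotes Sg t xs E ys \<Longrightarrow> length xs = tdom Sg t \<and> length ys = tcod Sg t \<and> monogamous xs E ys"
proof (induction t arbitrary: xs E ys)
  case (TGen g)
  have "\<forall>w. count (mset (xs @ ys)) w \<le> 1" using TGen distinct_count[of "xs @ ys"] by simp
  with TGen show ?case by (auto simp: monogamous_def)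
next
  case (TComp s t)
  then obtain F G zs where "denotes Sg s xs F zs" "denotes Sg t zs G ys" "E = F + G"
     "wires xs F \<inter> wires zs G = set zs" by auto
  then show ?case using TComp.IH(1)[of xs F zs] TComp.IH(2)[of zs G ys] monogamous_comp by auto
next
  case (TTens s t)
  then obtain xs1 xs2 F G ys1 ys2 where "denotes Sg s xs1 F ys1" "denotes Sg t xs2 G ys2"
     "xs = xs1 @ xs2" "E = F + G" "ys = ys1 @ ys2" "wires xs1 F \<inter> wires xs2 G = {}" by auto
  then show ?case using TTens.IH(1)[of xs1 F ys1] TTens.IH(2)[of xs2 G ys2] monogamous_tensor by auto
qed (auto simp: monogamous_empty)

lemma denotes_monogamous: "denotes Sg t xs E ys \<Longrightarrow> monogamous xs E ys"
  and denotes_dom: "denotes Sg t xs E ys \<Longrightarrow> length xs = tdom Sg t"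
  and denotes_cod: "denotes Sg t xs E ys \<Longrightarrow> length ys = tcod Sg t"
  using denotes_props by blast+

lemma denotes_wires_cod: "denotes Sg t xs E ys \<Longrightarrow> set ys \<subseteq> wires xs E"
  using denotes_monogamous monogamous_wires by blast

lemma wires_dom: "set xs \<subseteq> wires xs E"
  by (auto simp: wires_def)

lemma denotes_distinct: "denotes Sg t xs E ys \<Longrightarrow> distinct xs" "denotes Sg t xs E ys \<Longrightarrow> distinct ys"
proof -
  assume "denotes Sg t xs E ys"
  then have m: "monogamous xs E ys" by (rule denotes_monogamous)
  show "distinct xs" unfolding distinct_count
    using m unfolding monogamous_def by (meson count_le_mono mset_subset_eq_add_left)
  show "distinct ys" unfolding distinct_count
    using monogamous_srcs[OF m] by (meson count_le_mono mset_subset_eq_add_left)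
qed

section \<open>The laws of a PROP for denotations\<close>

lemma wires_comp: "denotes Sg s xs F ys \<Longrightarrow> wires xs (F + G) = wires xs F \<union> wires ys G"
  using denotes_wires_cod by (fastforce simp: wires_def)

text \<open>Only the sharing conditions have to be matched; they follow because both middle lists
  consist of wires of \<open>B\<close>. The law is stated as an equality of predicates, so that
  congruence under both operations in \<open>denotes_sound\<close> is mere rewriting.\<close>

lemma denotes_assoc: "denotes Sg (TComp (TComp f g) h) = denotes Sg (TComp f (TComp g h))"
proof (intro ext iffI)
  fix xs E zs
  assume "denotes Sg (TComp (TComp f g) h) xs E zs"
  then obtain A B ys C ws where 1: "denotes Sg f xs A ys" "denotes Sg g ys B ws" "denotes Sg h ws C zs"
    "E = A + B + C" "wires xs A \<inter> wires ys B = set ys" "wires xs (A + B) \<inter> wires ws C = set ws"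
    by auto
  have "set ws \<subseteq> wires ys B" "set ys \<subseteq> wires ys B" "set ws \<subseteq> wires ws C" using denotes_wires_cod[OF 1(2)] wires_dom by auto
  then have "wires ys B \<inter> wires ws C = set ws" "wires xs A \<inter> wires ys (B + C) = set ys"
    using 1(5,6) unfolding wires_comp[OF 1(1)] wires_comp[OF 1(2)] by blast+
  then show "denotes Sg (TComp f (TComp g h)) xs E zs"
    using 1(1-3) unfolding 1(4) add.assoc by (intro denotes_compI)
next
  fix xs E zs
  assume "denotes Sg (TComp f (TComp g h)) xs E zs"
  then obtain A B ys C ws where 1: "denotes Sg f xs A ys" "denotes Sg g ys B ws" "denotes Sg h ws C zs"
    "E = A + (B + C)" "wires ys B \<inter> wires ws C = set ws" "wires xs A \<inter> wires ys (B + C) = set ys"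
    by auto
  have "set ws \<subseteq> wires ys B" "set ys \<subseteq> wires ys B" "set ws \<subseteq> wires ws C" using denotes_wires_cod[OF 1(2)] wires_dom by auto
  then have "wires xs A \<inter> wires ys B = set ys" "wires xs (A + B) \<inter> wires ws C = set ws"
    using 1(5,6) unfolding wires_comp[OF 1(1)] wires_comp[OF 1(2)] by blast+
  then show "denotes Sg (TComp (TComp f g) h) xs E zs"
    using 1(1-3) unfolding 1(4) add.assoc[symmetric] by (intro denotes_compI)
qed

lemma denotes_id_left:
  assumes "tdom Sg f = n"
  shows "denotes Sg (TComp (TId n) f) = denotes Sg f"
proof (intro ext iffI)
  fix xs E ys assume d: "denotes Sg f xs E ys"
  have "denotes Sg (TComp (TId n) f) xs ({#} + E) ys"
    using d assms denotes_dom[OF d] denotes_distinct[OF d] wires_dom[of xs E]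
    by (intro denotes_compI[of _ _ _ _ xs]) auto
  then show "denotes Sg (TComp (TId n) f) xs E ys" by simp
qed auto

lemma denotes_id_right:
  assumes "tcod Sg f = n"
  shows "denotes Sg (TComp f (TId n)) = denotes Sg f"
proof (intro ext iffI)
  fix xs E ys assume d: "denotes Sg f xs E ys"
  have "denotes Sg (TComp f (TId n)) xs (E + {#}) ys"
    using d assms denotes_cod[OF d] denotes_distinct[OF d] denotes_wires_cod[OF d]
    by (intro denotes_compI[of _ _ _ _ ys]) auto
  then show "denotes Sg (TComp f (TId n)) xs E ys" by simp
qed auto

lemma denotes_tens_id: "denotes Sg (TTens (TId n) (TId m)) = denotes Sg (TId (n + m))"
proof (intro ext iffI)
  fix xs E ys assume d: "denotes Sg (TId (n + m)) xs E ys"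
  show "denotes Sg (TTens (TId n) (TId m)) xs E ys"
    using d denotes_tensI[of Sg "TId n" "take n xs" "{#}" "take n xs" "TId m" "drop n xs" "{#}" "drop n xs"]
    by (simp add: set_take_disj_set_drop_if_distinct)
qed auto

lemma denotes_unit_left: "denotes Sg (TTens (TId 0) f) = denotes Sg f"
  by (intro ext iffI) auto

lemma denotes_unit_right: "denotes Sg (TTens f (TId 0)) = denotes Sg f"
  by (intro ext iffI) auto

lemma denotes_tens_assoc: "denotes Sg (TTens (TTens f g) h) = denotes Sg (TTens f (TTens g h))"
proof (intro ext iffI)
  fix xs E ys
  assume "denotes Sg (TTens (TTens f g) h) xs E ys"
  then obtain x1 x2 x3 A B C y1 y2 y3 where 1: "denotes Sg f x1 A y1" "denotes Sg g x2 B y2" "denotes Sg h x3 C y3"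
    "xs = x1 @ x2 @ x3" "E = A + B + C" "ys = y1 @ y2 @ y3"
    "wires x1 A \<inter> wires x2 B = {}" "wires (x1 @ x2) (A + B) \<inter> wires x3 C = {}" by auto
  then show "denotes Sg (TTens f (TTens g h)) xs E ys"
    unfolding 1(4,5,6) add.assoc by (intro denotes_tensI) auto
next
  fix xs E ys
  assume "denotes Sg (TTens f (TTens g h)) xs E ys"
  then obtain x1 x2 x3 A B C y1 y2 y3 where 1: "denotes Sg f x1 A y1" "denotes Sg g x2 B y2" "denotes Sg h x3 C y3"
    "xs = (x1 @ x2) @ x3" "E = (A + B) + C" "ys = (y1 @ y2) @ y3"
    "wires x2 B \<inter> wires x3 C = {}" "wires x1 A \<inter> wires (x2 @ x3) (B + C) = {}"
    by (auto simp: add.assoc)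
  then show "denotes Sg (TTens (TTens f g) h) xs E ys"
    unfolding 1(4,5,6) by (intro denotes_tensI) auto
qed

text \<open>The set algebra of interchange, with \<open>A\<close>, \<open>C\<close> the wires of the
  first composite and \<open>B\<close>, \<open>D\<close> those of the second, sharing
  \<open>a\<close> and \<open>b\<close> respectively. It turns the sharing conditions of a tensor of
  composites into those of a composite of tensors.\<close>

lemma disjoint_grid_columns:
  assumes "A \<inter> C = a" "B \<inter> D = b" "(A \<union> C) \<inter> (B \<union> D) = {}"
  shows "A \<inter> B = {}" "C \<inter> D = {}" "(A \<union> B) \<inter> (C \<union> D) = a \<union> b"
  using assms by auto

text \<open>The way back. An element of both \<open>A\<close> and \<open>D\<close> would lie in
  \<open>a\<close> or \<open>b\<close>, hence in \<open>C\<close> or in \<open>B\<close>, and thus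
  violate one of the two disjointness conditions; the same applies to \<open>B\<close> and
  \<open>C\<close>.\<close>

lemma disjoint_grid_rows:
  assumes "A \<inter> B = {}" "C \<inter> D = {}" "(A \<union> B) \<inter> (C \<union> D) = a \<union> b"
    and "a \<subseteq> A" "a \<subseteq> C" "b \<subseteq> B" "b \<subseteq> D"
  shows "A \<inter> C = a" "B \<inter> D = b" "(A \<union> C) \<inter> (B \<union> D) = {}"
proof -
  have *: "x \<in> A \<inter> C \<longleftrightarrow> x \<in> a" "x \<in> B \<inter> D \<longleftrightarrow> x \<in> b" "x \<notin> (A \<union> C) \<inter> (B \<union> D)" for x
    using assms unfolding set_eq_iff subset_iff by (metis Un_iff Int_iff empty_iff)+
  show "A \<inter> C = a" "B \<inter> D = b" "(A \<union> C) \<inter> (B \<union> D) = {}"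
    using * by auto
qed

lemma denotes_interchange:
  assumes "tcod Sg f1 = tdom Sg g1" "tcod Sg f2 = tdom Sg g2"
  shows "denotes Sg (TTens (TComp f1 g1) (TComp f2 g2)) = denotes Sg (TComp (TTens f1 f2) (TTens g1 g2))"
proof (intro ext iffI)
  fix xs E zs
  assume "denotes Sg (TTens (TComp f1 g1) (TComp f2 g2)) xs E zs"
  then obtain x1 x2 y1 y2 z1 z2 A1 B1 A2 B2 where 1: "denotes Sg f1 x1 A1 y1" "denotes Sg g1 y1 B1 z1"
     "denotes Sg f2 x2 A2 y2" "denotes Sg g2 y2 B2 z2" "xs = x1 @ x2" "zs = z1 @ z2" "E = (A1 + B1) + (A2 + B2)"
     "wires x1 A1 \<inter> wires y1 B1 = set y1" "wires x2 A2 \<inter> wires y2 B2 = set y2"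
     "wires x1 (A1 + B1) \<inter> wires x2 (A2 + B2) = {}" by auto
  have E: "E = (A1 + A2) + (B1 + B2)" unfolding 1(7) by (simp add: ac_simps)
  show "denotes Sg (TComp (TTens f1 f2) (TTens g1 g2)) xs E zs"
    unfolding 1(5,6) E
    using disjoint_grid_columns[OF 1(8-10)[unfolded wires_comp[OF 1(1)] wires_comp[OF 1(3)]]]
    by (intro denotes_compI[of _ _ _ _ "y1 @ y2"] denotes_tensI 1(1-4)) simp_all
next
  fix xs E zs
  assume "denotes Sg (TComp (TTens f1 f2) (TTens g1 g2)) xs E zs"
  then obtain A B ys where AB: "denotes Sg (TTens f1 f2) xs A ys" "denotes Sg (TTens g1 g2) ys B zs" "E = A + B"
    "wires xs A \<inter> wires ys B = set ys" unfolding denotes.simps(4) by blast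
  obtain x1 x2 y1 y2 A1 A2 where A: "denotes Sg f1 x1 A1 y1" "denotes Sg f2 x2 A2 y2" "xs = x1 @ x2"
    "A = A1 + A2" "ys = y1 @ y2" "wires x1 A1 \<inter> wires x2 A2 = {}" using AB(1) by auto
  obtain y1' y2' z1 z2 B1 B2 where B: "denotes Sg g1 y1' B1 z1" "denotes Sg g2 y2' B2 z2" "ys = y1' @ y2'"
    "B = B1 + B2" "zs = z1 @ z2" "wires y1' B1 \<inter> wires y2' B2 = {}" using AB(2) by auto
  \<comment> \<open>The middle list is split once by the codomains of \<open>f1\<close>,
    \<open>f2\<close> and once by the domains of \<open>g1\<close>, \<open>g2\<close>; typing makes
    the two splittings coincide.\<close>
  have "length y1 = length y1'" using denotes_cod[OF A(1)] denotes_dom[OF B(1)] assms(1) by simp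
  then have y: "y1' = y1" "y2' = y2" using A(5) B(3) by auto
  note B = B[unfolded y]
  have E: "E = (A1 + B1) + (A2 + B2)" unfolding AB(3) A(4) B(4) by (simp add: ac_simps)
  note c = denotes_wires_cod[OF A(1)] denotes_wires_cod[OF A(2)] denotes_wires_cod[OF B(1)]
    denotes_wires_cod[OF B(2)] wires_dom[of y1 B1] wires_dom[of y2 B2]
  have w: "(wires x1 A1 \<union> wires x2 A2) \<inter> (wires y1 B1 \<union> wires y2 B2) = set y1 \<union> set y2"
    using AB(4) A(3,4,5) B(4) by simp
  show "denotes Sg (TTens (TComp f1 g1) (TComp f2 g2)) xs E zs"
    unfolding A(3) B(5) E
    using disjoint_grid_rows[OF A(6) B(6) w] c
    by (intro denotes_compI[of _ f1 _ _ y1] denotes_compI[of _ f2 _ _ y2] denotes_tensI A(1,2) B(1,2)) (simp_all add: wires_comp[OF A(1)] wires_comp[OF A(2)])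
qed

lemma denotes_sym_natural:
  assumes "tdom Sg f = n1" "tcod Sg f = m1" "tdom Sg g = n2" "tcod Sg g = m2"
  shows "denotes Sg (TComp (TTens f g) (TSym m1 m2)) = denotes Sg (TComp (TSym n1 n2) (TTens g f))"
proof (intro ext iffI)
  fix xs E zs
  assume "denotes Sg (TComp (TTens f g) (TSym m1 m2)) xs E zs"
  then obtain C D us where 1: "denotes Sg (TTens f g) xs C us" "denotes Sg (TSym m1 m2) us D zs" "E = C + D"
    unfolding denotes.simps(4) by blast
  obtain x1 x2 y1 y2 A B where 2: "denotes Sg f x1 A y1" "denotes Sg g x2 B y2" "xs = x1 @ x2"
     "C = A + B" "us = y1 @ y2" "wires x1 A \<inter> wires x2 B = {}"
    using 1(1) unfolding denotes.simps(5) by blast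
  obtain u v where "us = u @ v" "length u = m1" "zs = v @ u" "D = {#}" using 1(2) by auto
  then have 0: "denotes Sg f x1 A y1" "denotes Sg g x2 B y2" "xs = x1 @ x2"
     "E = A + B" "y1 @ y2 = u @ v" "length u = m1" "zs = v @ u" "wires x1 A \<inter> wires x2 B = {}"
    using 1(3) 2 by auto
  have "length y1 = length u" using denotes_cod[OF 0(1)] assms 0 by simp
  then have uv: "u = y1" "v = y2" using 0(5) by auto
  have d: "denotes Sg (TTens g f) (x2 @ x1) (B + A) (y2 @ y1)"
    by (rule denotes_tensI) (use 0 in auto)
  have "denotes Sg (TSym n1 n2) (x1 @ x2) {#} (x2 @ x1)"
    using denotes_distinct(1)[OF d] denotes_dom[OF 0(1)] denotes_dom[OF 0(2)] assms by auto
  then have "denotes Sg (TComp (TSym n1 n2) (TTens g f)) (x1 @ x2) ({#} + (B + A)) (y2 @ y1)"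
    by (rule denotes_compI[OF _ d]) (use wires_dom[of "x2 @ x1" "B + A"] in auto)
  then show "denotes Sg (TComp (TSym n1 n2) (TTens g f)) xs E zs"
    using 0 uv by (simp add: add.commute)
next
  fix xs E zs
  assume "denotes Sg (TComp (TSym n1 n2) (TTens g f)) xs E zs"
  then obtain C D us where 1: "denotes Sg (TSym n1 n2) xs C us" "denotes Sg (TTens g f) us D zs" "E = C + D"
    unfolding denotes.simps(4) by blast
  obtain x1 x2 y1 y2 A B where 2: "denotes Sg g x2 B y2" "denotes Sg f x1 A y1" "us = x2 @ x1"
     "D = B + A" "zs = y2 @ y1" "wires x2 B \<inter> wires x1 A = {}"
    using 1(2) unfolding denotes.simps(5) by blast
  obtain u v where "xs = u @ v" "length v = n2" "us = v @ u" "C = {#}" using 1(1) by auto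
  then have 0: "denotes Sg g x2 B y2" "denotes Sg f x1 A y1" "xs = u @ v"
     "v @ u = x2 @ x1" "length v = n2" "E = B + A" "zs = y2 @ y1" "wires x2 B \<inter> wires x1 A = {}"
    using 1(3) 2 by auto
  have "length v = length x2" using denotes_dom[OF 0(1)] assms 0 by simp
  then have uv: "u = x1" "v = x2" using 0(4) by auto
  have d: "denotes Sg (TTens f g) (x1 @ x2) (A + B) (y1 @ y2)"
    by (rule denotes_tensI) (use 0 in auto)
  have "denotes Sg (TSym m1 m2) (y1 @ y2) {#} (y2 @ y1)"
    using denotes_distinct(2)[OF d] denotes_cod[OF 0(1)] denotes_cod[OF 0(2)] assms by auto
  then have "denotes Sg (TComp (TTens f g) (TSym m1 m2)) (x1 @ x2) ((A + B) + {#}) (y2 @ y1)"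
    by (rule denotes_compI[OF d]) (use denotes_wires_cod[OF d] in auto)
  then show "denotes Sg (TComp (TTens f g) (TSym m1 m2)) xs E zs"
    using 0 uv by (simp add: add.commute)
qed

lemma denotes_sym_sym: "denotes Sg (TComp (TSym n m) (TSym m n)) = denotes Sg (TId (n + m))"
proof (intro ext iffI)
  fix xs E ys assume d: "denotes Sg (TId (n + m)) xs E ys"
  define u v where "u = take n xs" and "v = drop n xs"
  then have 1: "xs = u @ v" "length u = n" "length v = m" "distinct (u @ v)" using d by auto
  have "denotes Sg (TComp (TSym n m) (TSym m n)) (u @ v) ({#} + {#}) (u @ v)"
    using 1 by (intro denotes_compI[of _ _ _ _ "v @ u"] denotes_TSymI) auto
  then show "denotes Sg (TComp (TSym n m) (TSym m n)) xs E ys" using d 1 by simp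
next
  fix xs E ys assume "denotes Sg (TComp (TSym n m) (TSym m n)) xs E ys"
  then obtain C D zs where 1: "denotes Sg (TSym n m) xs C zs" "denotes Sg (TSym m n) zs D ys" "E = C + D"
    unfolding denotes.simps(4) by blast
  obtain u v where u: "xs = u @ v" "zs = v @ u" "length u = n" "length v = m" "distinct xs" "C = {#}"
    using 1(1) by auto
  obtain u' v' where "zs = v' @ u'" "ys = u' @ v'" "length u' = n" "length v' = m" "D = {#}" using 1(2) by auto
  with u 1(3) show "denotes Sg (TId (n + m)) xs E ys" by auto
qed

lemma denotes_hexagon: "denotes Sg (TSym n (m + k)) =
    denotes Sg (TComp (TTens (TSym n m) (TId k)) (TTens (TId m) (TSym n k)))"
proof (intro ext iffI)
  fix xs E ys assume d: "denotes Sg (TSym n (m + k)) xs E ys"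
  then obtain u z where 0: "length u = n" "length z = m + k" "xs = u @ z" "ys = z @ u" "distinct (u @ z)" "E = {#}" by auto
  define v w where "v = take m z" and "w = drop m z"
  then have 1: "z = v @ w" "length v = m" "length w = k" using 0 by auto
  have d1: "denotes Sg (TTens (TSym n m) (TId k)) ((u @ v) @ w) ({#} + {#}) ((v @ u) @ w)"
    by (intro denotes_tensI denotes_TSymI) (use 0 1 in auto)
  have d2: "denotes Sg (TTens (TId m) (TSym n k)) (v @ (u @ w)) ({#} + {#}) (v @ (w @ u))"
    by (intro denotes_tensI denotes_TSymI) (use 0 1 in auto)
  have "denotes Sg (TComp (TTens (TSym n m) (TId k)) (TTens (TId m) (TSym n k)))
      ((u @ v) @ w) (({#} + {#}) + ({#} + {#})) (v @ (w @ u))"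
    by (rule denotes_compI[OF d1]) (use d2 in \<open>auto simp del: denotes.simps\<close>)
  then show "denotes Sg (TComp (TTens (TSym n m) (TId k)) (TTens (TId m) (TSym n k))) xs E ys"
    using 0 1 by simp
next
  fix xs E ys assume d: "denotes Sg (TComp (TTens (TSym n m) (TId k)) (TTens (TId m) (TSym n k))) xs E ys"
  then obtain C D zs where 1: "denotes Sg (TTens (TSym n m) (TId k)) xs C zs"
      "denotes Sg (TTens (TId m) (TSym n k)) zs D ys" "E = C + D"
    unfolding denotes.simps(4) by blast
  obtain u v w where 2: "xs = u @ v @ w" "zs = v @ u @ w" "length u = n" "length v = m" "length w = k" "C = {#}"
    using 1(1) by auto
  obtain u' v' w' where 3: "zs = v' @ u' @ w'" "ys = v' @ w' @ u'" "length u' = n" "length v' = m" "length w' = k" "D = {#}"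
    using 1(2) by auto
  have "v' = v" "u' = u" "w' = w" using 2 3 by auto
  note 0 = 2 3 1(3) this
  moreover have "distinct xs" using denotes_distinct[OF d] by simp
  ultimately show "denotes Sg (TSym n (m + k)) xs E ys"
    using 0 by auto
qed

theorem denotes_sound: "free_eq Sg n m s t \<Longrightarrow> denotes Sg s = denotes Sg t"
proof (induction rule: free_eq.induct)
  case (cong_comp n m f f' l g g')
  then show ?case by (intro ext) simp
next
  case (cong_tens n1 m1 f f' n2 m2 g g')
  then show ?case by (intro ext) simp
qed (auto simp only: denotes_id_left denotes_id_right denotes_assoc denotes_tens_id denotes_interchange
    denotes_unit_left denotes_unit_right denotes_tens_assoc denotes_sym_natural denotes_sym_sym
    denotes_hexagon[symmetric] pterms_def mem_Collect_eq)

section \<open>Renaming of wires\<close>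

definition hmap :: "(nat \<Rightarrow> nat) \<Rightarrow> 'o hedge \<Rightarrow> 'o hedge" where
  "hmap \<rho> e = (hlab e, map \<rho> (hsrc e), map \<rho> (htgt e))"

lemma tgts_hmap: "tgts (image_mset (hmap \<rho>) E) = image_mset \<rho> (tgts E)"
  by (induction E) (auto simp: hmap_def)

lemma wires_hmap: "wires (map \<rho> xs) (image_mset (hmap \<rho>) E) = \<rho> ` wires xs E"
  by (auto simp: wires_def tgts_hmap)

text \<open>Injectivity on the wires in use lets images commute with intersections, and that
  preserves the sharing conditions of composition and tensor.\<close>

lemma denotes_rename:
  "denotes Sg t xs E ys \<Longrightarrow> inj_on \<rho> (wires xs E) \<Longrightarrow>
    denotes Sg t (map \<rho> xs) (image_mset (hmap \<rho>) E) (map \<rho> ys)"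
proof (induction t arbitrary: xs E ys)
  case (TGen g)
  then show ?case by (auto simp: hmap_def wires_def distinct_map inj_on_Un)
next
  case (TComp s t)
  obtain F G zs where 1: "denotes Sg s xs F zs" "denotes Sg t zs G ys" "E = F + G"
     "wires xs F \<inter> wires zs G = set zs" using TComp.prems(1) unfolding denotes.simps by blast
  have inj: "inj_on \<rho> (wires xs F \<union> wires zs G)" using TComp.prems(2) 1(3) wires_comp[OF 1(1)] by simp
  then have i: "inj_on \<rho> (wires xs F)" "inj_on \<rho> (wires zs G)" by (auto simp: inj_on_Un)
  have "\<rho> ` wires xs F \<inter> \<rho> ` wires zs G = \<rho> ` set zs"
    using inj 1(4) by (metis inj_on_image_Int Un_upper1 Un_upper2)
  then show ?case
    using denotes_compI[OF TComp.IH(1)[OF 1(1) i(1)] TComp.IH(2)[OF 1(2) i(2)]] 1(3)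
    by (simp add: wires_hmap del: denotes.simps)
next
  case (TTens s t)
  obtain x1 x2 F G y1 y2 where 1: "denotes Sg s x1 F y1" "denotes Sg t x2 G y2" "xs = x1 @ x2" "E = F + G"
    "ys = y1 @ y2" "wires x1 F \<inter> wires x2 G = {}" using TTens.prems(1) unfolding denotes.simps by blast
  have inj: "inj_on \<rho> (wires x1 F \<union> wires x2 G)" using TTens.prems(2) 1 by simp
  then have i: "inj_on \<rho> (wires x1 F)" "inj_on \<rho> (wires x2 G)" by (auto simp: inj_on_Un)
  have "\<rho> ` wires x1 F \<inter> \<rho> ` wires x2 G = {}"
    using inj 1(6) by (metis inj_on_image_Int Un_upper1 Un_upper2 image_empty)
  then show ?case
    using denotes_tensI[OF TTens.IH(1)[OF 1(1) i(1)] TTens.IH(2)[OF 1(2) i(2)]] 1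
    by (simp add: wires_hmap del: denotes.simps)
next
  case (TSym n m)
  then obtain us vs where 1: "xs = us @ vs" "ys = vs @ us" "length us = n" "length vs = m" "distinct xs" "E = {#}"
    by auto
  then have "distinct (map \<rho> us @ map \<rho> vs)" using TSym.prems(2) unfolding map_append[symmetric] distinct_map by simp
  then show ?case using denotes_TSymI[of "map \<rho> us" "map \<rho> vs" n m] 1 by simp
qed (auto simp: distinct_map)

lemma hmap_cong: "(\<And>w. w \<in> set (hsrc e) \<union> set (htgt e) \<Longrightarrow> \<rho> w = \<sigma> w) \<Longrightarrow> hmap \<rho> e = hmap \<sigma> e"
  by (auto simp: hmap_def)

lemma in_srcs: "w \<in># srcs E \<longleftrightarrow> (\<exists>e\<in>#E. w \<in> set (hsrc e))"
  and in_tgts: "w \<in># tgts E \<longleftrightarrow> (\<exists>e\<in>#E. w \<in> set (htgt e))"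
  by (induction E) auto

lemma image_hmap_cong:
  assumes "denotes Sg t xs E ys" "\<And>w. w \<in> wires xs E \<Longrightarrow> \<rho> w = \<sigma> w"
  shows "image_mset (hmap \<rho>) E = image_mset (hmap \<sigma>) E" "map \<rho> xs = map \<sigma> xs" "map \<rho> ys = map \<sigma> ys"
proof -
  have "set_mset (srcs E) \<subseteq> wires xs E" "set_mset (tgts E) \<subseteq> wires xs E"
    using monogamous_wires[OF denotes_monogamous[OF assms(1)]] by (auto simp: wires_def)
  then show "image_mset (hmap \<rho>) E = image_mset (hmap \<sigma>) E"
    using assms(2) by (intro image_mset_cong hmap_cong) (auto simp: in_srcs in_tgts subset_iff)
  show "map \<rho> xs = map \<sigma> xs" using assms(2) wires_dom by (metis map_eq_conv subsetD)
  show "map \<rho> ys = map \<sigma> ys" using assms(2) denotes_wires_cod[OF assms(1)] by (metis map_eq_conv subsetD)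
qed

text \<open>Joins renamings of two parts of a diagram. Agreement on the shared names makes the joint
  map well behaved; the last hypothesis excludes that private names of the two parts are sent to one
  name.\<close>

lemma inj_on_glue:
  assumes "inj_on \<rho> A" "inj_on \<sigma> B" "\<And>w. w \<in> A \<inter> B \<Longrightarrow> \<rho> w = \<sigma> w" "\<rho> ` A \<inter> \<sigma> ` B \<subseteq> \<rho> ` (A \<inter> B)"
  shows "inj_on (\<lambda>w. if w \<in> A then \<rho> w else \<sigma> w) (A \<union> B)"
proof (rule inj_onI)
  have mixed: "x = y" if "x \<in> A" "y \<in> B" "\<rho> x = \<sigma> y" for x y
  proof -
    have "\<rho> x \<in> \<rho> ` (A \<inter> B)" using assms(4) that by (metis IntI imageI subsetD)
    then obtain z where z: "z \<in> A" "z \<in> B" "\<rho> x = \<rho> z" by auto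
    then have "x = z" using assms(1) that(1) by (meson inj_onD)
    then have "\<sigma> z = \<sigma> y" using that assms(3) z by auto
    then show ?thesis using assms(2) z that \<open>x = z\<close> by (meson inj_onD)
  qed
  fix x y assume "x \<in> A \<union> B" "y \<in> A \<union> B" "(if x \<in> A then \<rho> x else \<sigma> x) = (if y \<in> A then \<rho> y else \<sigma> y)"
  then show "x = y" using mixed[of x y] mixed[of y x] assms(1,2)
    by (auto split: if_splits dest: inj_onD)
qed

text \<open>For the basic terms, lists without repetition and of equal length are matched position
  by position (\<open>list\<close>). For composites the two renamings obtained by induction are
  glued, and the sharing conditions of the second diagram give the injectivity of the
  result.\<close>

lemma denotes_unique:
  "denotes Sg t xs E ys \<Longrightarrow> denotes Sg t xs' E' ys' \<Longrightarrow>
    \<exists>\<rho>. inj_on \<rho> (wires xs E) \<and> xs' = map \<rho> xs \<and> E' = image_mset (hmap \<rho>) E \<and> ys' = map \<rho> ys"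
proof (induction t arbitrary: xs E ys xs' E' ys')
  have list: "\<exists>\<rho>. inj_on \<rho> (set zs) \<and> zs' = map \<rho> zs" if "distinct zs" "distinct zs'" "length zs = length zs'" for zs zs' :: "nat list"
  proof -
    let ?\<rho> = "\<lambda>w. zs' ! (THE i. i < length zs \<and> zs ! i = w)"
    have *: "?\<rho> (zs ! i) = zs' ! i" if "i < length zs" for i
    proof -
      have "(THE j. j < length zs \<and> zs ! j = zs ! i) = i"
        using that \<open>distinct zs\<close> by (intro the_equality) (auto simp: nth_eq_iff_index_eq)
      then show ?thesis by simp
    qed
    have "zs' = map ?\<rho> zs" using * that by (intro nth_equalityI) auto
    moreover have "inj_on ?\<rho> (set zs)" using that calculation by (metis distinct_map)
    ultimately show ?thesis by blast
  qed
  {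
    case (TId n)
    then show ?case using list[of xs xs'] by auto
  next
    case (TSym n m)
    obtain us vs where 1: "xs = us @ vs" "ys = vs @ us" "length us = n" "length vs = m" "distinct xs" "E = {#}"
      using TSym.prems(1) by auto
    obtain us' vs' where 2: "xs' = us' @ vs'" "ys' = vs' @ us'" "length us' = n" "length vs' = m" "distinct xs'" "E' = {#}"
      using TSym.prems(2) by auto
    obtain \<rho> where r: "inj_on \<rho> (set xs)" "xs' = map \<rho> xs" using list[of xs xs'] 1 2 by auto
    then have "us' = map \<rho> us" "vs' = map \<rho> vs" using 1 2 by auto
    then show ?case using 1 2 r by auto
  next
    case (TGen g)
    obtain \<rho> where r: "inj_on \<rho> (set (xs @ ys))" "xs' @ ys' = map \<rho> (xs @ ys)"
      using list[of "xs @ ys" "xs' @ ys'"] TGen by auto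
    then have "xs' = map \<rho> xs" "ys' = map \<rho> ys" using TGen by auto
    then show ?case using r(1) TGen by (auto simp: wires_def hmap_def intro!: exI[of _ \<rho>])
  next
    case (TComp s t)
    obtain F G zs where 1: "denotes Sg s xs F zs" "denotes Sg t zs G ys" "E = F + G"
       "wires xs F \<inter> wires zs G = set zs" using TComp.prems(1) unfolding denotes.simps by blast
    obtain F' G' zs' where 2: "denotes Sg s xs' F' zs'" "denotes Sg t zs' G' ys'" "E' = F' + G'"
       "wires xs' F' \<inter> wires zs' G' = set zs'" using TComp.prems(2) unfolding denotes.simps by blast
    obtain \<rho> where r: "inj_on \<rho> (wires xs F)" "xs' = map \<rho> xs" "F' = image_mset (hmap \<rho>) F" "zs' = map \<rho> zs"
      using TComp.IH(1)[OF 1(1) 2(1)] by blast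
    obtain \<sigma> where s: "inj_on \<sigma> (wires zs G)" "zs' = map \<sigma> zs" "G' = image_mset (hmap \<sigma>) G" "ys' = map \<sigma> ys"
      using TComp.IH(2)[OF 1(2) 2(2)] by blast
    let ?\<tau> = "\<lambda>w. if w \<in> wires xs F then \<rho> w else \<sigma> w"
    \<comment> \<open>Both renamings send the middle list \<open>zs\<close> to \<open>zs'\<close>,
      so they agree on exactly the shared wires.\<close>
    have agree: "\<rho> w = \<sigma> w" if "w \<in> set zs" for w using r(4) s(2) that by auto
    have inj: "inj_on ?\<tau> (wires xs F \<union> wires zs G)"
    proof (rule inj_on_glue[OF r(1) s(1)])
      show "\<rho> w = \<sigma> w" if "w \<in> wires xs F \<inter> wires zs G" for w using that agree 1(4) by auto
      have "\<rho> ` wires xs F = wires xs' F'" "\<sigma> ` wires zs G = wires zs' G'"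
        using r s by (simp_all add: wires_hmap)
      then show "\<rho> ` wires xs F \<inter> \<sigma> ` wires zs G \<subseteq> \<rho> ` (wires xs F \<inter> wires zs G)"
        using 2(4) 1(4) r(4) by simp
    qed
    have t: "?\<tau> w = \<sigma> w" if "w \<in> wires zs G" for w using that agree 1(4) by auto
    have "image_mset (hmap ?\<tau>) F = F'" "map ?\<tau> xs = xs'"
      using image_hmap_cong[OF 1(1), of ?\<tau> \<rho>] r by auto
    moreover have "image_mset (hmap ?\<tau>) G = G'" "map ?\<tau> ys = ys'"
      using image_hmap_cong[OF 1(2), of ?\<tau> \<sigma>, OF t] s by auto
    ultimately show ?case using inj 1(3) 2(3) wires_comp[OF 1(1)] by (auto intro!: exI[of _ ?\<tau>])
  next
    case (TTens s t)
    obtain x1 x2 F G y1 y2 where 1: "denotes Sg s x1 F y1" "denotes Sg t x2 G y2" "xs = x1 @ x2" "E = F + G"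
      "ys = y1 @ y2" "wires x1 F \<inter> wires x2 G = {}" using TTens.prems(1) unfolding denotes.simps by blast
    obtain x1' x2' F' G' y1' y2' where 2: "denotes Sg s x1' F' y1'" "denotes Sg t x2' G' y2'" "xs' = x1' @ x2'" "E' = F' + G'"
      "ys' = y1' @ y2'" "wires x1' F' \<inter> wires x2' G' = {}" using TTens.prems(2) unfolding denotes.simps by blast
    obtain \<rho> where r: "inj_on \<rho> (wires x1 F)" "x1' = map \<rho> x1" "F' = image_mset (hmap \<rho>) F" "y1' = map \<rho> y1"
      using TTens.IH(1)[OF 1(1) 2(1)] by blast
    obtain \<sigma> where s: "inj_on \<sigma> (wires x2 G)" "x2' = map \<sigma> x2" "G' = image_mset (hmap \<sigma>) G" "y2' = map \<sigma> y2"
      using TTens.IH(2)[OF 1(2) 2(2)] by blast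
    let ?\<tau> = "\<lambda>w. if w \<in> wires x1 F then \<rho> w else \<sigma> w"
    have inj: "inj_on ?\<tau> (wires x1 F \<union> wires x2 G)"
    proof (rule inj_on_glue[OF r(1) s(1)])
      have "\<rho> ` wires x1 F = wires x1' F'" "\<sigma> ` wires x2 G = wires x2' G'"
        using r s by (simp_all add: wires_hmap)
      then show "\<rho> ` wires x1 F \<inter> \<sigma> ` wires x2 G \<subseteq> \<rho> ` (wires x1 F \<inter> wires x2 G)"
        using 2(6) by simp
    qed (use 1(6) in auto)
    have t: "?\<tau> w = \<sigma> w" if "w \<in> wires x2 G" for w using that 1(6) by auto
    have "image_mset (hmap ?\<tau>) F = F'" "map ?\<tau> x1 = x1'" "map ?\<tau> y1 = y1'"
      using image_hmap_cong[OF 1(1), of ?\<tau> \<rho>] r by auto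
    moreover have "image_mset (hmap ?\<tau>) G = G'" "map ?\<tau> x2 = x2'" "map ?\<tau> y2 = y2'"
      using image_hmap_cong[OF 1(2), of ?\<tau> \<sigma>, OF t] s by auto
    ultimately have "inj_on ?\<tau> (wires xs E) \<and> xs' = map ?\<tau> xs \<and> E' = image_mset (hmap ?\<tau>) E \<and> ys' = map ?\<tau> ys"
      using inj unfolding 1(3,4,5) 2(3,4,5) wires_simps map_append image_mset_union by metis
    then show ?case by (intro exI[of _ ?\<tau>])
  }
qed

section \<open>Terms denoting a given diagram\<close>

lemma wires_int_cod:
  assumes "denotes Sg s xs F ys" "monogamous xs (F + G) zs"
  shows "wires xs F \<inter> wires ys G = set ys"
proof
  show "set ys \<subseteq> wires xs F \<inter> wires ys G" using denotes_wires_cod[OF assms(1)] wires_dom by blast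
  have "\<forall>w. count ((mset xs + tgts F) + tgts G) w \<le> 1" using assms(2) unfolding monogamous_def tgts_simps by (metis add.assoc)
  \<comment> \<open>A shared wire outside \<open>ys\<close> would be a target of \<open>G\<close>
    and also be produced by \<open>xs\<close> or \<open>F\<close>, hence be counted twice. Thus
    monogamy of the whole implies the sharing condition of its parts.\<close>
  from count_le_disjoint[OF this] show "wires xs F \<inter> wires ys G \<subseteq> set ys"
    by (auto simp: wires_def)
qed

text \<open>The term repeats the recursion of \<open>P\<close>: route all other wires, then insert
  the head at its place.\<close>

lemma permutation_denoted:
  "mset xs = mset ys \<Longrightarrow> distinct ys \<Longrightarrow> \<exists>t. wf_term Sg t \<and> denotes Sg t xs {#} ys"
proof (induction xs arbitrary: ys)
  case Nil
  then show ?case by (auto intro!: exI[of _ "TId 0"])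
next
  case (Cons x xs)
  have "x \<in> set ys" using Cons.prems(1) by (metis list.set_intros(1) set_mset_mset)
  then obtain a b where ab: "ys = a @ x # b" by (meson split_list)
  then have m: "mset xs = mset (a @ b)" and d: "distinct (a @ b)" and xn: "x \<notin> set (a @ b)" using Cons.prems by auto
  obtain t where t: "wf_term Sg t" "denotes Sg t xs {#} (a @ b)" using Cons.IH[OF m d] by blast
  have x: "x \<notin> set xs" "length xs = length (a @ b)" using xn m by (metis set_mset_mset, metis mset_eq_length)
  have 1: "denotes Sg (TTens (TId 1) t) ([x] @ xs) ({#} + {#}) ([x] @ (a @ b))"
    by (rule denotes_tensI) (use t x in auto)
  have 2: "denotes Sg (TTens (TSym 1 (length a)) (TId (length b))) (([x] @ a) @ b) ({#} + {#}) ((a @ [x]) @ b)"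
    by (intro denotes_tensI denotes_TSymI) (use d xn in auto)
  have "denotes Sg (TComp (TTens (TId 1) t) (TTens (TSym 1 (length a)) (TId (length b))))
      ([x] @ xs) (({#} + {#}) + ({#} + {#})) ((a @ [x]) @ b)"
    by (rule denotes_compI[OF 1]) (use 2 mset_eq_setD[OF m] in auto)
  moreover have "wf_term Sg (TComp (TTens (TId 1) t) (TTens (TSym 1 (length a)) (TId (length b))))"
    using t denotes_cod[OF t(2)] by simp
  ultimately show ?case using ab by (intro exI[of _ "TComp (TTens (TId 1) t) (TTens (TSym 1 (length a)) (TId (length b)))"]) simp
qed

text \<open>The term repeats one step of \<open>val\<close>: a permutation bringing the sources to
  the front, the operation beside an identity, and the term of the tail.\<close>

lemma prog_denoted: "prog Sg xs es ys \<Longrightarrow> \<exists>t. wf_term Sg t \<and> denotes Sg t xs (mset es) ys"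
proof (induction es arbitrary: xs)
  case Nil
  then show ?case using permutation_denoted by auto
next
  case (Cons e es)
  obtain r where r: "mset xs = mset (hsrc e @ r)" using prog_Cons(1)[OF Cons.prems] by blast
  note p = prog_Cons(6,7)[OF Cons.prems r] and g = prog_Cons(3-5)[OF Cons.prems]
  obtain t where t: "wf_term Sg t" "denotes Sg t (htgt e @ r) (mset es) ys" using Cons.IH[OF p(1)] by blast
  obtain s where s: "wf_term Sg s" "denotes Sg s xs {#} (hsrc e @ r)" using permutation_denoted[OF r] p(2) by blast
  have m: "monogamous xs (mset (e # es)) ys" using Cons.prems by (simp add: prog_def)
  have m1: "\<forall>w. count ((mset (hsrc e) + mset r) + (mset (htgt e) + tgts (mset es))) w \<le> 1"
    using m r unfolding monogamous_def by simp
  from count_le_disjoint[OF this] have d1: "(set (hsrc e) \<union> set r) \<inter> (set (htgt e) \<union> set_mset (tgts (mset es))) = {}"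
    by simp
  have "\<forall>w. count (mset (htgt e) + tgts (mset es)) w \<le> 1"
    using m1 by (rule count_le_mono) simp
  from count_le_disjoint[OF this] have d2: "set (htgt e) \<inter> set_mset (tgts (mset es)) = {}" by simp
  have e: "{#(hlab e, hsrc e, htgt e)#} = {#e#}" by simp
  have G: "denotes Sg (TGen (hlab e)) (hsrc e) {#e#} (htgt e)"
    using g p(2) d1 by auto
  have 1: "denotes Sg (TTens (TGen (hlab e)) (TId (length r))) (hsrc e @ r) ({#e#} + {#}) (htgt e @ r)"
    by (rule denotes_tensI[OF G]) (use p(2) d1 in \<open>auto simp: wires_def\<close>)
  have 2: "denotes Sg (TComp (TTens (TGen (hlab e)) (TId (length r))) t) (hsrc e @ r) (({#e#} + {#}) + mset es) ys"
    by (rule denotes_compI[OF 1 t(2)]) (use d1 d2 in \<open>auto simp: wires_def\<close>)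
  have 3: "denotes Sg (TComp s (TComp (TTens (TGen (hlab e)) (TId (length r))) t)) xs ({#} + (({#e#} + {#}) + mset es)) ys"
    \<comment> \<open>The permutation in front has no hyperedges, so the monogamy required for the
      sharing condition is that of the whole sequence.\<close>
    by (rule denotes_compI[OF s(2) 2], rule wires_int_cod[OF s(2)]) (use m in simp)
  then show ?case using s(1) t(1) g denotes_cod[OF s(2)] denotes_dom[OF t(2)]
    by (intro exI[of _ "TComp s (TComp (TTens (TGen (hlab e)) (TId (length r))) t)"]) (simp del: denotes.simps)
qed


section \<open>Classes of terms\<close>

lemma free_eq_types: "free_eq Sg n m s t \<Longrightarrow> s \<in> pterms Sg n m \<and> t \<in> pterms Sg n m"
  by (induction rule: free_eq.induct) (auto simp: pterms_def)

text \<open>The type is read off the term, so an ill-formed term has the empty class. The empty set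
  thereby serves as the value of every ill-typed composite.\<close>

definition cls :: "'o signature \<Rightarrow> 'o pterm \<Rightarrow> 'o pterm set" where
  "cls Sg t = {s. free_eq Sg (tdom Sg t) (tcod Sg t) t s}"

lemma mem_cls: "s \<in> cls Sg t \<Longrightarrow> wf_term Sg s \<and> wf_term Sg t \<and> tdom Sg s = tdom Sg t \<and> tcod Sg s = tcod Sg t"
  by (auto simp: cls_def pterms_def dest: free_eq_types)

lemma cls_self: "wf_term Sg t \<Longrightarrow> t \<in> cls Sg t"
  by (auto simp: cls_def pterms_def intro: free_eq.refl)

lemma cls_empty_iff [simp]: "cls Sg t = {} \<longleftrightarrow> \<not> wf_term Sg t"
  using mem_cls cls_self by blast

lemma cls_eqI: "free_eq Sg n m s t \<Longrightarrow> cls Sg s = cls Sg t"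
  using free_eq_types[of Sg n m s t]
  by (auto simp: cls_def pterms_def intro: free_eq.sym free_eq.trans)

text \<open>The guard sends arguments that are not classes to the empty set, which makes
  associativity an equation for arbitrary sets, as \<open>prop_algebra\<close> demands.\<close>

definition ccomp :: "'o signature \<Rightarrow> 'o pterm set \<Rightarrow> 'o pterm set \<Rightarrow> 'o pterm set" where
  "ccomp Sg X Y = (if X \<in> range (cls Sg) \<and> Y \<in> range (cls Sg) then \<Union>s\<in>X. \<Union>t\<in>Y. cls Sg (TComp s t) else {})"

definition ctens :: "'o signature \<Rightarrow> 'o pterm set \<Rightarrow> 'o pterm set \<Rightarrow> 'o pterm set" where
  "ctens Sg X Y = (if X \<in> range (cls Sg) \<and> Y \<in> range (cls Sg) then \<Union>s\<in>X. \<Union>t\<in>Y. cls Sg (TTens s t) else {})"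

lemma cls_TComp_cong:
  assumes "s' \<in> cls Sg s" "t' \<in> cls Sg t"
  shows "cls Sg (TComp s' t') = cls Sg (TComp s t)"
proof (cases "tcod Sg s = tdom Sg t")
  case True
  have "free_eq Sg (tdom Sg s) (tcod Sg t) (TComp s t) (TComp s' t')"
    using assms True by (auto simp: cls_def intro: free_eq.cong_comp)
  then show ?thesis using cls_eqI by metis
next
  case False
  then have "\<not> wf_term Sg (TComp s t)" "\<not> wf_term Sg (TComp s' t')"
    using assms[THEN mem_cls] by auto
  then show ?thesis by (metis cls_empty_iff)
qed

lemma cls_TTens_cong:
  assumes "s' \<in> cls Sg s" "t' \<in> cls Sg t"
  shows "cls Sg (TTens s' t') = cls Sg (TTens s t)"
proof -
  have "free_eq Sg (tdom Sg s + tdom Sg t) (tcod Sg s + tcod Sg t) (TTens s t) (TTens s' t')"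
    using assms by (auto simp: cls_def intro: free_eq.cong_tens)
  then show ?thesis using cls_eqI by metis
qed

lemma op_empty [simp]: "ccomp Sg {} Y = {}" "ccomp Sg X {} = {}" "ctens Sg {} Y = {}" "ctens Sg X {} = {}"
  by (auto simp: ccomp_def ctens_def)

lemma ccomp_cls [simp]: "ccomp Sg (cls Sg s) (cls Sg t) = cls Sg (TComp s t)"
proof (cases "wf_term Sg s \<and> wf_term Sg t")
  case True
  have "(\<Union>s'\<in>cls Sg s. \<Union>t'\<in>cls Sg t. cls Sg (TComp s' t')) = (\<Union>s'\<in>cls Sg s. \<Union>t'\<in>cls Sg t. cls Sg (TComp s t))"
    by (rule SUP_cong[OF HOL.refl], rule SUP_cong[OF HOL.refl], rule cls_TComp_cong)
  also have "\<dots> = cls Sg (TComp s t)" using True by auto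
  finally show ?thesis by (simp add: ccomp_def)
next
  case False
  then have "cls Sg s = {} \<or> cls Sg t = {}" "cls Sg (TComp s t) = {}" by auto
  then show ?thesis by (metis op_empty)
qed

lemma ctens_cls [simp]: "ctens Sg (cls Sg s) (cls Sg t) = cls Sg (TTens s t)"
proof (cases "wf_term Sg s \<and> wf_term Sg t")
  case True
  have "(\<Union>s'\<in>cls Sg s. \<Union>t'\<in>cls Sg t. cls Sg (TTens s' t')) = (\<Union>s'\<in>cls Sg s. \<Union>t'\<in>cls Sg t. cls Sg (TTens s t))"
    by (rule SUP_cong[OF HOL.refl], rule SUP_cong[OF HOL.refl], rule cls_TTens_cong)
  also have "\<dots> = cls Sg (TTens s t)" using True by auto
  finally show ?thesis by (simp add: ctens_def)
next
  case False
  then have "cls Sg s = {} \<or> cls Sg t = {}" "cls Sg (TTens s t) = {}" by auto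
  then show ?thesis by (metis op_empty)
qed

definition is_cls :: "'o signature \<Rightarrow> 'o pterm set \<Rightarrow> bool" where
  "is_cls Sg X \<longleftrightarrow> (\<exists>t. wf_term Sg t \<and> X = cls Sg t)"

definition cdom :: "'o signature \<Rightarrow> 'o pterm set \<Rightarrow> nat" where
  "cdom Sg X = tdom Sg (SOME t. t \<in> X)"

definition ccod :: "'o signature \<Rightarrow> 'o pterm set \<Rightarrow> nat" where
  "ccod Sg X = tcod Sg (SOME t. t \<in> X)"

lemma cls_type [simp]:
  assumes "wf_term Sg t"
  shows "is_cls Sg (cls Sg t)" "cdom Sg (cls Sg t) = tdom Sg t" "ccod Sg (cls Sg t) = tcod Sg t"
proof -
  have "(SOME s. s \<in> cls Sg t) \<in> cls Sg t" using cls_self[OF assms] by (rule someI)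
  then show "is_cls Sg (cls Sg t)" "cdom Sg (cls Sg t) = tdom Sg t" "ccod Sg (cls Sg t) = tcod Sg t"
    using mem_cls assms unfolding is_cls_def cdom_def ccod_def by blast+
qed

lemma is_clsE:
  assumes "is_cls Sg X"
  obtains t where "wf_term Sg t" "X = cls Sg t" "cdom Sg X = tdom Sg t" "ccod Sg X = tcod Sg t"
  using assms cls_type unfolding is_cls_def by metis

lemma op_outside:
  assumes "X \<notin> range (cls Sg) \<or> Y \<notin> range (cls Sg)"
  shows "ccomp Sg X Y = {}" "ctens Sg X Y = {}"
  using assms by (auto simp: ccomp_def ctens_def)

lemma ccomp_assoc: "ccomp Sg (ccomp Sg X Y) Z = ccomp Sg X (ccomp Sg Y Z)"
proof (cases "X \<in> range (cls Sg) \<and> Y \<in> range (cls Sg) \<and> Z \<in> range (cls Sg)")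
  case True
  then obtain f g h where 1: "X = cls Sg f" "Y = cls Sg g" "Z = cls Sg h" by blast
  have "cls Sg (TComp (TComp f g) h) = cls Sg (TComp f (TComp g h))"
  proof (cases "wf_term Sg (TComp (TComp f g) h)")
    case True
    then show ?thesis by (intro cls_eqI free_eq.comp_assoc) (auto simp: pterms_def)
  next
    case False
    then have "\<not> wf_term Sg (TComp f (TComp g h))" by auto
    with False show ?thesis by (metis cls_empty_iff)
  qed
  then show ?thesis using 1 by simp
qed (auto simp: op_outside)

lemma ctens_assoc: "ctens Sg (ctens Sg X Y) Z = ctens Sg X (ctens Sg Y Z)"
proof (cases "X \<in> range (cls Sg) \<and> Y \<in> range (cls Sg) \<and> Z \<in> range (cls Sg)")
  case True
  then obtain f g h where 1: "X = cls Sg f" "Y = cls Sg g" "Z = cls Sg h" by blast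
  have "cls Sg (TTens (TTens f g) h) = cls Sg (TTens f (TTens g h))"
  proof (cases "wf_term Sg (TTens (TTens f g) h)")
    case True
    then show ?thesis by (intro cls_eqI[OF free_eq.tens_assoc]) (auto simp: pterms_def)
  next
    case False
    then have "\<not> wf_term Sg (TTens f (TTens g h))" by auto
    with False show ?thesis by (metis cls_empty_iff)
  qed
  then show ?thesis using 1 by simp
qed (auto simp: op_outside)

text \<open>Here \<open>val\<close> takes its values in classes of terms: two sequences with equal
  values yield terms that are provably equal in the free PROP.\<close>

interpretation free: prop_algebra_gen "is_cls Sg" "cdom Sg" "ccod Sg" "\<lambda>n. cls Sg (TId n)"
  "\<lambda>n m. cls Sg (TSym n m)" "ccomp Sg" "ctens Sg" Sg "\<lambda>g. cls Sg (TGen g)" for Sg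
proof
  fix f g assume fg: "is_cls Sg f" "is_cls Sg g"
  obtain s where s: "wf_term Sg s" "f = cls Sg s" "cdom Sg f = tdom Sg s" "ccod Sg f = tcod Sg s" using fg(1) by (rule is_clsE)
  obtain t where t: "wf_term Sg t" "g = cls Sg t" "cdom Sg g = tdom Sg t" "ccod Sg g = tcod Sg t" using fg(2) by (rule is_clsE)
  show "is_cls Sg (ccomp Sg f g)" "cdom Sg (ccomp Sg f g) = cdom Sg f" "ccod Sg (ccomp Sg f g) = ccod Sg g"
    if "ccod Sg f = cdom Sg g" using that s t by simp_all
  show "is_cls Sg (ctens Sg f g)" "cdom Sg (ctens Sg f g) = cdom Sg f + cdom Sg g"
     "ccod Sg (ctens Sg f g) = ccod Sg f + ccod Sg g" using s t by simp_all
  show "ccomp Sg (ctens Sg f g) (cls Sg (TSym (ccod Sg f) (ccod Sg g))) =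
       ccomp Sg (cls Sg (TSym (cdom Sg f) (cdom Sg g))) (ctens Sg g f)"
    unfolding s t ctens_cls ccomp_cls
    by (rule cls_eqI, rule free_eq.sym_natural) (use s t in \<open>auto simp: pterms_def\<close>)
next
  fix f n assume f: "is_cls Sg f"
  obtain s where s: "wf_term Sg s" "f = cls Sg s" "cdom Sg f = tdom Sg s" "ccod Sg f = tcod Sg s" using f by (rule is_clsE)
  show "ccomp Sg (cls Sg (TId n)) f = f" if "cdom Sg f = n"
    unfolding s ccomp_cls by (rule cls_eqI, rule free_eq.id_left) (use s that in \<open>auto simp: pterms_def\<close>)
  show "ccomp Sg f (cls Sg (TId n)) = f" if "ccod Sg f = n"
    unfolding s ccomp_cls by (rule cls_eqI, rule free_eq.id_right) (use s that in \<open>auto simp: pterms_def\<close>)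
  show "ctens Sg (cls Sg (TId 0)) f = f"
    unfolding s ctens_cls by (rule cls_eqI, rule free_eq.unit_left) (use s in \<open>auto simp: pterms_def\<close>)
  show "ctens Sg f (cls Sg (TId 0)) = f"
    unfolding s ctens_cls by (rule cls_eqI, rule free_eq.unit_right) (use s in \<open>auto simp: pterms_def\<close>)
next
  fix f1 g1 f2 g2
  assume a: "is_cls Sg f1" "is_cls Sg g1" "is_cls Sg f2" "is_cls Sg g2" "ccod Sg f1 = cdom Sg g1" "ccod Sg f2 = cdom Sg g2"
  obtain s1 where s1: "wf_term Sg s1" "f1 = cls Sg s1" "ccod Sg f1 = tcod Sg s1" using a(1) by (rule is_clsE)
  obtain t1 where t1: "wf_term Sg t1" "g1 = cls Sg t1" "cdom Sg g1 = tdom Sg t1" using a(2) by (rule is_clsE)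
  obtain s2 where s2: "wf_term Sg s2" "f2 = cls Sg s2" "ccod Sg f2 = tcod Sg s2" using a(3) by (rule is_clsE)
  obtain t2 where t2: "wf_term Sg t2" "g2 = cls Sg t2" "cdom Sg g2 = tdom Sg t2" using a(4) by (rule is_clsE)
  show "ctens Sg (ccomp Sg f1 g1) (ccomp Sg f2 g2) = ccomp Sg (ctens Sg f1 f2) (ctens Sg g1 g2)"
    unfolding s1(2) t1(2) s2(2) t2(2) ctens_cls ccomp_cls
    by (rule cls_eqI, rule free_eq.interchange) (use s1 s2 t1 t2 a in \<open>auto simp: pterms_def\<close>)
next
  fix n m k
  show "ctens Sg (cls Sg (TId n)) (cls Sg (TId m)) = cls Sg (TId (n + m))"
    unfolding ctens_cls by (rule cls_eqI, rule free_eq.tens_id)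
  show "ccomp Sg (cls Sg (TSym n m)) (cls Sg (TSym m n)) = cls Sg (TId (n + m))"
    unfolding ccomp_cls by (rule cls_eqI, rule free_eq.sym_sym)
  show "cls Sg (TSym n (m + k)) = ccomp Sg (ctens Sg (cls Sg (TSym n m)) (cls Sg (TId k)))
      (ctens Sg (cls Sg (TId m)) (cls Sg (TSym n k)))"
    unfolding ctens_cls ccomp_cls by (rule cls_eqI, rule free_eq.hexagon)
qed (simp_all add: ccomp_assoc ctens_assoc)

text \<open>The listing is built along the term by concatenation. It is admissible for a composite
  because the outputs of the first part are among the wires it was given or has produced, and for a
  tensor because additional available wires do no harm.\<close>

lemma denotes_val:
  "denotes Sg t xs E ys \<Longrightarrow> wf_term Sg t \<Longrightarrow> \<exists>es. mset es = E \<and> prog Sg xs es ys \<and> cls Sg t = free.val Sg xs es ys"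
proof (induction t arbitrary: xs E ys)
  case (TId n)
  then show ?case by (auto intro!: exI[of _ "[]"])
next
  case (TSym n m)
  then obtain us vs where 1: "xs = us @ vs" "ys = vs @ us" "length us = n" "length vs = m" "distinct xs" "E = {#}"
    by auto
  then show ?case using free.P_sym[of us vs Sg] by (intro exI[of _ "[]"]) auto
next
  case (TGen g)
  let ?e = "(g, xs, ys)"
  have p: "prog Sg xs [?e] ys"
    using TGen denotes_monogamous[OF TGen.prems(1)] by (auto simp: prog_def)
  have d: "distinct xs" "distinct ys" using prog_distinct[OF p] by auto
  have "free.val Sg xs [?e] ys = cls Sg (TGen g)"
    using free.val_step[OF p, of "[]"] TGen d by (simp del: ccomp_cls ctens_cls)
  then show ?case using p TGen by (intro exI[of _ "[?e]"]) auto
next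
  case (TComp s t)
  obtain F G zs where 1: "denotes Sg s xs F zs" "denotes Sg t zs G ys" "E = F + G"
     "wires xs F \<inter> wires zs G = set zs" using TComp.prems(1) unfolding denotes.simps by blast
  obtain es where es: "mset es = F" "prog Sg xs es zs" "cls Sg s = free.val Sg xs es zs"
    using TComp.IH(1)[OF 1(1)] TComp.prems(2) by auto
  obtain fs where fs: "mset fs = G" "prog Sg zs fs ys" "cls Sg t = free.val Sg zs fs ys"
    using TComp.IH(2)[OF 1(2)] TComp.prems(2) by auto
  have "set zs \<subseteq> set xs \<union> set_mset (tgts (mset es))" using denotes_wires_cod[OF 1(1)] es(1) by (simp add: wires_def)
  then have "linear_from (set xs) (es @ fs)"
    using es(2) fs(2) by (auto simp: prog_def linear_from_append intro: linear_from_mono)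
  then have p: "prog Sg xs (es @ fs) ys"
    using denotes_monogamous[OF TComp.prems(1)] es fs 1(3) by (simp add: prog_def)
  have "cls Sg (TComp s t) = free.val Sg xs (es @ fs) ys"
    using free.val_comp[OF es(2) fs(2) p] es(3) fs(3) by (metis ccomp_cls)
  then show ?case using p es fs 1 by (intro exI[of _ "es @ fs"]) auto
next
  case (TTens s t)
  obtain x1 x2 F G y1 y2 where 1: "denotes Sg s x1 F y1" "denotes Sg t x2 G y2" "xs = x1 @ x2" "E = F + G"
    "ys = y1 @ y2" "wires x1 F \<inter> wires x2 G = {}" using TTens.prems(1) unfolding denotes.simps by blast
  obtain es where es: "mset es = F" "prog Sg x1 es y1" "cls Sg s = free.val Sg x1 es y1"
    using TTens.IH(1)[OF 1(1)] TTens.prems(2) by auto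
  obtain fs where fs: "mset fs = G" "prog Sg x2 fs y2" "cls Sg t = free.val Sg x2 fs y2"
    using TTens.IH(2)[OF 1(2)] TTens.prems(2) by auto
  note m = denotes_monogamous[OF 1(1)] denotes_monogamous[OF 1(2)]
  have l: "linear_from (set x1 \<union> A) es" "linear_from (A \<union> set x2) fs" for A
    using es(2) fs(2) by (auto simp: prog_def intro: linear_from_mono)
  \<comment> \<open>The idle wires \<open>x2\<close> form a diagram without hyperedges, so monogamy
    with idle wires is an instance of that of tensors.\<close>
  have "monogamous (x1 @ x2) (F + {#}) (y1 @ x2)"
    by (rule monogamous_tensor[OF m(1)]) (use prog_distinct[OF fs(2)] 1(6) wires_dom[of x2 G] in \<open>auto simp: monogamous_empty\<close>)
  then have p1: "prog Sg (x1 @ x2) es (y1 @ x2)" using es l by (simp add: prog_def)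
  have "monogamous (y1 @ x2) ({#} + G) (y1 @ y2)"
    by (rule monogamous_tensor[OF _ m(2)])
       (use prog_distinct[OF es(2)] 1(6) denotes_wires_cod[OF 1(1)] in \<open>auto simp: monogamous_empty\<close>)
  then have p2: "prog Sg (y1 @ x2) fs (y1 @ y2)" using fs l by (simp add: prog_def)
  have "linear_from (set (x1 @ x2)) (es @ fs)"
    using l by (auto simp: linear_from_append intro: linear_from_mono)
  then have p3: "prog Sg (x1 @ x2) (es @ fs) (y1 @ y2)"
    using denotes_monogamous[OF TTens.prems(1)] es fs 1(3-5) by (simp add: prog_def)
  have "cls Sg (TTens s t) = free.val Sg (x1 @ x2) (es @ fs) (y1 @ y2)"
    using free.val_tensor[OF es(2) fs(2) p1 p2 p3] es(3) fs(3) by (metis ctens_cls)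
  then show ?case using p3 es fs 1 by (intro exI[of _ "es @ fs"]) auto
qed

text \<open>Two listings of one multiset \<open>E\<close> have the same value by
  \<open>val_mset_eq\<close>. The two terms share the very same names here, so no renaming
  intervenes.\<close>

theorem denotes_complete:
  assumes "denotes Sg s xs E ys" "denotes Sg t xs E ys" "wf_term Sg s" "wf_term Sg t"
  shows "cls Sg s = cls Sg t"
proof -
  obtain es where "mset es = E" "prog Sg xs es ys" "cls Sg s = free.val Sg xs es ys"
    using denotes_val assms by metis
  moreover obtain fs where "mset fs = E" "prog Sg xs fs ys" "cls Sg t = free.val Sg xs fs ys"
    using denotes_val assms by metis
  ultimately show ?thesis using free.val_mset_eq by metis
qed

section \<open>Permutation matrices\<close>

abbreviation pinv :: "('a \<Rightarrow> 'a) \<Rightarrow> 'a \<Rightarrow> 'a" where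
  "pinv p \<equiv> inv_into UNIV p"

lemma dim_perm_mat [simp]: "dim_row (perm_mat K p) = K" "dim_col (perm_mat K p) = K"
  by (auto simp: perm_mat_def)

lemma perm_mat_carrier [simp]: "perm_mat K p \<in> carrier_mat K K"
  by (rule carrier_matI) simp_all

lemma perm_mat_inject:
  assumes "p permutes {..<K}" "q permutes {..<K}" "perm_mat K p = perm_mat K q"
  shows "p = q"
proof
  fix i show "p i = q i"
  proof (cases "i < K")
    case True
    then have "p i < K" using assms(1) by (metis lessThan_iff permutes_in_image)
    then have "perm_mat K p $$ (p i, i) = 1" "perm_mat K q $$ (p i, i) = (if p i = q i then 1 else 0)"
      using True by (auto simp: perm_mat_def)
    then show ?thesis using assms(3) by (metis zero_neq_one)
  next
    case False
    then show ?thesis using assms(1,2) by (simp add: permutes_not_in)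
  qed
qed

lemma permutes_lt: "p permutes {..<K} \<Longrightarrow> (p i < K) = (i < (K::nat))"
  by (metis lessThan_iff permutes_in_image)

lemma perm_mat_mult_left:
  assumes "p permutes {..<K}" "A \<in> carrier_mat K n" "i < K" "j < n"
  shows "(perm_mat K p * A) $$ (i, j) = A $$ (pinv p i, j)"
proof -
  have e: "i = p k \<longleftrightarrow> k = pinv p i" for k using permutes_inv_eq[OF assms(1), of i k] by auto
  have i: "pinv p i < K" using assms(1,3) by (simp add: permutes_lt[OF permutes_inv])
  have "(perm_mat K p * A) $$ (i, j) = (\<Sum>k = 0..<K. (if i = p k then 1 else 0) * A $$ (k, j))"
    using assms by (auto simp: scalar_prod_def perm_mat_def intro!: sum.cong)
  also have "\<dots> = (\<Sum>k = 0..<K. if k = pinv p i then A $$ (k, j) else 0)"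
    by (intro sum.cong HOL.refl) (simp add: e)
  also have "\<dots> = A $$ (pinv p i, j)" using i by simp
  finally show ?thesis .
qed

lemma perm_mat_mult_right:
  assumes "p permutes {..<K}" "A \<in> carrier_mat n K" "i < n" "j < K"
  shows "(A * perm_mat K p) $$ (i, j) = A $$ (i, p j)"
proof -
  have j: "p j < K" using assms(1,4) by (simp add: permutes_lt)
  have "(A * perm_mat K p) $$ (i, j) = (\<Sum>k = 0..<K. A $$ (i, k) * (if k = p j then 1 else 0))"
    using assms by (auto simp: scalar_prod_def perm_mat_def intro!: sum.cong)
  also have "\<dots> = (\<Sum>k = 0..<K. if k = p j then A $$ (i, k) else 0)"
    by (intro sum.cong) auto
  also have "\<dots> = A $$ (i, p j)" using j by simp
  finally show ?thesis .
qed

lemma perm_mat_mult: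
  assumes "p permutes {..<K}"
  shows "perm_mat K p * perm_mat K q = perm_mat K (p \<circ> q)"
proof (rule eq_matI)
  fix i j assume a: "i < dim_row (perm_mat K (p \<circ> q))" "j < dim_col (perm_mat K (p \<circ> q))"
  then have "pinv p i < K" using assms by (simp add: permutes_lt[OF permutes_inv])
  with a assms show "(perm_mat K p * perm_mat K q) $$ (i, j) = perm_mat K (p \<circ> q) $$ (i, j)"
    using permutes_inv_eq[OF assms, of i "q j"]
    by (subst perm_mat_mult_left[OF assms perm_mat_carrier]) (auto simp: perm_mat_def)
qed simp_all

lemma perm_mat_transpose: "p permutes {..<K} \<Longrightarrow> (perm_mat K p)\<^sup>T = perm_mat K (pinv p)"
  by (rule eq_matI) (auto simp: perm_mat_def permutes_inv_eq)

lemma perm_mat_one: "1\<^sub>m n = perm_mat n id"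
  by (rule eq_matI) (auto simp: perm_mat_def)

text \<open>Conjugation with a permutation matrix, in terms of entries. Vertex \<open>v\<close>
  moves to position \<open>p v\<close>, so the entry at given positions is read at their
  preimages.\<close>

definition reorder :: "(nat \<Rightarrow> nat) \<Rightarrow> nat mat \<Rightarrow> nat mat" where
  "reorder p A = mat (dim_row A) (dim_col A) (\<lambda>(i, j). A $$ (pinv p i, pinv p j))"

lemma reorder_conj:
  assumes "p permutes {..<K}" "A \<in> carrier_mat K K"
  shows "(perm_mat K p)\<^sup>T \<Zsemi> A \<Zsemi> perm_mat K p = reorder p A"
proof (rule eq_matI)
  fix i j assume "i < dim_row (reorder p A)" "j < dim_col (reorder p A)"
  then have ij: "i < K" "j < K" using assms by (auto simp: reorder_def)
  have i': "pinv p i < K" using assms(1) ij by (simp add: permutes_lt[OF permutes_inv])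
  have c: "A * perm_mat K (pinv p) \<in> carrier_mat K K" using assms(2) by simp
  show "((perm_mat K p)\<^sup>T \<Zsemi> A \<Zsemi> perm_mat K p) $$ (i, j) = reorder p A $$ (i, j)"
    unfolding dcomp_def perm_mat_transpose[OF assms(1)] perm_mat_mult_left[OF assms(1) c ij]
      perm_mat_mult_right[OF permutes_inv[OF assms(1)] assms(2) i' ij(2)]
    using ij assms by (simp add: reorder_def)
qed (use assms in \<open>simp_all add: dcomp_def reorder_def\<close>)

lemma reorder_carrier: "A \<in> carrier_mat K K \<Longrightarrow> reorder p A \<in> carrier_mat K K"
  by (simp add: reorder_def)

lemma reorder_index: "A \<in> carrier_mat K K \<Longrightarrow> i < K \<Longrightarrow> j < K \<Longrightarrow> reorder p A $$ (i, j) = A $$ (pinv p i, pinv p j)"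
  by (simp add: reorder_def)

lemma length_permute_labels [simp]: "length (N \<Zsemi>\<^sub>l P) = length N"
  by (simp add: permute_labels_def)

lemma permute_labels_nth:
  assumes "p permutes {..<K}" "length N = K" "i < K"
  shows "(N \<Zsemi>\<^sub>l perm_mat K p) ! i = N ! pinv p i"
proof -
  have "(THE j. j < K \<and> perm_mat K p $$ (i, j) = 1) = pinv p i"
  proof (rule the_equality)
    show "pinv p i < K \<and> perm_mat K p $$ (i, pinv p i) = 1"
      using assms permutes_lt[OF permutes_inv[OF assms(1)]] permutes_inverses(1)[OF assms(1)]
      by (auto simp: perm_mat_def)
    show "j = pinv p i" if "j < K \<and> perm_mat K p $$ (i, j) = 1" for j
      using that assms permutes_inv_eq[OF assms(1), of i j] by (auto simp: perm_mat_def split: if_splits)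
  qed
  then show ?thesis using assms by (simp add: permute_labels_def)
qed

text \<open>The permutation behind a direct sum of permutation matrices. Beyond both blocks it is
  the identity because \<open>q\<close> is, which is what \<open>permutes\<close> asks for.\<close>

definition psum :: "nat \<Rightarrow> (nat \<Rightarrow> nat) \<Rightarrow> (nat \<Rightarrow> nat) \<Rightarrow> nat \<Rightarrow> nat" where
  "psum a p q i = (if i < a then p i else a + q (i - a))"

lemma psum_permutes:
  assumes "p permutes {..<a}" "q permutes {..<b}"
  shows "psum a p q permutes {..<a + b}"
proof (rule bij_imp_permutes)
  have "inj_on (psum a p q) {..<a + b}"
  proof (rule inj_onI)
    fix x y assume "x \<in> {..<a + b}" "y \<in> {..<a + b}" and e: "psum a p q x = psum a p q y"
    have lt: "p z < a" if "z < a" for z using that permutes_lt[OF assms(1)] by blast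
    have i: "p u = p v \<Longrightarrow> u = v" "q u = q v \<Longrightarrow> u = v" for u v
      using permutes_inj[OF assms(1)] permutes_inj[OF assms(2)] by (auto dest: injD)
    show "x = y"
      using e i(1)[of x y] i(2)[of "x - a" "y - a"] lt[of x] lt[of y] by (auto simp: psum_def split: if_splits)
  qed
  moreover have "psum a p q ` {..<a + b} \<subseteq> {..<a + b}"
  proof
    fix y assume "y \<in> psum a p q ` {..<a + b}"
    then obtain x where x: "y = psum a p q x" "x < a + b" by auto
    show "y \<in> {..<a + b}"
    proof (cases "x < a")
      case True
      then have "p x < a" using permutes_lt[OF assms(1)] by blast
      then show ?thesis using x True by (simp add: psum_def)
    next
      case False
      then have "q (x - a) < b" using x permutes_lt[OF assms(2), of "x - a"] by linarith
      then show ?thesis using x False by (simp add: psum_def)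
    qed
  qed
  ultimately show "bij_betw (psum a p q) {..<a + b} {..<a + b}"
    by (simp add: bij_betw_def endo_inj_surj)
  show "psum a p q x = x" if "x \<notin> {..<a + b}" for x
    using that permutes_not_in[OF assms(2), of "x - a"] by (auto simp: psum_def)
qed

lemma dsum_perm_mat:
  assumes "p permutes {..<a}" "q permutes {..<b}"
  shows "perm_mat a p \<oplus>\<^sub>d perm_mat b q = perm_mat (a + b) (psum a p q)"
proof (rule eq_matI)
  fix i j assume "i < dim_row (perm_mat (a + b) (psum a p q))" "j < dim_col (perm_mat (a + b) (psum a p q))"
  then have ij: "i < a + b" "j < a + b" by auto
  have "p j < a" if "j < a" using that permutes_lt[OF assms(1)] by blast
  then show "(perm_mat a p \<oplus>\<^sub>d perm_mat b q) $$ (i, j) = perm_mat (a + b) (psum a p q) $$ (i, j)"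
    using ij by (auto simp: dsum_def perm_mat_def psum_def)
qed (simp_all add: dsum_def)

text \<open>The permutation behind \<open>sigma_mat\<close>, extended by the identity beyond
  \<open>a + b\<close>.\<close>

definition psig :: "nat \<Rightarrow> nat \<Rightarrow> nat \<Rightarrow> nat" where
  "psig a b j = (if j < a then b + j else if j < a + b then j - a else j)"

lemma psig_permutes: "psig a b permutes {..<a + b}"
proof (rule bij_imp_permutes)
  have "inj_on (psig a b) {..<a + b}" by (auto simp: inj_on_def psig_def)
  moreover have "psig a b ` {..<a + b} \<subseteq> {..<a + b}" by (auto simp: psig_def)
  ultimately show "bij_betw (psig a b) {..<a + b} {..<a + b}"
    by (simp add: bij_betw_def endo_inj_surj)
qed (auto simp: psig_def)

lemma sigma_perm_mat: "sigma_mat a b = perm_mat (a + b) (psig a b)"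
proof (rule eq_matI)
  fix i j assume "i < dim_row (perm_mat (a + b) (psig a b))" "j < dim_col (perm_mat (a + b) (psig a b))"
  then show "sigma_mat a b $$ (i, j) = perm_mat (a + b) (psig a b) $$ (i, j)"
    by (auto simp: sigma_mat_def perm_mat_def psig_def)
qed (simp_all add: sigma_mat_def)

section \<open>The hypergraph of a HAR\<close>

text \<open>The conditions of \<open>is_har\<close> that mention neither the orders nor the numbers
  of interface nodes. They are stable under gluing, whereas the interface changes.\<close>

definition har_graph :: "'o signature \<Rightarrow> nat \<Rightarrow> nat mat \<Rightarrow> 'o node list \<Rightarrow> bool" where
  "har_graph Sg K M N \<longleftrightarrow> M \<in> carrier_mat K K \<and> length N = K \<and> (\<forall>g. Circ g \<in> set N \<longrightarrow> g \<in> ops Sg) \<and>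
     acyclic (edges M) \<and> (\<forall>(j, i) \<in> edges M. (N ! j = Bullet) \<noteq> (N ! i = Bullet)) \<and>
     (\<forall>v < K. N ! v = Bullet \<longrightarrow> card (preds M v) \<le> 1 \<and> card (succs M v) \<le> 1) \<and>
     (\<forall>v < K. \<forall>g. N ! v = Circ g \<longrightarrow>
         bij_betw (\<lambda>u. M $$ (v, u)) (preds M v) {1..arity Sg g} \<and>
         bij_betw (\<lambda>w. M $$ (w, v)) (succs M v) {1..coarity Sg g})"

lemma mem_edges: "M \<in> carrier_mat K K \<Longrightarrow> (j, i) \<in> edges M \<longleftrightarrow> i < K \<and> j < K \<and> M $$ (i, j) \<noteq> 0"
  by (auto simp: edges_def)

lemma left_nodes_reorder:
  assumes "p permutes {..<K}" "M \<in> carrier_mat K K" "length N = K"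
  shows "left_nodes (reorder p M) (N \<Zsemi>\<^sub>l perm_mat K p) = p ` left_nodes M N"
    and "right_nodes (reorder p M) (N \<Zsemi>\<^sub>l perm_mat K p) = p ` right_nodes M N"
proof -
  note c = reorder_carrier[OF assms(2), of p]
  have lt: "pinv p v < K" if "v < K" for v using that permutes_lt[OF permutes_inv[OF assms(1)]] by blast
  have lt': "p v < K \<longleftrightarrow> v < K" for v using permutes_lt[OF assms(1)] by blast
  have inv: "p (pinv p v) = v" "pinv p (p v) = v" for v using permutes_inverses[OF assms(1)] by auto
  have pr: "preds (reorder p M) v = {} \<longleftrightarrow> preds M (pinv p v) = {}" if "v < K" for v
  proof -
    have "u \<in> preds (reorder p M) v \<longleftrightarrow> pinv p u \<in> preds M (pinv p v)" for u
      using that lt[of v] lt[of u] lt'[of "pinv p u"] unfolding preds_def mem_Collect_eq mem_edges[OF c] mem_edges[OF assms(2)]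
      by (auto simp: inv reorder_index[OF assms(2)])
    then show ?thesis using inv by (metis equals0D equals0I)
  qed
  have su: "succs (reorder p M) v = {} \<longleftrightarrow> succs M (pinv p v) = {}" if "v < K" for v
  proof -
    have "u \<in> succs (reorder p M) v \<longleftrightarrow> pinv p u \<in> succs M (pinv p v)" for u
      using that lt[of v] lt[of u] lt'[of "pinv p u"] unfolding succs_def mem_Collect_eq mem_edges[OF c] mem_edges[OF assms(2)]
      by (auto simp: inv reorder_index[OF assms(2)])
    then show ?thesis using inv by (metis equals0D equals0I)
  qed
  have im: "v \<in> p ` X \<longleftrightarrow> pinv p v \<in> X" for v X using inv by (metis image_iff)
  have lab: "v < K \<Longrightarrow> (N \<Zsemi>\<^sub>l perm_mat K p) ! v = N ! pinv p v" for v
    by (rule permute_labels_nth[OF assms(1,3)])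
  have ltiff: "pinv p v < K \<longleftrightarrow> v < K" for v using permutes_lt[OF permutes_inv[OF assms(1)]] by blast
  show "left_nodes (reorder p M) (N \<Zsemi>\<^sub>l perm_mat K p) = p ` left_nodes M N"
  proof -
    have "v \<in> left_nodes (reorder p M) (N \<Zsemi>\<^sub>l perm_mat K p) \<longleftrightarrow> v \<in> p ` left_nodes M N" for v
      unfolding im left_nodes_def mem_Collect_eq length_permute_labels assms(3)
      using lab[of v] pr[of v] ltiff[of v] by auto
    then show ?thesis by blast
  qed
  show "right_nodes (reorder p M) (N \<Zsemi>\<^sub>l perm_mat K p) = p ` right_nodes M N"
  proof -
    have "v \<in> right_nodes (reorder p M) (N \<Zsemi>\<^sub>l perm_mat K p) \<longleftrightarrow> v \<in> p ` right_nodes M N" for v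
      unfolding im right_nodes_def mem_Collect_eq length_permute_labels assms(3)
      using lab[of v] su[of v] ltiff[of v] by auto
    then show ?thesis by blast
  qed
qed

text \<open>Injectivity of \<open>l\<close> and \<open>r\<close> absorbs the cardinality conditions
  into the images. The inequality \<open>m \<le> hK f\<close> must be kept on the right: truncated
  subtraction in \<open>hK f - m\<close> would otherwise conceal its failure.\<close>

lemma is_har_iff:
  "is_har Sg n m f \<longleftrightarrow> har_graph Sg (hK f) (hM f) (hN f) \<and> m \<le> hK f \<and>
     (\<exists>l r. l permutes {..<hK f} \<and> r permutes {..<hK f} \<and> hL f = perm_mat (hK f) l \<and> hR f = perm_mat (hK f) r \<and>
        l ` left_nodes (hM f) (hN f) = {..<n} \<and> r ` right_nodes (hM f) (hN f) = {hK f - m..<hK f})"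
proof
  assume h: "is_har Sg n m f"
  have g: "har_graph Sg (hK f) (hM f) (hN f)" using h unfolding is_har_def har_graph_def Let_def by blast
  have c: "hM f \<in> carrier_mat (hK f) (hK f)" "length (hN f) = hK f" using g unfolding har_graph_def by auto
  obtain l r where lr: "l permutes {..<hK f}" "hL f = perm_mat (hK f) l" "r permutes {..<hK f}" "hR f = perm_mat (hK f) r"
    using h unfolding is_har_def Let_def is_perm_mat_def by blast
  have "card (right_nodes (hM f) (hN f)) = m" using h unfolding is_har_def Let_def by blast
  moreover have "right_nodes (hM f) (hN f) \<subseteq> {..<hK f}" using c by (auto simp: right_nodes_def)
  ultimately have "m \<le> hK f" using card_mono[of "{..<hK f}"] by fastforce
  moreover have "l ` left_nodes (hM f) (hN f) = {..<n}"
    using h left_nodes_reorder(1)[OF lr(1) c] unfolding is_har_def Let_def lr(2) reorder_conj[OF lr(1) c(1)] atLeast0LessThan by blast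
  moreover have "r ` right_nodes (hM f) (hN f) = {hK f - m..<hK f}"
    using h left_nodes_reorder(2)[OF lr(3) c] unfolding is_har_def Let_def lr(4) reorder_conj[OF lr(3) c(1)] by blast
  ultimately show "har_graph Sg (hK f) (hM f) (hN f) \<and> m \<le> hK f \<and>
     (\<exists>l r. l permutes {..<hK f} \<and> r permutes {..<hK f} \<and> hL f = perm_mat (hK f) l \<and> hR f = perm_mat (hK f) r \<and>
        l ` left_nodes (hM f) (hN f) = {..<n} \<and> r ` right_nodes (hM f) (hN f) = {hK f - m..<hK f})"
    using g lr by blast
next
  assume h: "har_graph Sg (hK f) (hM f) (hN f) \<and> m \<le> hK f \<and>
     (\<exists>l r. l permutes {..<hK f} \<and> r permutes {..<hK f} \<and> hL f = perm_mat (hK f) l \<and> hR f = perm_mat (hK f) r \<and>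
        l ` left_nodes (hM f) (hN f) = {..<n} \<and> r ` right_nodes (hM f) (hN f) = {hK f - m..<hK f})"
  then have g: "har_graph Sg (hK f) (hM f) (hN f)" "m \<le> hK f" by auto
  have c: "hM f \<in> carrier_mat (hK f) (hK f)" "length (hN f) = hK f" using g unfolding har_graph_def by auto
  obtain l r where lr: "l permutes {..<hK f}" "hL f = perm_mat (hK f) l" "r permutes {..<hK f}" "hR f = perm_mat (hK f) r"
    "l ` left_nodes (hM f) (hN f) = {..<n}" "r ` right_nodes (hM f) (hN f) = {hK f - m..<hK f}" using h by blast
  have "card (left_nodes (hM f) (hN f)) = n"
    using card_image[of l "left_nodes (hM f) (hN f)"] permutes_inj_on[OF lr(1)] lr(5) by simp
  moreover have "card (right_nodes (hM f) (hN f)) = m"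
    using card_image[of r "right_nodes (hM f) (hN f)"] permutes_inj_on[OF lr(3)] lr(6) g(2) by simp
  moreover have "is_perm_mat (hK f) (hL f)" "is_perm_mat (hK f) (hR f)" using lr unfolding is_perm_mat_def by blast+
  moreover have "left_nodes ((hL f)\<^sup>T \<Zsemi> hM f \<Zsemi> hL f) (hN f \<Zsemi>\<^sub>l hL f) = {0..<n}"
    unfolding lr(2) reorder_conj[OF lr(1) c(1)] left_nodes_reorder(1)[OF lr(1) c] lr(5) by auto
  moreover have "right_nodes ((hR f)\<^sup>T \<Zsemi> hM f \<Zsemi> hR f) (hN f \<Zsemi>\<^sub>l hR f) = {hK f - m..<hK f}"
    unfolding lr(4) reorder_conj[OF lr(3) c(1)] left_nodes_reorder(2)[OF lr(3) c] lr(6) by auto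
  ultimately show "is_har Sg n m f"
    using g(1) unfolding is_har_def Let_def har_graph_def by blast
qed

text \<open>Labels start at 1 and list positions at 0, hence \<open>Suc i\<close>. The description
  is proper because the labels at a vertex form a bijection; see
  \<open>bij_betw_labels\<close>.\<close>

definition circ_srcs :: "nat mat \<Rightarrow> nat \<Rightarrow> nat \<Rightarrow> nat list" where
  "circ_srcs M c a = map (\<lambda>i. THE u. u < dim_col M \<and> M $$ (c, u) = Suc i) [0..<a]"

definition circ_tgts :: "nat mat \<Rightarrow> nat \<Rightarrow> nat \<Rightarrow> nat list" where
  "circ_tgts M c b = map (\<lambda>i. THE w. w < dim_row M \<and> M $$ (w, c) = Suc i) [0..<b]"

primrec op_of :: "'o node \<Rightarrow> 'o" where
  "op_of (Circ g) = g"

definition circ_edge :: "'o signature \<Rightarrow> nat mat \<Rightarrow> 'o node list \<Rightarrow> nat \<Rightarrow> 'o hedge" where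
  "circ_edge Sg M N c = (op_of (N ! c), circ_srcs M c (arity Sg (op_of (N ! c))), circ_tgts M c (coarity Sg (op_of (N ! c))))"

definition circs :: "'o node list \<Rightarrow> nat set" where
  "circs N = {c. c < length N \<and> N ! c \<noteq> Bullet}"

definition bullets :: "'o node list \<Rightarrow> nat set" where
  "bullets N = {v. v < length N \<and> N ! v = Bullet}"

text \<open>A multiset, because vertices carrying the same operation of arity and coarity 0 give
  equal hyperedges, and their number matters.\<close>

definition hedges :: "'o signature \<Rightarrow> nat mat \<Rightarrow> 'o node list \<Rightarrow> 'o hedge multiset" where
  "hedges Sg M N = image_mset (circ_edge Sg M N) (mset_set (circs N))"

lemma finite_circs [simp]: "finite (circs N)" "finite (bullets N)"
  by (auto simp: circs_def bullets_def)

lemma circ_label: "c \<in> circs N \<Longrightarrow> N ! c = Circ (op_of (N ! c))"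
  by (cases "N ! c") (auto simp: circs_def)

text \<open>A neighbourhood labelled bijectively by an initial segment of the positive numbers
  amounts to a list without repetition; the parts of the lemma are the two directions of this
  translation.\<close>

lemma bij_betw_labels:
  assumes "bij_betw h A {1..n::nat}" "A = {u. u < K \<and> h u \<noteq> 0}"
  shows "\<And>i. i < n \<Longrightarrow> (THE u. u < K \<and> h u = Suc i) < K \<and> h (THE u. u < K \<and> h u = Suc i) = Suc i"
    and "\<And>u i. u < K \<Longrightarrow> h u = Suc i \<Longrightarrow> i < n \<and> u = (THE u. u < K \<and> h u = Suc i)"
    and "distinct (map (\<lambda>i. THE u. u < K \<and> h u = Suc i) [0..<n])"
    and "set (map (\<lambda>i. THE u. u < K \<and> h u = Suc i) [0..<n]) = A"
proof -
  have inj: "inj_on h A" and im: "h ` A = {1..n}" using assms(1) by (auto simp: bij_betw_def)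
  have ex: "\<exists>!u. u < K \<and> h u = Suc i" if "i < n" for i
  proof -
    have "Suc i \<in> h ` A" using that im by auto
    then obtain u where "u \<in> A" "h u = Suc i" by auto
    then have "u < K \<and> h u = Suc i" using assms(2) by auto
    moreover have "v = u" if "v < K \<and> h v = Suc i" for v
    proof (rule inj_onD[OF inj])
      show "h v = h u" using that \<open>h u = Suc i\<close> by simp
      show "v \<in> A" using that assms(2) by auto
    qed (fact \<open>u \<in> A\<close>)
    ultimately show ?thesis by blast
  qed
  show 1: "(THE u. u < K \<and> h u = Suc i) < K \<and> h (THE u. u < K \<and> h u = Suc i) = Suc i" if "i < n" for i
    using theI'[OF ex[OF that]] .
  show 2: "i < n \<and> u = (THE u. u < K \<and> h u = Suc i)" if "u < K" "h u = Suc i" for u i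
  proof -
    have "u \<in> A" using that assms(2) by auto
    then have "Suc i \<in> {1..n}" using im that by (metis imageI)
    then have "i < n" by simp
    then show ?thesis using the1_equality[OF ex[OF \<open>i < n\<close>]] that by simp
  qed
  show "distinct (map (\<lambda>i. THE u. u < K \<and> h u = Suc i) [0..<n])"
    unfolding distinct_map
  proof
    show "inj_on (\<lambda>i. THE u. u < K \<and> h u = Suc i) (set [0..<n])"
    proof (rule inj_onI)
      fix i j assume "i \<in> set [0..<n]" "j \<in> set [0..<n]" "(THE u. u < K \<and> h u = Suc i) = (THE u. u < K \<and> h u = Suc j)"
      then have "i < n" "j < n" "h (THE u. u < K \<and> h u = Suc i) = h (THE u. u < K \<and> h u = Suc j)" by auto
      then show "i = j" using 1[of i] 1[of j] by (metis Suc_inject)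
    qed
  qed simp
  show "set (map (\<lambda>i. THE u. u < K \<and> h u = Suc i) [0..<n]) = A"
  proof
    show "set (map (\<lambda>i. THE u. u < K \<and> h u = Suc i) [0..<n]) \<subseteq> A"
    proof
      fix u assume "u \<in> set (map (\<lambda>i. THE u. u < K \<and> h u = Suc i) [0..<n])"
      then obtain i where "i < n" "u = (THE u. u < K \<and> h u = Suc i)" by auto
      then show "u \<in> A" using 1[of i] assms(2) by simp
    qed
    show "A \<subseteq> set (map (\<lambda>i. THE u. u < K \<and> h u = Suc i) [0..<n])"
    proof
      fix u assume u: "u \<in> A"
      then obtain i where "h u = Suc i" "u < K" using assms(2) not0_implies_Suc by auto
      then show "u \<in> set (map (\<lambda>i. THE u. u < K \<and> h u = Suc i) [0..<n])" using 2[of u i] by auto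
    qed
  qed
qed

lemma count_sum_mset_set:
  assumes "finite C" "\<And>c. c \<in> C \<Longrightarrow> distinct (h (g c))"
  shows "count (\<Sum>e\<in>#image_mset g (mset_set C). mset (h e)) w = card {c \<in> C. w \<in> set (h (g c))}"
  using assms
proof (induction C rule: finite_induct)
  case (insert c C)
  have "{d \<in> insert c C. w \<in> set (h (g d))} = (if w \<in> set (h (g c)) then insert c {d \<in> C. w \<in> set (h (g d))} else {d \<in> C. w \<in> set (h (g d))})"
    by auto
  moreover have "count (mset (h (g c))) w = (if w \<in> set (h (g c)) then 1 else 0)"
    using insert.prems[of c] by (simp add: distinct_count_atmost_1)
  ultimately show ?case using insert by auto
qed simp

section \<open>Monogamy and linearisation of the hyperedges of a graph\<close>

context
  fixes Sg :: "'o signature" and K M N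
  assumes hg: "har_graph Sg K M N"
begin

lemma hg_carrier: "M \<in> carrier_mat K K" "length N = K"
  using hg unfolding har_graph_def by auto

lemma preds_eq: "v < K \<Longrightarrow> preds M v = {u. u < K \<and> M $$ (v, u) \<noteq> 0}"
  and succs_eq: "v < K \<Longrightarrow> succs M v = {w. w < K \<and> M $$ (w, v) \<noteq> 0}"
  using mem_edges[OF hg_carrier(1)] by (auto simp: preds_def succs_def)

lemma preds_subset: "preds M v \<subseteq> {..<K}" and succs_subset: "succs M v \<subseteq> {..<K}"
  using mem_edges[OF hg_carrier(1)] by (auto simp: preds_def succs_def)

lemma finite_preds: "finite (preds M v)" "finite (succs M v)"
  using finite_subset[OF preds_subset] finite_subset[OF succs_subset] by simp_all

lemma bipartite: "(j, i) \<in> edges M \<Longrightarrow> j \<in> bullets N \<and> i \<in> circs N \<or> j \<in> circs N \<and> i \<in> bullets N"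
  using hg mem_edges[OF hg_carrier(1)] unfolding har_graph_def bullets_def circs_def by blast

lemma circ_bij:
  assumes "c \<in> circs N"
  shows "bij_betw (\<lambda>u. M $$ (c, u)) (preds M c) {1..arity Sg (op_of (N ! c))}"
    "bij_betw (\<lambda>w. M $$ (w, c)) (succs M c) {1..coarity Sg (op_of (N ! c))}"
    "c < K" "op_of (N ! c) \<in> ops Sg"
proof -
  show c: "c < K" using assms hg_carrier by (auto simp: circs_def)
  have "Circ (op_of (N ! c)) \<in> set N" using c hg_carrier circ_label[OF assms] by (metis nth_mem)
  then show "op_of (N ! c) \<in> ops Sg" using hg unfolding har_graph_def by blast
  show "bij_betw (\<lambda>u. M $$ (c, u)) (preds M c) {1..arity Sg (op_of (N ! c))}"
    "bij_betw (\<lambda>w. M $$ (w, c)) (succs M c) {1..coarity Sg (op_of (N ! c))}"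
    using hg c circ_label[OF assms] unfolding har_graph_def by blast+
qed

lemma circ_edge_props:
  assumes c: "c \<in> circs N"
  shows "set (hsrc (circ_edge Sg M N c)) = preds M c" "distinct (hsrc (circ_edge Sg M N c))"
    "set (htgt (circ_edge Sg M N c)) = succs M c" "distinct (htgt (circ_edge Sg M N c))"
    "u < K \<Longrightarrow> M $$ (c, u) = Suc i \<longleftrightarrow> i < arity Sg (op_of (N ! c)) \<and> u = hsrc (circ_edge Sg M N c) ! i"
    "u < K \<Longrightarrow> M $$ (u, c) = Suc i \<longleftrightarrow> i < coarity Sg (op_of (N ! c)) \<and> u = htgt (circ_edge Sg M N c) ! i"
    "length (hsrc (circ_edge Sg M N c)) = arity Sg (op_of (N ! c))"
    "length (htgt (circ_edge Sg M N c)) = coarity Sg (op_of (N ! c))"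
proof -
  note b = circ_bij[OF c]
  have d: "dim_row M = K" "dim_col M = K" using hg_carrier by auto
  note s = bij_betw_labels[OF b(1) preds_eq[OF b(3)]]
  note t = bij_betw_labels[OF b(2) succs_eq[OF b(3)]]
  show "set (hsrc (circ_edge Sg M N c)) = preds M c" "distinct (hsrc (circ_edge Sg M N c))"
    "set (htgt (circ_edge Sg M N c)) = succs M c" "distinct (htgt (circ_edge Sg M N c))"
    using s(3,4) t(3,4) by (simp_all add: circ_edge_def circ_srcs_def circ_tgts_def d)
  show "M $$ (c, u) = Suc i \<longleftrightarrow> i < arity Sg (op_of (N ! c)) \<and> u = hsrc (circ_edge Sg M N c) ! i" if "u < K"
  proof
    assume "M $$ (c, u) = Suc i"
    from s(2)[OF that this] show "i < arity Sg (op_of (N ! c)) \<and> u = hsrc (circ_edge Sg M N c) ! i"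
      by (simp add: circ_edge_def circ_srcs_def d)
  next
    assume "i < arity Sg (op_of (N ! c)) \<and> u = hsrc (circ_edge Sg M N c) ! i"
    then show "M $$ (c, u) = Suc i" using s(1)[of i] by (simp add: circ_edge_def circ_srcs_def d)
  qed
  show "M $$ (u, c) = Suc i \<longleftrightarrow> i < coarity Sg (op_of (N ! c)) \<and> u = htgt (circ_edge Sg M N c) ! i" if "u < K"
  proof
    assume "M $$ (u, c) = Suc i"
    from t(2)[OF that this] show "i < coarity Sg (op_of (N ! c)) \<and> u = htgt (circ_edge Sg M N c) ! i"
      by (simp add: circ_edge_def circ_tgts_def d)
  next
    assume "i < coarity Sg (op_of (N ! c)) \<and> u = htgt (circ_edge Sg M N c) ! i"
    then show "M $$ (u, c) = Suc i" using t(1)[of i] by (simp add: circ_edge_def circ_tgts_def d)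
  qed
  show "length (hsrc (circ_edge Sg M N c)) = arity Sg (op_of (N ! c))"
    "length (htgt (circ_edge Sg M N c)) = coarity Sg (op_of (N ! c))"
    by (simp_all add: circ_edge_def circ_srcs_def circ_tgts_def)
qed

lemma hedges_well_sorted: "well_sorted Sg (hedges Sg M N)"
  using circ_edge_props(7,8) circ_bij(4) by (auto simp: well_sorted_def hedges_def circ_edge_def)

text \<open>By bipartiteness the neighbours of a \<open>Bullet\<close> vertex are all operation
  vertices, and operation vertices never occur as wires. So being produced or consumed is counted by
  the degrees.\<close>

lemma count_srcs_tgts:
  "count (tgts (hedges Sg M N)) w = (if w \<in> bullets N then card (preds M w) else 0)"
  "count (srcs (hedges Sg M N)) w = (if w \<in> bullets N then card (succs M w) else 0)"
proof -
  have disj: "bullets N \<inter> circs N = {}" by (auto simp: bullets_def circs_def)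
  have "count (tgts (hedges Sg M N)) w = card {c \<in> circs N. w \<in> set (htgt (circ_edge Sg M N c))}"
    unfolding tgts_def hedges_def 
    by (rule count_sum_mset_set[where h = htgt]) (auto intro: circ_edge_props(4))
  also have "{c \<in> circs N. w \<in> set (htgt (circ_edge Sg M N c))} = {c \<in> circs N. (c, w) \<in> edges M}"
    using circ_edge_props(3) by (auto simp: succs_def)
  also have "\<dots> = (if w \<in> bullets N then preds M w else {})"
    using bipartite[of _ w] disj by (auto simp: preds_def)
  finally show "count (tgts (hedges Sg M N)) w = (if w \<in> bullets N then card (preds M w) else 0)" by simp
  have "count (srcs (hedges Sg M N)) w = card {c \<in> circs N. w \<in> set (hsrc (circ_edge Sg M N c))}"
    unfolding srcs_def hedges_def 
    by (rule count_sum_mset_set[where h = hsrc]) (auto intro: circ_edge_props(2))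
  also have "{c \<in> circs N. w \<in> set (hsrc (circ_edge Sg M N c))} = {c \<in> circs N. (w, c) \<in> edges M}"
    using circ_edge_props(1) by (auto simp: preds_def)
  also have "\<dots> = (if w \<in> bullets N then succs M w else {})"
    using bipartite[of w] disj by (auto simp: succs_def)
  finally show "count (srcs (hedges Sg M N)) w = (if w \<in> bullets N then card (succs M w) else 0)" by simp
qed

text \<open>Monogamy in local form: a wire is either an interface node on the given side or has
  exactly one edge there.\<close>

lemma bullet_degree:
  assumes "w \<in> bullets N"
  shows "card (preds M w) + (if w \<in> left_nodes M N then 1 else 0) = 1"
    "card (succs M w) + (if w \<in> right_nodes M N then 1 else 0) = 1"
proof -
  have w: "w < K" "N ! w = Bullet" "w < length N" using assms hg_carrier by (auto simp: bullets_def)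
  then have c: "card (preds M w) \<le> 1" "card (succs M w) \<le> 1" using hg unfolding har_graph_def by auto
  have "preds M w = {} \<longleftrightarrow> card (preds M w) = 0" "succs M w = {} \<longleftrightarrow> card (succs M w) = 0" using finite_preds by auto
  then show "card (preds M w) + (if w \<in> left_nodes M N then 1 else 0) = 1"
    "card (succs M w) + (if w \<in> right_nodes M N then 1 else 0) = 1"
    using c w by (auto simp: left_nodes_def right_nodes_def)
qed

lemma hedges_monogamous:
  assumes "distinct xs" "set xs = left_nodes M N" "distinct ys" "set ys = right_nodes M N"
  shows "monogamous xs (hedges Sg M N) ys" "wires xs (hedges Sg M N) = bullets N"
proof -
  have sub: "left_nodes M N \<subseteq> bullets N" "right_nodes M N \<subseteq> bullets N"
    by (auto simp: left_nodes_def right_nodes_def bullets_def)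
  have "count (mset xs) w = (if w \<in> left_nodes M N then 1 else 0)" "count (mset ys) w = (if w \<in> right_nodes M N then 1 else 0)" for w
    using assms by (auto simp: distinct_count_atmost_1)
  then have 1: "count (mset xs + tgts (hedges Sg M N)) w = (if w \<in> bullets N then 1 else 0)"
    "count (mset ys + srcs (hedges Sg M N)) w = (if w \<in> bullets N then 1 else 0)" for w
    using bullet_degree[of w] count_srcs_tgts[of w] sub by (auto split: if_splits)
  have "mset xs + tgts (hedges Sg M N) = mset ys + srcs (hedges Sg M N)"
    by (rule multiset_eqI) (simp only: 1)
  then show "monogamous xs (hedges Sg M N) ys" unfolding monogamous_def using 1(1) by simp
  have "w \<in> wires xs (hedges Sg M N) \<longleftrightarrow> w \<in> bullets N" for w
    using 1(1)[of w] notin_wires[of w xs "hedges Sg M N"] by (auto split: if_splits)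
  then show "wires xs (hedges Sg M N) = bullets N" by blast
qed

text \<open>The claim is generalised to a set \<open>D\<close> of operation vertices still to be
  listed, all others counting as performed, and proved by induction on its size.\<close>

lemma hedges_linearisable:
  assumes "set xs = left_nodes M N"
  shows "\<exists>es. mset es = hedges Sg M N \<and> linear_from (set xs) es"
proof -
  have ac: "acyclic (edges M)" using hg unfolding har_graph_def by blast
  have "edges M \<subseteq> {..<K} \<times> {..<K}" using mem_edges[OF hg_carrier(1)] by auto
  then have "finite (edges M)" by (rule finite_subset) simp
  then have wf: "wf ((edges M)\<^sup>+)" using ac finite_acyclic_wf wf_trancl by blast
  let ?e = "circ_edge Sg M N"
  have "\<exists>es. mset es = image_mset ?e (mset_set D) \<and>
      linear_from (set xs \<union> (\<Union>c\<in>circs N - D. set (htgt (?e c)))) es" if "D \<subseteq> circs N" for D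
    using that
  proof (induction "card D" arbitrary: D)
    case 0
    then have "D = {}" using finite_subset[OF 0(2) finite_circs(1)] by simp
    then show ?case by (intro exI[of _ "[]"]) simp
  next
    case (Suc k)
    have fin: "finite D" using Suc.prems finite_circs(1) finite_subset by blast
    have "D \<noteq> {}" using Suc.hyps(2) by auto
    \<comment> \<open>Two operation vertices are never adjacent but have a wire between them, so the
      minimal element is taken with respect to the transitive closure.\<close>
    then obtain c where c: "c \<in> D" "\<And>d. (d, c) \<in> (edges M)\<^sup>+ \<Longrightarrow> d \<notin> D"
      using wf unfolding wf_eq_minimal by (metis ex_in_conv)
    have cc: "c \<in> circs N" using c Suc.prems by blast
    have "k = card (D - {c})" "D - {c} \<subseteq> circs N" using Suc.hyps(2) c(1) fin Suc.prems by auto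
    from Suc.hyps(1)[OF this] obtain es where es: "mset es = image_mset ?e (mset_set (D - {c}))"
      "linear_from (set xs \<union> (\<Union>d\<in>circs N - (D - {c}). set (htgt (?e d)))) es" by blast
    let ?X = "set xs \<union> (\<Union>d\<in>circs N - D. set (htgt (?e d)))"
    have "set (hsrc (?e c)) \<subseteq> ?X"
    proof
      fix u assume "u \<in> set (hsrc (?e c))"
      then have uc: "(u, c) \<in> edges M" using circ_edge_props(1)[OF cc] by (simp add: preds_def)
      have ub: "u \<in> bullets N" using bipartite[OF uc] cc by (auto simp: bullets_def circs_def)
      show "u \<in> ?X"
      proof (cases "preds M u = {}")
        case True
        then show ?thesis using ub assms by (auto simp: left_nodes_def bullets_def)
      next
        case False
        then obtain d where d: "(d, u) \<in> edges M" by (auto simp: preds_def)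
        then have "(d, c) \<in> (edges M)\<^sup>+" using uc by (meson r_into_trancl trancl_trans)
        then have "d \<notin> D" by (rule c(2))
        moreover have dc: "d \<in> circs N" using bipartite[OF d] ub by (auto simp: bullets_def circs_def)
        moreover have "u \<in> set (htgt (?e d))" using circ_edge_props(3)[OF dc] d by (simp add: succs_def)
        ultimately show ?thesis by blast
      qed
    qed
    moreover have "circs N - (D - {c}) = insert c (circs N - D)" using c(1) cc by blast
    then have "linear_from (?X \<union> set (htgt (?e c))) es"
      using es(2) by (auto simp: Un_ac elim: linear_from_mono)
    ultimately have "linear_from ?X (?e c # es)" by simp
    moreover have "mset (?e c # es) = image_mset ?e (mset_set D)"
      using es(1) c(1) fin by (simp add: mset_set.remove)
    ultimately show ?case by blast
  qed
  from this[of "circs N"] show ?thesis by (auto simp: hedges_def)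
qed

end

section \<open>Gluing\<close>

text \<open>What a part of a graph must satisfy for its hyperedges to be those of the whole,
  renamed: operation vertices keep their complete neighbourhoods, while \<open>Bullet\<close>
  vertices may gain edges.\<close>

locale embedding =
  fixes Sg :: "'o signature" and K0 M0 N0 K M N and \<epsilon> :: "nat \<Rightarrow> nat"
  assumes g0: "har_graph Sg K0 M0 N0" and inj: "inj_on \<epsilon> {..<K0}"
    and carrier: "M \<in> carrier_mat K K" and len: "length N = K"
    and in_range: "i < K0 \<Longrightarrow> \<epsilon> i < K" and label: "i < K0 \<Longrightarrow> N ! \<epsilon> i = N0 ! i"
    and entry: "i < K0 \<Longrightarrow> i' < K0 \<Longrightarrow> M $$ (\<epsilon> i, \<epsilon> i') = M0 $$ (i, i')"
    and preds_image: "c \<in> circs N0 \<Longrightarrow> preds M (\<epsilon> c) = \<epsilon> ` preds M0 c"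
    and succs_image: "c \<in> circs N0 \<Longrightarrow> succs M (\<epsilon> c) = \<epsilon> ` succs M0 c"
begin

lemma labels:
  assumes "c \<in> circs N0"
  shows "bij_betw (\<lambda>u. M $$ (\<epsilon> c, u)) (preds M (\<epsilon> c)) {1..arity Sg (op_of (N0 ! c))}"
    "bij_betw (\<lambda>w. M $$ (w, \<epsilon> c)) (succs M (\<epsilon> c)) {1..coarity Sg (op_of (N0 ! c))}"
proof -
  have c: "c < K0" by (rule circ_bij(3)[OF g0 assms])
  have p: "bij_betw \<epsilon> (preds M0 c) (preds M (\<epsilon> c))" "bij_betw \<epsilon> (succs M0 c) (succs M (\<epsilon> c))"
    using inj_on_subset[OF inj preds_subset[OF g0, of c]] inj_on_subset[OF inj succs_subset[OF g0, of c]]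
      preds_image[OF assms] succs_image[OF assms] by (simp_all add: bij_betw_def)
  have "bij_betw ((\<lambda>u. M $$ (\<epsilon> c, u)) \<circ> \<epsilon>) (preds M0 c) {1..arity Sg (op_of (N0 ! c))}"
    using circ_bij(1)[OF g0 assms]
    by (rule bij_betw_cong[THEN iffD1, rotated]) (auto simp: entry[OF c] dest!: preds_subset[OF g0, THEN subsetD])
  then show "bij_betw (\<lambda>u. M $$ (\<epsilon> c, u)) (preds M (\<epsilon> c)) {1..arity Sg (op_of (N0 ! c))}"
    using bij_betw_comp_iff[OF p(1)] by blast
  have "bij_betw ((\<lambda>u. M $$ (u, \<epsilon> c)) \<circ> \<epsilon>) (succs M0 c) {1..coarity Sg (op_of (N0 ! c))}"
    using circ_bij(2)[OF g0 assms]
    by (rule bij_betw_cong[THEN iffD1, rotated]) (auto simp: entry[OF _ c] dest!: succs_subset[OF g0, THEN subsetD])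
  then show "bij_betw (\<lambda>w. M $$ (w, \<epsilon> c)) (succs M (\<epsilon> c)) {1..coarity Sg (op_of (N0 ! c))}"
    using bij_betw_comp_iff[OF p(2)] by blast
qed

lemma circ_edge:
  assumes hg: "har_graph Sg K M N" and c0: "c \<in> circs N0"
  shows "circ_edge Sg M N (\<epsilon> c) = hmap \<epsilon> (circ_edge Sg M0 N0 c)"
proof -
  have c: "c < K0" "\<epsilon> c \<in> circs N"
    using circ_bij(3)[OF g0 c0] c0 label in_range len by (auto simp: circs_def)
  have op: "op_of (N ! \<epsilon> c) = op_of (N0 ! c)" using label[OF c(1)] by simp
  note p = circ_edge_props[OF hg c(2)] and q = circ_edge_props[OF g0 c0]
  have "hsrc (circ_edge Sg M N (\<epsilon> c)) = map \<epsilon> (hsrc (circ_edge Sg M0 N0 c))"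
  proof (rule nth_equalityI)
    fix i assume "i < length (hsrc (circ_edge Sg M N (\<epsilon> c)))"
    then have i: "i < arity Sg (op_of (N0 ! c))" using p(7) op by simp
    let ?u = "hsrc (circ_edge Sg M0 N0 c) ! i"
    have "?u \<in> preds M0 c" using i q(1,7) by (metis nth_mem)
    then have u: "?u < K0" using preds_subset[OF g0] by blast
    \<comment> \<open>The label \<open>Suc i\<close> singles out the source in position
      \<open>i\<close>, in the part as in the whole, so equality of entries gives equality of
      lists.\<close>
    then have "M $$ (\<epsilon> c, \<epsilon> ?u) = Suc i" using q(5)[of ?u i] i c entry by simp
    then show "hsrc (circ_edge Sg M N (\<epsilon> c)) ! i = map \<epsilon> (hsrc (circ_edge Sg M0 N0 c)) ! i"
      using p(5)[of "\<epsilon> ?u" i] in_range[OF u] i q(7) by simp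
  qed (simp add: p(7) q(7) op)
  moreover have "htgt (circ_edge Sg M N (\<epsilon> c)) = map \<epsilon> (htgt (circ_edge Sg M0 N0 c))"
  proof (rule nth_equalityI)
    fix i assume "i < length (htgt (circ_edge Sg M N (\<epsilon> c)))"
    then have i: "i < coarity Sg (op_of (N0 ! c))" using p(8) op by simp
    let ?u = "htgt (circ_edge Sg M0 N0 c) ! i"
    have "?u \<in> succs M0 c" using i q(3,8) by (metis nth_mem)
    then have u: "?u < K0" using succs_subset[OF g0] by blast
    then have "M $$ (\<epsilon> ?u, \<epsilon> c) = Suc i" using q(6)[of ?u i] i c entry by simp
    then show "htgt (circ_edge Sg M N (\<epsilon> c)) ! i = map \<epsilon> (htgt (circ_edge Sg M0 N0 c)) ! i"
      using p(6)[of "\<epsilon> ?u" i] in_range[OF u] i q(8) by simp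
  qed (simp add: p(8) q(8) op)
  ultimately show ?thesis using op by (simp add: hmap_def prod_eq_iff) (simp add: circ_edge_def)
qed

end

text \<open>Covers composition (right interface nodes of the first graph are glued to left interface nodes of
  the second), tensor product (nothing is glued) and relabelling (the second graph is empty).\<close>

locale gluing =
  fixes Sg :: "'o signature" and K1 M1 N1 K2 M2 N2 K M N and \<alpha> \<beta> :: "nat \<Rightarrow> nat"
  assumes g1: "har_graph Sg K1 M1 N1" and g2: "har_graph Sg K2 M2 N2"
    and inj_a: "inj_on \<alpha> {..<K1}" and inj_b: "inj_on \<beta> {..<K2}"
    and cover: "\<alpha> ` {..<K1} \<union> \<beta> ` {..<K2} = {..<K}"
    and carrier: "M \<in> carrier_mat K K" and len: "length N = K"
    and lab_a: "i < K1 \<Longrightarrow> N ! \<alpha> i = N1 ! i" and lab_b: "j < K2 \<Longrightarrow> N ! \<beta> j = N2 ! j"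
    and M_a: "i < K1 \<Longrightarrow> i' < K1 \<Longrightarrow> M $$ (\<alpha> i, \<alpha> i') = M1 $$ (i, i')"
    and M_b: "j < K2 \<Longrightarrow> j' < K2 \<Longrightarrow> M $$ (\<beta> j, \<beta> j') = M2 $$ (j, j')"
    and M_ab: "\<lbrakk>i < K1; j < K2; \<alpha> i \<notin> \<beta> ` {..<K2}; \<beta> j \<notin> \<alpha> ` {..<K1}\<rbrakk>
      \<Longrightarrow> M $$ (\<alpha> i, \<beta> j) = 0 \<and> M $$ (\<beta> j, \<alpha> i) = 0"
    and shared: "\<lbrakk>i < K1; j < K2; \<alpha> i = \<beta> j\<rbrakk> \<Longrightarrow> i \<in> right_nodes M1 N1 \<and> j \<in> left_nodes M2 N2"
begin

section \<open>Neighbourhoods and interfaces of a glued graph\<close>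

lemma a_lt: "i < K1 \<Longrightarrow> \<alpha> i < K" and b_lt: "j < K2 \<Longrightarrow> \<beta> j < K"
  using cover by blast+

lemma vertex_cases:
  assumes "v < K"
  obtains i where "i < K1" "v = \<alpha> i" | j where "j < K2" "v = \<beta> j" "\<beta> j \<notin> \<alpha> ` {..<K1}"
  using assms cover by blast

lemma mem_edges1: "(j, i) \<in> edges M1 \<longleftrightarrow> i < K1 \<and> j < K1 \<and> M1 $$ (i, j) \<noteq> 0"
  and mem_edges2: "(j, i) \<in> edges M2 \<longleftrightarrow> i < K2 \<and> j < K2 \<and> M2 $$ (i, j) \<noteq> 0"
  by (rule mem_edges[OF hg_carrier(1)[OF g1]], rule mem_edges[OF hg_carrier(1)[OF g2]])

lemma edges_glue: "edges M = map_prod \<alpha> \<alpha> ` edges M1 \<union> map_prod \<beta> \<beta> ` edges M2"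
proof (intro equalityI subsetI)
  fix e assume "e \<in> edges M"
  then obtain x y where e: "e = (x, y)" "x < K" "y < K" "M $$ (y, x) \<noteq> 0"
    using mem_edges[OF carrier] by (metis surj_pair)
  let ?goal = "e \<in> map_prod \<alpha> \<alpha> ` edges M1 \<union> map_prod \<beta> \<beta> ` edges M2"
  have a: ?goal if "i < K1" "i' < K1" "x = \<alpha> i" "y = \<alpha> i'" for i i'
  proof -
    have "(i, i') \<in> edges M1" using that e M_a mem_edges1 by simp
    then show ?goal using that e by force
  qed
  have b: ?goal if "i < K2" "i' < K2" "x = \<beta> i" "y = \<beta> i'" for i i'
  proof -
    have "(i, i') \<in> edges M2" using that e M_b mem_edges2 by simp
    then show ?goal using that e by force
  qed
  show "e \<in> map_prod \<alpha> \<alpha> ` edges M1 \<union> map_prod \<beta> \<beta> ` edges M2"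
  proof (cases "(x \<in> \<alpha> ` {..<K1} \<and> y \<in> \<alpha> ` {..<K1}) \<or> (x \<in> \<beta> ` {..<K2} \<and> y \<in> \<beta> ` {..<K2})")
    case True
    then show ?thesis using a b by auto
  next
    \<comment> \<open>If one endpoint were shared, both would lie in a common part. So each endpoint
      lies in one part only, and the two parts differ.\<close>
    case False
    have "x \<in> \<alpha> ` {..<K1} \<union> \<beta> ` {..<K2}" "y \<in> \<alpha> ` {..<K1} \<union> \<beta> ` {..<K2}" using e cover by auto
    then have "M $$ (y, x) = 0" using False M_ab by auto
    then show ?thesis using e by simp
  qed
next
  fix e assume "e \<in> map_prod \<alpha> \<alpha> ` edges M1 \<union> map_prod \<beta> \<beta> ` edges M2"
  then show "e \<in> edges M"
  proof
    assume "e \<in> map_prod \<alpha> \<alpha> ` edges M1"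
    then obtain i i' where "e = (\<alpha> i, \<alpha> i')" "(i, i') \<in> edges M1" by auto
    then show ?thesis using mem_edges1 a_lt M_a mem_edges[OF carrier] by simp
  next
    assume "e \<in> map_prod \<beta> \<beta> ` edges M2"
    then obtain i i' where "e = (\<beta> i, \<beta> i')" "(i, i') \<in> edges M2" by auto
    then show ?thesis using mem_edges2 b_lt M_b mem_edges[OF carrier] by simp
  qed
qed

lemma edge_glue_cases:
  assumes "(x, y) \<in> edges M"
  obtains i i' where "x = \<alpha> i" "y = \<alpha> i'" "(i, i') \<in> edges M1" "i < K1" "i' < K1"
  | j j' where "x = \<beta> j" "y = \<beta> j'" "(j, j') \<in> edges M2" "j < K2" "j' < K2"
  using assms mem_edges1 mem_edges2 unfolding edges_glue by auto

lemma edge_a: "(i, i') \<in> edges M1 \<Longrightarrow> (\<alpha> i, \<alpha> i') \<in> edges M"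
  and edge_b: "(j, j') \<in> edges M2 \<Longrightarrow> (\<beta> j, \<beta> j') \<in> edges M"
  unfolding edges_glue by auto

lemma a_eq: "i < K1 \<Longrightarrow> i' < K1 \<Longrightarrow> \<alpha> i = \<alpha> i' \<longleftrightarrow> i = i'"
  and b_eq: "j < K2 \<Longrightarrow> j' < K2 \<Longrightarrow> \<beta> j = \<beta> j' \<longleftrightarrow> j = j'"
  using inj_a inj_b by (auto dest: inj_onD)

text \<open>Holds for glued vertices too: such a vertex is a left interface node of the second
  graph, so its incoming edges all come from the first.\<close>

lemma preds_a: assumes "i < K1" shows "preds M (\<alpha> i) = \<alpha> ` preds M1 i"
proof (intro equalityI subsetI)
  fix x assume "x \<in> preds M (\<alpha> i)"
  then have "(x, \<alpha> i) \<in> edges M" by (simp add: preds_def)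
  then show "x \<in> \<alpha> ` preds M1 i"
  proof (cases rule: edge_glue_cases)
    case (1 k k')
    then show ?thesis using a_eq[OF assms] by (auto simp: preds_def)
  next
    case (2 j j')
    then have "j' \<in> left_nodes M2 N2" using shared[OF assms] by metis
    then show ?thesis using 2 by (auto simp: left_nodes_def preds_def)
  qed
qed (auto simp: preds_def intro: edge_a)

text \<open>The dual situation: a glued vertex is a right interface node of the first graph and has
  no outgoing edge there.\<close>

lemma succs_b: assumes "j < K2" shows "succs M (\<beta> j) = \<beta> ` succs M2 j"
proof (intro equalityI subsetI)
  fix x assume "x \<in> succs M (\<beta> j)"
  then have "(\<beta> j, x) \<in> edges M" by (simp add: succs_def)
  then show "x \<in> \<beta> ` succs M2 j"
  proof (cases rule: edge_glue_cases)
    case (1 k k')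
    then have "k \<in> right_nodes M1 N1" using shared[OF _ assms] by metis
    then show ?thesis using 1 by (auto simp: right_nodes_def succs_def)
  next
    case (2 k k')
    then show ?thesis using b_eq[OF assms] by (auto simp: succs_def)
  qed
qed (auto simp: succs_def intro: edge_b)

lemma preds_b: assumes "j < K2" "\<beta> j \<notin> \<alpha> ` {..<K1}" shows "preds M (\<beta> j) = \<beta> ` preds M2 j"
proof (intro equalityI subsetI)
  fix x assume "x \<in> preds M (\<beta> j)"
  then have "(x, \<beta> j) \<in> edges M" by (simp add: preds_def)
  then show "x \<in> \<beta> ` preds M2 j"
  proof (cases rule: edge_glue_cases)
    case (1 k k')
    then show ?thesis using assms by auto
  next
    case (2 k k')
    then show ?thesis using b_eq[OF assms(1)] by (auto simp: preds_def)
  qed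
qed (auto simp: preds_def intro: edge_b)

lemma succs_a: assumes "i < K1" "\<alpha> i \<notin> \<beta> ` {..<K2}" shows "succs M (\<alpha> i) = \<alpha> ` succs M1 i"
proof (intro equalityI subsetI)
  fix x assume "x \<in> succs M (\<alpha> i)"
  then have "(\<alpha> i, x) \<in> edges M" by (simp add: succs_def)
  then show "x \<in> \<alpha> ` succs M1 i"
  proof (cases rule: edge_glue_cases)
    case (1 k k')
    then show ?thesis using a_eq[OF assms(1)] by (auto simp: succs_def)
  next
    case (2 k k')
    then show ?thesis using assms by auto
  qed
qed (auto simp: succs_def intro: edge_a)

lemma card_image_a: "A \<subseteq> {..<K1} \<Longrightarrow> card (\<alpha> ` A) = card A"
  and card_image_b: "B \<subseteq> {..<K2} \<Longrightarrow> card (\<beta> ` B) = card B"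
  using inj_a inj_b card_image inj_on_subset by blast+

lemma circs_a: "i \<in> circs N1 \<Longrightarrow> i < K1 \<and> \<alpha> i \<in> circs N \<and> \<alpha> i \<notin> \<beta> ` {..<K2}"
  using hg_carrier(2)[OF g1] len a_lt lab_a shared by (auto simp: circs_def right_nodes_def)

lemma circs_b: "j \<in> circs N2 \<Longrightarrow> j < K2 \<and> \<beta> j \<in> circs N \<and> \<beta> j \<notin> \<alpha> ` {..<K1}"
  using hg_carrier(2)[OF g2] len b_lt lab_b shared by (fastforce simp: circs_def left_nodes_def)

lemma circs_glue: "circs N = \<alpha> ` circs N1 \<union> \<beta> ` circs N2"
proof (intro equalityI subsetI)
  fix v assume v: "v \<in> circs N"
  then have "v < K" using len by (simp add: circs_def)
  then show "v \<in> \<alpha> ` circs N1 \<union> \<beta> ` circs N2"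
  proof (cases rule: vertex_cases)
    case (1 i)
    then have "i \<in> circs N1" using v lab_a hg_carrier(2)[OF g1] by (simp add: circs_def)
    then show ?thesis using 1 by blast
  next
    case (2 j)
    then have "j \<in> circs N2" using v lab_b hg_carrier(2)[OF g2] by (simp add: circs_def)
    then show ?thesis using 2 by blast
  qed
qed (use circs_a circs_b in blast)

sublocale a: embedding Sg K1 M1 N1 K M N \<alpha>
  by unfold_locales (use g1 inj_a carrier len a_lt lab_a M_a preds_a succs_a circs_a in auto)

sublocale b: embedding Sg K2 M2 N2 K M N \<beta>
  by unfold_locales (use g2 inj_b carrier len b_lt lab_b M_b preds_b succs_b circs_b in auto)

text \<open>A path can pass from the first part to the second but never back, since a vertex reached
  by an edge of the second part has no outgoing edge in the first. For finite graphs acyclicity is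
  well-foundedness, and \<open>wf_Un\<close> covers exactly such one-way unions.\<close>

lemma acyclic_glue: "acyclic (edges M)"
proof (rule wf_acyclic)
  have wf: "wf (edges M')" if g: "har_graph Sg K' M' N'" for K' M' and N' :: "'o node list"
  proof -
    have "edges M' \<subseteq> {..<K'} \<times> {..<K'}" using mem_edges[OF hg_carrier(1)[OF g]] by auto
    then have "finite (edges M')" by (rule finite_subset) simp
    then show ?thesis using g finite_acyclic_wf unfolding har_graph_def by blast
  qed
  have "wf (map_prod \<alpha> \<alpha> ` edges M1)"
    by (rule wf_map_prod_image_Dom_Ran[OF wf[OF g1]]) (use a_eq mem_edges1 in auto)
  moreover have "wf (map_prod \<beta> \<beta> ` edges M2)"
    by (rule wf_map_prod_image_Dom_Ran[OF wf[OF g2]]) (use b_eq mem_edges2 in auto)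
  moreover have "Domain (map_prod \<alpha> \<alpha> ` edges M1) \<inter> Range (map_prod \<beta> \<beta> ` edges M2) = {}"
  proof -
    have False if "(i, i') \<in> edges M1" "(j', j) \<in> edges M2" "\<alpha> i = \<beta> j" for i i' j j'
      using that shared[of i j] mem_edges1 mem_edges2 by (auto simp: right_nodes_def succs_def)
    then show ?thesis by (auto; metis)
  qed
  ultimately show "wf (edges M)" unfolding edges_glue by (rule wf_Un)
qed

lemma har_graph_glue: "har_graph Sg K M N"
  unfolding har_graph_def
proof (intro conjI)
  show "\<forall>g. Circ g \<in> set N \<longrightarrow> g \<in> ops Sg"
  proof (intro allI impI)
    fix g assume "Circ g \<in> set N"
    then obtain v where v: "v < K" "N ! v = Circ g" using len by (metis in_set_conv_nth)
    from v(1) show "g \<in> ops Sg"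
    proof (cases rule: vertex_cases)
      case (1 i)
      then have "Circ g \<in> set N1" using v lab_a hg_carrier(2)[OF g1] by (metis nth_mem)
      then show ?thesis using g1 by (simp add: har_graph_def)
    next
      case (2 i)
      then have "Circ g \<in> set N2" using v lab_b hg_carrier(2)[OF g2] by (metis nth_mem)
      then show ?thesis using g2 by (simp add: har_graph_def)
    qed
  qed
  show "\<forall>(j, i)\<in>edges M. (N ! j = Bullet) \<noteq> (N ! i = Bullet)"
  proof (clarify)
    fix x y assume "(x, y) \<in> edges M" and e: "(N ! x = Bullet) = (N ! y = Bullet)"
    then show False
    proof (cases rule: edge_glue_cases)
      case (1 i i')
      then show False using bipartite[OF g1, of i i'] e lab_a by (auto simp: bullets_def circs_def)
    next
      case (2 i i')
      then show False using bipartite[OF g2, of i i'] e lab_b by (auto simp: bullets_def circs_def)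
    qed
  qed
  show "\<forall>v<K. N ! v = Bullet \<longrightarrow> card (preds M v) \<le> 1 \<and> card (succs M v) \<le> 1"
  proof (intro allI impI)
    have 1: "card (preds M1 i) \<le> 1 \<and> card (succs M1 i) \<le> 1" if "i < K1" "N ! \<alpha> i = Bullet" for i
      using that lab_a g1 by (simp add: har_graph_def)
    have 2: "card (preds M2 i) \<le> 1 \<and> card (succs M2 i) \<le> 1" if "i < K2" "N ! \<beta> i = Bullet" for i
      using that lab_b g2 by (simp add: har_graph_def)
    fix v assume "v < K" and b: "N ! v = Bullet"
    have s2: "card (succs M (\<beta> j)) \<le> 1" if "j < K2" "N ! \<beta> j = Bullet" for j
      using 2[OF that] succs_b[OF that(1)] card_image_b[OF succs_subset[OF g2]] by simp
    from \<open>v < K\<close> show "card (preds M v) \<le> 1 \<and> card (succs M v) \<le> 1"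
    proof (cases rule: vertex_cases)
      case v: (1 i)
      have "card (preds M v) \<le> 1" using 1[of i] v b preds_a card_image_a[OF preds_subset[OF g1]] by simp
      moreover have "card (succs M v) \<le> 1"
      proof (cases "v \<in> \<beta> ` {..<K2}")
        case True
        then show ?thesis using s2 b by auto
      next
        case False
        then show ?thesis using 1[of i] v b succs_a card_image_a[OF succs_subset[OF g1]] by simp
      qed
      ultimately show ?thesis by simp
    next
      case v: (2 j)
      have "card (preds M v) \<le> 1" using 2[of j] v b preds_b card_image_b[OF preds_subset[OF g2]] by simp
      then show ?thesis using v b s2 by simp
    qed
  qed
  show "\<forall>v<K. \<forall>g. N ! v = Circ g \<longrightarrow> bij_betw (\<lambda>u. M $$ (v, u)) (preds M v) {1..arity Sg g} \<and>
      bij_betw (\<lambda>w. M $$ (w, v)) (succs M v) {1..coarity Sg g}"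
  proof (intro allI impI)
    fix v g assume "v < K" and b: "N ! v = Circ g"
    then have "v \<in> circs N" using len by (simp add: circs_def)
    then consider i where "i \<in> circs N1" "v = \<alpha> i" | j where "j \<in> circs N2" "v = \<beta> j"
      unfolding circs_glue by blast
    then show "bij_betw (\<lambda>u. M $$ (v, u)) (preds M v) {1..arity Sg g} \<and>
      bij_betw (\<lambda>w. M $$ (w, v)) (succs M v) {1..coarity Sg g}"
    proof cases
      case (1 i)
      then have "N1 ! i = Circ g" using lab_a circs_a b by metis
      then show ?thesis using a.labels[OF 1(1)] 1 by simp
    next
      case (2 i)
      then have "N2 ! i = Circ g" using lab_b circs_b b by metis
      then show ?thesis using b.labels[OF 2(1)] 2 by simp
    qed
  qed
qed (fact carrier len acyclic_glue)+

lemma left_nodes_glue: "left_nodes M N = \<alpha> ` left_nodes M1 N1 \<union> \<beta> ` {j \<in> left_nodes M2 N2. \<beta> j \<notin> \<alpha> ` {..<K1}}"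
proof -
  have a: "\<alpha> i \<in> left_nodes M N \<longleftrightarrow> i \<in> left_nodes M1 N1" if "i < K1" for i
    using that preds_a[OF that] lab_a[OF that] a_lt[OF that] len hg_carrier(2)[OF g1] by (simp add: left_nodes_def)
  have b: "\<beta> j \<in> left_nodes M N \<longleftrightarrow> j \<in> left_nodes M2 N2" if "j < K2" "\<beta> j \<notin> \<alpha> ` {..<K1}" for j
    using that preds_b[OF that] lab_b[OF that(1)] b_lt[OF that(1)] len hg_carrier(2)[OF g2] by (simp add: left_nodes_def)
  have sub: "left_nodes M1 N1 \<subseteq> {..<K1}" "left_nodes M2 N2 \<subseteq> {..<K2}" "left_nodes M N \<subseteq> {..<K}"
    using hg_carrier(2)[OF g1] hg_carrier(2)[OF g2] len by (auto simp: left_nodes_def)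
  show ?thesis
  proof (intro equalityI subsetI)
    fix v assume v: "v \<in> left_nodes M N"
    then have "v < K" using sub by auto
    then show "v \<in> \<alpha> ` left_nodes M1 N1 \<union> \<beta> ` {j \<in> left_nodes M2 N2. \<beta> j \<notin> \<alpha> ` {..<K1}}"
      by (cases rule: vertex_cases) (use v a b in auto)
  next
    fix v assume "v \<in> \<alpha> ` left_nodes M1 N1 \<union> \<beta> ` {j \<in> left_nodes M2 N2. \<beta> j \<notin> \<alpha> ` {..<K1}}"
    then show "v \<in> left_nodes M N" using a b sub by auto
  qed
qed

lemma right_nodes_glue: "right_nodes M N = \<alpha> ` {i \<in> right_nodes M1 N1. \<alpha> i \<notin> \<beta> ` {..<K2}} \<union> \<beta> ` right_nodes M2 N2"
proof -
  have b: "\<beta> i \<in> right_nodes M N \<longleftrightarrow> i \<in> right_nodes M2 N2" if "i < K2" for i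
    using that succs_b[OF that] lab_b[OF that] b_lt[OF that] len hg_carrier(2)[OF g2] by (simp add: right_nodes_def)
  have a: "\<alpha> j \<in> right_nodes M N \<longleftrightarrow> j \<in> right_nodes M1 N1" if "j < K1" "\<alpha> j \<notin> \<beta> ` {..<K2}" for j
    using that succs_a[OF that] lab_a[OF that(1)] a_lt[OF that(1)] len hg_carrier(2)[OF g1] by (simp add: right_nodes_def)
  have sub: "right_nodes M1 N1 \<subseteq> {..<K1}" "right_nodes M2 N2 \<subseteq> {..<K2}" "right_nodes M N \<subseteq> {..<K}"
    using hg_carrier(2)[OF g1] hg_carrier(2)[OF g2] len by (auto simp: right_nodes_def)
  show ?thesis
  proof (intro equalityI subsetI)
    fix v assume v: "v \<in> right_nodes M N"
    then have "v < K" using sub by auto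
    then have "v \<in> \<beta> ` {..<K2} \<or> v \<in> \<alpha> ` {..<K1} \<and> v \<notin> \<beta> ` {..<K2}" using cover by blast
    then show "v \<in> \<alpha> ` {i \<in> right_nodes M1 N1. \<alpha> i \<notin> \<beta> ` {..<K2}} \<union> \<beta> ` right_nodes M2 N2"
      using v a b by auto
  next
    fix v assume "v \<in> \<alpha> ` {i \<in> right_nodes M1 N1. \<alpha> i \<notin> \<beta> ` {..<K2}} \<union> \<beta> ` right_nodes M2 N2"
    then show "v \<in> right_nodes M N" using a b sub by auto
  qed
qed

text \<open>Glued vertices are \<open>Bullet\<close> vertices, so the operation vertices form a
  disjoint union and each keeps its hyperedge up to renaming.\<close>

lemma hedges_glue: "hedges Sg M N = image_mset (hmap \<alpha>) (hedges Sg M1 N1) + image_mset (hmap \<beta>) (hedges Sg M2 N2)"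
proof -
  have ia: "inj_on \<alpha> (circs N1)" using inj_a circs_a by (meson inj_on_subset lessThan_iff subsetI)
  have ib: "inj_on \<beta> (circs N2)" using inj_b circs_b by (meson inj_on_subset lessThan_iff subsetI)
  have "\<alpha> ` circs N1 \<inter> \<beta> ` circs N2 = {}" using circs_a circs_b by blast
  then have "mset_set (circs N) = image_mset \<alpha> (mset_set (circs N1)) + image_mset \<beta> (mset_set (circs N2))"
    unfolding circs_glue image_mset_mset_set[OF ia] image_mset_mset_set[OF ib] by (simp add: mset_set_Union)
  then have "hedges Sg M N = image_mset (\<lambda>c. circ_edge Sg M N (\<alpha> c)) (mset_set (circs N1)) +
      image_mset (\<lambda>c. circ_edge Sg M N (\<beta> c)) (mset_set (circs N2))"
    by (simp add: hedges_def multiset.map_comp comp_def)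
  also have "image_mset (\<lambda>c. circ_edge Sg M N (\<alpha> c)) (mset_set (circs N1)) = image_mset (hmap \<alpha>) (hedges Sg M1 N1)"
    unfolding hedges_def multiset.map_comp by (intro image_mset_cong) (simp add: a.circ_edge[OF har_graph_glue])
  also have "image_mset (\<lambda>c. circ_edge Sg M N (\<beta> c)) (mset_set (circs N2)) = image_mset (hmap \<beta>) (hedges Sg M2 N2)"
    unfolding hedges_def multiset.map_comp by (intro image_mset_cong) (simp add: b.circ_edge[OF har_graph_glue])
  finally show ?thesis .
qed

end

section \<open>The diagram of a HAR\<close>

text \<open>The position of each vertex in the left order, well defined by
  \<open>perm_mat_inject\<close>. The interface lists below name the vertices at given positions and
  therefore use its inverse.\<close>

definition lpos :: "'o har \<Rightarrow> nat \<Rightarrow> nat" where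
  "lpos f = (THE l. l permutes {..<hK f} \<and> hL f = perm_mat (hK f) l)"

definition rpos :: "'o har \<Rightarrow> nat \<Rightarrow> nat" where
  "rpos f = (THE r. r permutes {..<hK f} \<and> hR f = perm_mat (hK f) r)"

definition inputs :: "nat \<Rightarrow> 'o har \<Rightarrow> nat list" where
  "inputs n f = map (pinv (lpos f)) [0..<n]"

definition outputs :: "nat \<Rightarrow> 'o har \<Rightarrow> nat list" where
  "outputs m f = map (\<lambda>i. pinv (rpos f) (hK f - m + i)) [0..<m]"

abbreviation har_edges :: "'o signature \<Rightarrow> 'o har \<Rightarrow> 'o hedge multiset" where
  "har_edges Sg f \<equiv> hedges Sg (hM f) (hN f)"

lemma lpos_eq: "l permutes {..<hK f} \<Longrightarrow> hL f = perm_mat (hK f) l \<Longrightarrow> lpos f = l"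
  unfolding lpos_def by (rule the_equality) (auto dest: perm_mat_inject)

lemma rpos_eq: "r permutes {..<hK f} \<Longrightarrow> hR f = perm_mat (hK f) r \<Longrightarrow> rpos f = r"
  unfolding rpos_def by (rule the_equality) (auto dest: perm_mat_inject)

lemma is_harD:
  assumes "is_har Sg n m f"
  shows "har_graph Sg (hK f) (hM f) (hN f)" "m \<le> hK f" "n \<le> hK f"
    "lpos f permutes {..<hK f}" "hL f = perm_mat (hK f) (lpos f)" "lpos f ` left_nodes (hM f) (hN f) = {..<n}"
    "rpos f permutes {..<hK f}" "hR f = perm_mat (hK f) (rpos f)"
    "rpos f ` right_nodes (hM f) (hN f) = {hK f - m..<hK f}"
    "hM f \<in> carrier_mat (hK f) (hK f)" "length (hN f) = hK f"
proof -
  obtain l r where lr: "l permutes {..<hK f}" "r permutes {..<hK f}" "hL f = perm_mat (hK f) l" "hR f = perm_mat (hK f) r"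
      "l ` left_nodes (hM f) (hN f) = {..<n}" "r ` right_nodes (hM f) (hN f) = {hK f - m..<hK f}"
    using assms unfolding is_har_iff by blast
  show g: "har_graph Sg (hK f) (hM f) (hN f)" "m \<le> hK f" using assms unfolding is_har_iff by blast+
  show "hM f \<in> carrier_mat (hK f) (hK f)" "length (hN f) = hK f" using hg_carrier[OF g(1)] by auto
  then have "left_nodes (hM f) (hN f) \<subseteq> {..<hK f}" by (auto simp: left_nodes_def)
  then have "{..<n} \<subseteq> {..<hK f}" using lr(1,5) by (metis image_mono permutes_image)
  then show "n \<le> hK f" by simp
  show "lpos f permutes {..<hK f}" "hL f = perm_mat (hK f) (lpos f)" "lpos f ` left_nodes (hM f) (hN f) = {..<n}"
    using lr unfolding lpos_eq[OF lr(1,3)] by auto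
  show "rpos f permutes {..<hK f}" "hR f = perm_mat (hK f) (rpos f)"
    "rpos f ` right_nodes (hM f) (hN f) = {hK f - m..<hK f}"
    using lr unfolding rpos_eq[OF lr(2,4)] by auto
qed

lemma is_harI:
  assumes "har_graph Sg (hK f) (hM f) (hN f)" "l permutes {..<hK f}" "r permutes {..<hK f}"
    "hL f = perm_mat (hK f) l" "hR f = perm_mat (hK f) r" "m \<le> hK f"
    "l ` left_nodes (hM f) (hN f) = {..<n}" "r ` right_nodes (hM f) (hN f) = {hK f - m..<hK f}"
  shows "is_har Sg n m f" "lpos f = l" "rpos f = r"
proof -
  show "is_har Sg n m f" unfolding is_har_iff using assms by (intro conjI exI[of _ l] exI[of _ r])
qed (rule lpos_eq[OF assms(2,4)], rule rpos_eq[OF assms(3,5)])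

lemma inputs_eqI:
  assumes "is_har Sg n m f" "length xs = n" "\<And>i. i < n \<Longrightarrow> lpos f (xs ! i) = i"
  shows "inputs n f = xs"
  using assms(2,3) permutes_inv_eq[OF is_harD(4)[OF assms(1)]]
  by (intro nth_equalityI) (auto simp: inputs_def)

lemma outputs_eqI:
  assumes "is_har Sg n m f" "length xs = m" "\<And>i. i < m \<Longrightarrow> rpos f (xs ! i) = hK f - m + i"
  shows "outputs m f = xs"
  using assms(2,3) permutes_inv_eq[OF is_harD(7)[OF assms(1)]]
  by (intro nth_equalityI) (auto simp: outputs_def)

lemma lpos_inputs:
  assumes "is_har Sg n m f" "i < n"
  shows "lpos f (inputs n f ! i) = i" "inputs n f ! i < hK f"
  using assms is_harD(3,4)[OF assms(1)] permutes_lt[OF permutes_inv[OF is_harD(4)[OF assms(1)]], of i]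
  by (auto simp: inputs_def permutes_inverses)

lemma rpos_outputs:
  assumes "is_har Sg n m f" "i < m"
  shows "rpos f (outputs m f ! i) = hK f - m + i" "outputs m f ! i < hK f"
  using assms is_harD(2,7)[OF assms(1)] permutes_lt[OF permutes_inv[OF is_harD(7)[OF assms(1)]], of "hK f - m + i"]
  by (auto simp: outputs_def permutes_inverses)

lemma length_inputs [simp]: "length (inputs n f) = n" "length (outputs n f) = n"
  by (auto simp: inputs_def outputs_def)

lemma left_nodes_lt:
  assumes "is_har Sg n m f"
  shows "v < hK f \<Longrightarrow> v \<in> left_nodes (hM f) (hN f) \<longleftrightarrow> lpos f v < n"
    "v < hK f \<Longrightarrow> v \<in> right_nodes (hM f) (hN f) \<longleftrightarrow> hK f - m \<le> rpos f v"
proof -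
  have "v \<in> left_nodes (hM f) (hN f) \<longleftrightarrow> lpos f v \<in> lpos f ` left_nodes (hM f) (hN f)"
    using permutes_inj[OF is_harD(4)[OF assms]] by (meson inj_image_mem_iff)
  then show "v \<in> left_nodes (hM f) (hN f) \<longleftrightarrow> lpos f v < n" using is_harD(6)[OF assms] by simp
  assume v: "v < hK f"
  have "v \<in> right_nodes (hM f) (hN f) \<longleftrightarrow> rpos f v \<in> rpos f ` right_nodes (hM f) (hN f)"
    using permutes_inj[OF is_harD(7)[OF assms]] by (meson inj_image_mem_iff)
  then show "v \<in> right_nodes (hM f) (hN f) \<longleftrightarrow> hK f - m \<le> rpos f v"
    using is_harD(9)[OF assms] permutes_lt[OF is_harD(7)[OF assms], of v] v by simp
qed

lemma inputs_set:
  assumes "is_har Sg n m f"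
  shows "distinct (inputs n f)" "set (inputs n f) = left_nodes (hM f) (hN f)"
    "distinct (outputs m f)" "set (outputs m f) = right_nodes (hM f) (hN f)"
proof -
  note h = is_harD[OF assms]
  have il: "inj_on (pinv (lpos f)) A" "inj_on (pinv (rpos f)) A" for A
    using permutes_inj[OF permutes_inv[OF h(4)]] permutes_inj[OF permutes_inv[OF h(7)]] inj_on_subset by blast+
  show "distinct (inputs n f)" using il by (simp add: inputs_def distinct_map)
  have o: "outputs m f = map (pinv (rpos f)) [hK f - m..<hK f]"
    by (rule nth_equalityI) (use h(2) in \<open>auto simp: outputs_def\<close>)
  show "distinct (outputs m f)" unfolding o using il by (simp add: distinct_map)
  have "pinv (lpos f) ` lpos f ` left_nodes (hM f) (hN f) = left_nodes (hM f) (hN f)"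
    by (simp add: image_image permutes_inverses(2)[OF h(4)])
  then show "set (inputs n f) = left_nodes (hM f) (hN f)"
    using h(6) by (simp add: inputs_def atLeast0LessThan)
  have "pinv (rpos f) ` rpos f ` right_nodes (hM f) (hN f) = right_nodes (hM f) (hN f)"
    by (simp add: image_image permutes_inverses(2)[OF h(7)])
  then show "set (outputs m f) = right_nodes (hM f) (hN f)"
    using h(9) unfolding o by simp
qed

text \<open>The bridge between terms and HARs: the vertex numbers of \<open>f\<close> are taken as
  names of wires.\<close>

definition represents :: "'o signature \<Rightarrow> nat \<Rightarrow> nat \<Rightarrow> 'o pterm \<Rightarrow> 'o har \<Rightarrow> bool" where
  "represents Sg n m t f \<longleftrightarrow> is_har Sg n m f \<and> denotes Sg t (inputs n f) (har_edges Sg f) (outputs m f)"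

lemma har_monogamous:
  assumes "is_har Sg n m f"
  shows "monogamous (inputs n f) (har_edges Sg f) (outputs m f)"
    "wires (inputs n f) (har_edges Sg f) = bullets (hN f)"
  using hedges_monogamous[OF is_harD(1)[OF assms] inputs_set[OF assms]] by auto

lemma bullets_subset: "is_har Sg n m f \<Longrightarrow> bullets (hN f) \<subseteq> {..<hK f}"
  using is_harD(11) by (fastforce simp: bullets_def)

text \<open>The source of surjectivity: acyclicity gives a listing of the hyperedges, and the
  listing gives a term.\<close>

lemma har_represented:
  assumes "is_har Sg n m f"
  shows "\<exists>t \<in> pterms Sg n m. represents Sg n m t f"
proof -
  obtain es where es: "mset es = har_edges Sg f" "linear_from (set (inputs n f)) es"
    using hedges_linearisable[OF is_harD(1)[OF assms] inputs_set(2)[OF assms]] by blast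
  then have "prog Sg (inputs n f) es (outputs m f)"
    using har_monogamous(1)[OF assms] hedges_well_sorted[OF is_harD(1)[OF assms]] by (simp add: prog_def)
  then obtain t where t: "wf_term Sg t" "denotes Sg t (inputs n f) (har_edges Sg f) (outputs m f)"
    using prog_denoted es(1) by metis
  then have "t \<in> pterms Sg n m" using denotes_dom[OF t(2)] denotes_cod[OF t(2)] by (simp add: pterms_def)
  then show ?thesis using t assms by (auto simp: represents_def)
qed

section \<open>The diagrams of identities, symmetries and singletons\<close>

lemma har_graph_discrete:
  fixes Sg :: "'o signature"
  shows "har_graph Sg n (0\<^sub>m n n) (replicate n Bullet)" "left_nodes (0\<^sub>m n n) (replicate n Bullet) = {..<n}"
  "right_nodes (0\<^sub>m n n) (replicate n Bullet) = {..<n}" "hedges Sg (0\<^sub>m n n) (replicate n Bullet) = {#}"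
proof -
  have e: "edges (0\<^sub>m n n) = {}" by (auto simp: edges_def)
  then show "har_graph Sg n (0\<^sub>m n n) (replicate n Bullet)"
    by (auto simp: har_graph_def preds_def succs_def acyclic_def)
  show "left_nodes (0\<^sub>m n n) (replicate n Bullet) = {..<n}" "right_nodes (0\<^sub>m n n) (replicate n Bullet) = {..<n}"
    using e by (auto simp: left_nodes_def right_nodes_def preds_def succs_def)
  have "circs (replicate n Bullet :: 'o node list) = {}" by (auto simp: circs_def)
  then show "hedges Sg (0\<^sub>m n n) (replicate n Bullet) = {#}" by (simp add: hedges_def)
qed

lemma represents_id: "represents Sg n n (TId n) (har_id n)"
proof -
  let ?f = "har_id n :: 'a har"
  have K: "hK ?f = n" by (simp add: har_id_def)
  have h: "is_har Sg n n ?f" and l: "lpos ?f = id" and r: "rpos ?f = id"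
    using is_harI[of Sg ?f id id n n] permutes_id[of "{..<n}"]
    by (auto simp: har_id_def perm_mat_one atLeast0LessThan har_graph_discrete)
  have "inputs n ?f = [0..<n]" by (rule inputs_eqI[OF h]) (simp_all add: l)
  moreover have "outputs n ?f = [0..<n]" by (rule outputs_eqI[OF h]) (simp_all add: r K)
  moreover have "har_edges Sg ?f = {#}" using har_graph_discrete(4) by (simp add: har_id_def)
  ultimately show ?thesis using h by (simp add: represents_def)
qed

lemma represents_sym: "represents Sg (n + m) (m + n) (TSym n m) (har_sym n m)"
proof -
  let ?f = "har_sym n m :: 'a har"
  have K: "hK ?f = n + m" by (simp add: har_sym_def)
  have "psig n m ` {..<n + m} = {..<n + m}" using psig_permutes by (rule permutes_image)
  then have h: "is_har Sg (n + m) (m + n) ?f" and l: "lpos ?f = id" and r: "rpos ?f = psig n m"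
    using is_harI[of Sg ?f id "psig n m" "m + n" "n + m"]
      permutes_id[of "{..<n + m}"] psig_permutes[of n m]
    by (auto simp: har_sym_def perm_mat_one sigma_perm_mat atLeast0LessThan har_graph_discrete)
  have "inputs (n + m) ?f = [0..<n] @ [n..<n + m]"
    by (rule inputs_eqI[OF h]) (auto simp: l nth_append)
  moreover have "outputs (m + n) ?f = [n..<n + m] @ [0..<n]"
    by (rule outputs_eqI[OF h]) (auto simp: r K psig_def nth_append)
  moreover have "har_edges Sg ?f = {#}" using har_graph_discrete(4) by (simp add: har_sym_def)
  moreover have "denotes Sg (TSym n m) ([0..<n] @ [n..<n + m]) {#} ([n..<n + m] @ [0..<n])"
    by (rule denotes_TSymI) auto
  ultimately show ?thesis using h by (simp add: represents_def)
qed

lemma represents_gen: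
  assumes g: "g \<in> ops Sg"
  shows "represents Sg (arity Sg g) (coarity Sg g) (TGen g) (har_gen Sg g)"
proof -
  let ?f = "har_gen Sg g"
  define n where "n = arity Sg g"
  define m where "m = coarity Sg g"
  define K where "K = n + 1 + m"
  define M where "M = mat K K (\<lambda>(i, j). if i = n \<and> j < n then j + 1 else if n < i \<and> j = n then i - n else 0)"
  define N where "N = replicate n Bullet @ [Circ g] @ replicate m Bullet"
  have f: "hK ?f = K" "hM ?f = M" "hL ?f = perm_mat K id" "hR ?f = perm_mat K id" "hN ?f = N"
    unfolding har_gen_def Let_def n_def m_def K_def M_def N_def perm_mat_one by simp_all
  have len: "length N = K" by (simp add: N_def K_def)
  have Nn: "i < K \<Longrightarrow> N ! i = (if i = n then Circ g else Bullet)" for i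
    by (auto simp: N_def K_def nth_append nth_Cons')
  have Mij: "i < K \<Longrightarrow> j < K \<Longrightarrow> M $$ (i, j) = (if i = n \<and> j < n then j + 1 else if n < i \<and> j = n then i - n else 0)" for i j
    by (simp add: M_def)
  have c: "M \<in> carrier_mat K K" by (simp add: M_def)
  have e: "(j, i) \<in> edges M \<longleftrightarrow> i = n \<and> j < n \<or> i < K \<and> n < i \<and> j = n" for i j
    unfolding mem_edges[OF c] using Mij[of i j] by (auto simp: K_def split: if_splits)
  have pn: "preds M n = {..<n}" by (auto simp: preds_def e)
  have sn: "succs M n = {n<..<K}" by (auto simp: succs_def e)
  have pb: "preds M v = (if v < n then {} else if v < K then {n} else {})" if "v \<noteq> n" for v
    using that by (auto simp: preds_def e)
  have sb: "succs M v = (if v < n then {n} else {})" if "v \<noteq> n" for v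
    using that by (auto simp: succs_def e)
  have "edges M \<subseteq> less_than" by (auto simp: e)
  then have ac: "acyclic (edges M)" using acyclic_subset[OF wf_acyclic[OF wf_less_than]] by blast
  have hg: "har_graph Sg K M N"
    unfolding har_graph_def
  proof (intro conjI)
    show "\<forall>g. Circ g \<in> set N \<longrightarrow> g \<in> ops Sg" using g by (auto simp: N_def)
    show "\<forall>(j, i)\<in>edges M. (N ! j = Bullet) \<noteq> (N ! i = Bullet)"
      using Nn by (auto simp: e K_def)
    show "\<forall>v<K. N ! v = Bullet \<longrightarrow> card (preds M v) \<le> 1 \<and> card (succs M v) \<le> 1"
    proof (intro allI impI)
      fix v assume "v < K" "N ! v = Bullet"
      then have "v \<noteq> n" using Nn[of v] by auto
      then show "card (preds M v) \<le> 1 \<and> card (succs M v) \<le> 1" by (simp add: pb sb)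
    qed
    show "\<forall>v<K. \<forall>h. N ! v = Circ h \<longrightarrow> bij_betw (\<lambda>u. M $$ (v, u)) (preds M v) {1..arity Sg h} \<and>
        bij_betw (\<lambda>w. M $$ (w, v)) (succs M v) {1..coarity Sg h}"
    proof (intro allI impI)
      fix v h assume v: "v < K" "N ! v = Circ h"
      then have vn: "v = n" "h = g" using Nn[of v] by (auto split: if_splits)
      have "bij_betw (\<lambda>u. M $$ (n, u)) {..<n} {1..n}"
        by (rule bij_betw_byWitness[where f' = "\<lambda>i. i - 1"]) (auto simp: Mij K_def)
      moreover have "bij_betw (\<lambda>w. M $$ (w, n)) {n<..<K} {1..m}"
        by (rule bij_betw_byWitness[where f' = "\<lambda>i. n + i"]) (auto simp: Mij K_def)
      ultimately show "bij_betw (\<lambda>u. M $$ (v, u)) (preds M v) {1..arity Sg h} \<and>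
          bij_betw (\<lambda>w. M $$ (w, v)) (succs M v) {1..coarity Sg h}"
        unfolding vn pn sn n_def[symmetric] m_def[symmetric] by blast
    qed
  qed (fact c len ac)+
  have left: "left_nodes M N = {..<n}"
  proof -
    have "v \<in> left_nodes M N \<longleftrightarrow> v < n" for v
      using Nn[of v] pb[of v] len by (cases "v = n") (auto simp: left_nodes_def K_def)
    then show ?thesis by blast
  qed
  have right: "right_nodes M N = {K - m..<K}"
  proof -
    have "v \<in> right_nodes M N \<longleftrightarrow> n < v \<and> v < K" for v
      using Nn[of v] sb[of v] len by (cases "v = n") (auto simp: right_nodes_def K_def)
    then have "right_nodes M N = {n<..<K}" by fastforce
    moreover have "K - m = Suc n" by (simp add: K_def)
    ultimately show ?thesis by (simp add: atLeastSucLessThan_greaterThanLessThan)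
  qed
  have h: "is_har Sg n m ?f" and l: "lpos ?f = id" and r: "rpos ?f = id"
    using is_harI[of Sg ?f id id m n] hg left right permutes_id[of "{..<K}"] unfolding f by (auto simp: K_def)
  have nc: "n \<in> circs N" using len Nn[of n] by (simp add: circs_def K_def)
  have "v \<in> circs N \<longleftrightarrow> v = n" for v using Nn[of v] len by (auto simp: circs_def K_def split: if_splits)
  then have "circs N = {n}" by blast
  moreover have "circ_edge Sg M N n = (g, [0..<n], [n + 1..<K])"
  proof -
    note p = circ_edge_props[OF hg nc]
    have op: "op_of (N ! n) = g" using Nn[of n] by (simp add: K_def)
    have "hsrc (circ_edge Sg M N n) = [0..<n]"
    proof (rule nth_equalityI)
      fix i assume "i < length (hsrc (circ_edge Sg M N n))"
      then have i: "i < n" using p(7) op n_def by simp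
      then show "hsrc (circ_edge Sg M N n) ! i = [0..<n] ! i"
        using p(5)[of i i] Mij[of n i] by (simp add: K_def)
    qed (use p(7) op n_def in simp)
    moreover have "htgt (circ_edge Sg M N n) = [n + 1..<K]"
    proof (rule nth_equalityI)
      fix i assume "i < length (htgt (circ_edge Sg M N n))"
      then have i: "i < m" using p(8) op m_def by simp
      then have k: "n + 1 + i < K" "n < K" by (simp_all add: K_def)
      then have "htgt (circ_edge Sg M N n) ! i = n + 1 + i"
        using p(6)[OF k(1), of i] Mij[OF k] by simp
      then show "htgt (circ_edge Sg M N n) ! i = [n + 1..<K] ! i"
        using nth_upt[OF k(1)] by simp
    qed (use p(8) op m_def K_def in simp)
    moreover have "hlab (circ_edge Sg M N n) = g" using op by (simp add: circ_edge_def)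
    ultimately show ?thesis by (simp add: prod_eq_iff)
  qed
  ultimately have E: "har_edges Sg ?f = {#(g, [0..<n], [n + 1..<K])#}"
    unfolding f by (simp add: hedges_def)
  have i: "inputs n ?f = [0..<n]" by (rule inputs_eqI[OF h]) (simp_all add: l)
  have o: "outputs m ?f = [n + 1..<K]"
  proof (rule outputs_eqI[OF h])
    fix i assume "i < m"
    then have "n + 1 + i < K" "K - m + i = n + 1 + i" by (simp_all add: K_def)
    then show "rpos ?f ([n + 1..<K] ! i) = hK ?f - m + i" using nth_upt by (simp add: r f)
  qed (simp add: K_def)
  have "denotes Sg (TGen g) [0..<n] {#(g, [0..<n], [n + 1..<K])#} [n + 1..<K]"
    by (auto simp: n_def m_def K_def)
  then show ?thesis using h i o E unfolding represents_def n_def m_def by simp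
qed

text \<open>In the composite matrix the vertices of \<open>f\<close> appear in right order from
  position 0 and those of \<open>g\<close> in left order from position \<open>hK f - m\<close>. The
  \<open>m\<close> positions in which they overlap are where the outputs of \<open>f\<close> meet
  the inputs of \<open>g\<close>, which explains both maps.\<close>

lemma comp_glue:
  assumes f: "is_har Sg n m f" and g: "is_har Sg m l g"
  defines "h \<equiv> har_comp m f g"
  defines "\<alpha> \<equiv> rpos f" and "\<beta> \<equiv> (\<lambda>v. hK f - m + lpos g v)"
  shows "gluing Sg (hK f) (hM f) (hN f) (hK g) (hM g) (hN g) (hK h) (hM h) (hN h) \<alpha> \<beta>"
    and "hK h = hK f + hK g - m"
    and "hL h = perm_mat (hK h) (psum (hK f) (lpos f \<circ> pinv (rpos f)) id)"
    and "hR h = perm_mat (hK h) (psum (hK f - m) id (rpos g \<circ> pinv (lpos g)))"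
    and "psum (hK f) (lpos f \<circ> pinv (rpos f)) id permutes {..<hK h}"
    and "psum (hK f - m) id (rpos g \<circ> pinv (lpos g)) permutes {..<hK h}"
proof -
  note F = is_harD[OF f] and G = is_harD[OF g]
  show K: "hK h = hK f + hK g - m" by (simp add: h_def har_comp_def Let_def)
  have K': "hK h = hK f + (hK g - m)" "hK h = hK f - m + hK g" using K F(2) G(3) by auto
  have N: "hN h = (hN f \<Zsemi>\<^sub>l hR f) @ drop m (hN g \<Zsemi>\<^sub>l hL g)"
    by (simp add: h_def har_comp_def Let_def left_order_def right_order_def)
  have reoR: "(hR f)\<^sup>T \<Zsemi> hM f \<Zsemi> hR f = reorder (rpos f) (hM f)" using reorder_conj[OF F(7,10)] F(8) by simp
  have reoL: "(hL g)\<^sup>T \<Zsemi> hM g \<Zsemi> hL g = reorder (lpos g) (hM g)" using reorder_conj[OF G(4,10)] G(5) by simp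
  have LR: "(hR f)\<^sup>T \<Zsemi> hL f = perm_mat (hK f) (lpos f \<circ> pinv (rpos f))"
    unfolding F(5,8) dcomp_def perm_mat_transpose[OF F(7)] by (rule perm_mat_mult[OF F(4)])
  have RL: "(hL g)\<^sup>T \<Zsemi> hR g = perm_mat (hK g) (rpos g \<circ> pinv (lpos g))"
    unfolding G(5,8) dcomp_def perm_mat_transpose[OF G(4)] by (rule perm_mat_mult[OF G(7)])
  have p1: "lpos f \<circ> pinv (rpos f) permutes {..<hK f}" using permutes_compose[OF permutes_inv[OF F(7)] F(4)] .
  have p2: "rpos g \<circ> pinv (lpos g) permutes {..<hK g}" using permutes_compose[OF permutes_inv[OF G(4)] G(7)] .
  show "hL h = perm_mat (hK h) (psum (hK f) (lpos f \<circ> pinv (rpos f)) id)"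
    unfolding K'(1) dsum_perm_mat[OF p1 permutes_id, symmetric] perm_mat_one[symmetric]
    by (simp add: h_def har_comp_def Let_def right_order_def LR)
  show "hR h = perm_mat (hK h) (psum (hK f - m) id (rpos g \<circ> pinv (lpos g)))"
    unfolding K'(2) dsum_perm_mat[OF permutes_id p2, symmetric] perm_mat_one[symmetric]
    by (simp add: h_def har_comp_def Let_def left_order_def RL)
  show "psum (hK f) (lpos f \<circ> pinv (rpos f)) id permutes {..<hK h}"
    unfolding K'(1) by (rule psum_permutes[OF p1 permutes_id])
  show "psum (hK f - m) id (rpos g \<circ> pinv (lpos g)) permutes {..<hK h}"
    unfolding K'(2) by (rule psum_permutes[OF permutes_id p2])
  have alt: "\<alpha> i < hK f \<longleftrightarrow> i < hK f" and blt: "lpos g j < hK g \<longleftrightarrow> j < hK g" for i j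
    using permutes_lt[OF F(7)] permutes_lt[OF G(4)] by (auto simp: \<alpha>_def)
  have ainv: "\<alpha> (pinv \<alpha> i) = i" "pinv \<alpha> (\<alpha> i) = i" for i using permutes_inverses[OF F(7)] by (auto simp: \<alpha>_def)
  have binv: "pinv (lpos g) (lpos g i) = i" "lpos g (pinv (lpos g) i) = i" for i using permutes_inverses[OF G(4)] by auto
  have Aimg: "\<alpha> ` {..<hK f} = {..<hK f}" unfolding \<alpha>_def by (rule permutes_image[OF F(7)])
  have Bimg: "\<beta> ` {..<hK g} = {hK f - m..<hK h}"
  proof -
    have "\<beta> ` {..<hK g} = (+) (hK f - m) ` (lpos g ` {..<hK g})" by (auto simp: \<beta>_def)
    also have "\<dots> = (+) (hK f - m) ` {0..<hK g}" unfolding permutes_image[OF G(4)] atLeast0LessThan ..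
    also have "\<dots> = {hK f - m..<hK h}" unfolding image_add_atLeastLessThan K'(2) by (simp add: add.commute)
    finally show ?thesis .
  qed
  have ah: "\<alpha> i < hK h" if "i < hK f" for i using that alt[of i] K'(1) by simp
  have bh: "\<beta> j < hK h" if "j < hK g" for j using that blt[of j] K'(2) by (simp add: \<beta>_def)
  define A where "A = reorder (rpos f) (hM f)"
  define B where "B = reorder (lpos g) (hM g)"
  have cA: "A \<in> carrier_mat (hK f) (hK f)" and cB: "B \<in> carrier_mat (hK g) (hK g)"
    using reorder_carrier F(10) G(10) by (auto simp: A_def B_def)
  have M: "hM h = first_cols (hK f - m) A \<oplus>\<^sub>d last_rows (hK g - m) B"
    by (simp add: h_def har_comp_def Let_def left_order_def right_order_def reoR reoL A_def B_def)
  have Mc: "hM h \<in> carrier_mat (hK h) (hK h)"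
    unfolding M using cA cB K' by (intro carrier_matI) (auto simp: dsum_def first_cols_def last_rows_def)
  \<comment> \<open>The blocks omit the columns of the right interface nodes of \<open>f\<close> and
    the rows of the left interface nodes of \<open>g\<close>. Those nodes have no outgoing,
    respectively incoming, edges, so only zeros are lost; the verification of the gluing entries
    uses this.\<close>
  have Mij: "hM h $$ (i, j) = (if i < hK f \<and> j < hK f - m then A $$ (i, j)
       else if hK f \<le> i \<and> hK f - m \<le> j then B $$ (i - (hK f - m), j - (hK f - m)) else 0)"
    if "i < hK h" "j < hK h" for i j
  proof -
    have d: "dim_row A = hK f" "dim_row B = hK g" "dim_col A = hK f" "dim_col B = hK g" using cA cB by auto
    \<comment> \<open>\<open>last_rows\<close> counts from the bottom; since \<open>m\<close>
      exceeds neither size, its offset is the shift by \<open>hK f - m\<close>.\<close>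
    have "hK f \<le> i \<Longrightarrow> hK g - (hK g - m) + (i - hK f) = i - (hK f - m)" using F(2) G(3) by simp
    then show ?thesis using that F(2) G(3) unfolding M K'(1)
      by (auto simp: dsum_def first_cols_def last_rows_def d)
  qed
  have Aij: "A $$ (\<alpha> i, \<alpha> j) = hM f $$ (i, j)" if "i < hK f" "j < hK f" for i j
    using reorder_index[OF F(10), of "\<alpha> i" "\<alpha> j" "rpos f"] alt that ainv unfolding A_def \<alpha>_def by simp
  have Bij: "B $$ (lpos g i, lpos g j) = hM g $$ (i, j)" if "i < hK g" "j < hK g" for i j
    using reorder_index[OF G(10), of "lpos g i" "lpos g j" "lpos g"] blt that binv unfolding B_def by simp
  show "gluing Sg (hK f) (hM f) (hN f) (hK g) (hM g) (hN g) (hK h) (hM h) (hN h) \<alpha> \<beta>"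
  proof
    show "har_graph Sg (hK f) (hM f) (hN f)" "har_graph Sg (hK g) (hM g) (hN g)" by fact+
    show "inj_on \<alpha> {..<hK f}" unfolding \<alpha>_def by (rule permutes_inj_on[OF F(7)])
    show "inj_on \<beta> {..<hK g}" using permutes_inj_on[OF G(4)] by (auto simp: \<beta>_def inj_on_def)
    show "\<alpha> ` {..<hK f} \<union> \<beta> ` {..<hK g} = {..<hK h}"
    proof -
      have "hK f \<le> hK h" using K'(1) by simp
      then show ?thesis unfolding Aimg Bimg by auto
    qed
    show "hM h \<in> carrier_mat (hK h) (hK h)" by fact
    show "length (hN h) = hK h" using F(11) G(11) K' by (simp add: N)
    show labA: "hN h ! \<alpha> i = hN f ! i" if "i < hK f" for i
      using that alt[of i] permute_labels_nth[OF F(7,11), of "\<alpha> i"] ainv F(11) unfolding N F(8)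
      by (simp add: nth_append \<alpha>_def)
    show sh: "i \<in> right_nodes (hM f) (hN f) \<and> j \<in> left_nodes (hM g) (hN g)"
      if "i < hK f" "j < hK g" "\<alpha> i = \<beta> j" for i j
    proof -
      have "rpos f i = hK f - m + lpos g j" "rpos f i < hK f" using that alt[of i] by (simp_all add: \<alpha>_def \<beta>_def)
      then have "hK f - m \<le> rpos f i" "lpos g j < m" using F(2) by linarith+
      then show ?thesis using left_nodes_lt(2)[OF f that(1)] left_nodes_lt(1)[OF g that(2)] by simp
    qed
    show "hN h ! \<beta> j = hN g ! j" if j: "j < hK g" for j
    proof (cases "\<beta> j < hK f")
      case True
      then obtain i where i: "i < hK f" "\<beta> j = \<alpha> i" using Aimg by (metis imageE lessThan_iff)
      \<comment> \<open>A glued vertex takes its label from \<open>f\<close>, which is harmless as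
        both labels are \<open>Bullet\<close>.\<close>
      then have "hN f ! i = Bullet" "hN g ! j = Bullet" using sh[OF i(1) j] by (auto simp: right_nodes_def left_nodes_def)
      then show ?thesis using labA[OF i(1)] i(2) by simp
    next
      case False
      then have e: "m + (\<beta> j - hK f) = lpos g j" using F(2) by (simp add: \<beta>_def)
      have "hN h ! \<beta> j = (hN g \<Zsemi>\<^sub>l hL g) ! lpos g j"
        using False e F(11) G(11) G(3) unfolding N by (simp add: nth_append)
      then show ?thesis using permute_labels_nth[OF G(4,11), of "lpos g j"] blt j binv unfolding G(5) by simp
    qed
    show "hM h $$ (\<alpha> i, \<alpha> j) = hM f $$ (i, j)" if "i < hK f" "j < hK f" for i j
    proof (cases "\<alpha> j < hK f - m")
      case True
      then show ?thesis using that alt[of i] Mij[OF ah ah, of i j] Aij[of i j] by simp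
    next
      case False
      then have "j \<in> right_nodes (hM f) (hN f)" using left_nodes_lt(2)[OF f that(2)] by (simp add: \<alpha>_def)
      then have "(j, i) \<notin> edges (hM f)" by (auto simp: right_nodes_def succs_def)
      then have "hM f $$ (i, j) = 0" using that mem_edges[OF F(10)] by blast
      then show ?thesis using False that alt[of i] Mij[OF ah ah, of i j] by simp
    qed
    show "hM h $$ (\<beta> i, \<beta> j) = hM g $$ (i, j)" if "i < hK g" "j < hK g" for i j
    proof (cases "\<beta> i < hK f")
      case False
      then show ?thesis using that Mij[OF bh bh, of i j] Bij[of i j] by (simp add: \<beta>_def)
    next
      case True
      then have "lpos g i < m" using F(2) by (simp add: \<beta>_def)
      then have "i \<in> left_nodes (hM g) (hN g)" using left_nodes_lt(1)[OF g that(1)] by simp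
      then have "(j, i) \<notin> edges (hM g)" by (auto simp: left_nodes_def preds_def)
      then have 0: "hM g $$ (i, j) = 0" using that mem_edges[OF G(10)] by blast
      then show ?thesis using True that Mij[OF bh bh, of i j] by (simp add: \<beta>_def)
    qed
    show "hM h $$ (\<alpha> i, \<beta> j) = 0 \<and> hM h $$ (\<beta> j, \<alpha> i) = 0"
      if "i < hK f" "j < hK g" "\<alpha> i \<notin> \<beta> ` {..<hK g}" "\<beta> j \<notin> \<alpha> ` {..<hK f}" for i j
    proof -
      have a: "\<alpha> i < hK f - m" using that(1,3) ah[of i] unfolding Bimg by simp
      have b: "hK f \<le> \<beta> j" using that(4) unfolding Aimg by simp
      have c: "\<not> hK f \<le> \<alpha> i" "\<not> \<beta> j < hK f - m" using a b by linarith+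
      show ?thesis using a b c Mij[OF ah[OF that(1)] bh[OF that(2)]] Mij[OF bh[OF that(2)] ah[OF that(1)]] by simp
    qed
  qed
qed

text \<open>Renaming along the two maps of the gluing turns the outputs of \<open>f\<close> and the
  inputs of \<open>g\<close> into one list (\<open>mid\<close>). The remaining sharing condition is
  read off from monogamy of the composite HAR.\<close>

lemma represents_comp:
  assumes s: "represents Sg n m s f" and t: "represents Sg m l t g"
  shows "represents Sg n l (TComp s t) (har_comp m f g)"
proof -
  have f: "is_har Sg n m f" and g: "is_har Sg m l g" using s t by (auto simp: represents_def)
  note F = is_harD[OF f] and G = is_harD[OF g]
  let ?h = "har_comp m f g" and ?\<alpha> = "rpos f" and ?\<beta> = "\<lambda>v. hK f - m + lpos g v"
  let ?l = "psum (hK f) (lpos f \<circ> pinv (rpos f)) id" and ?r = "psum (hK f - m) id (rpos g \<circ> pinv (lpos g))"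
  note C = comp_glue[OF f g]
  interpret gluing Sg "hK f" "hM f" "hN f" "hK g" "hM g" "hN g" "hK ?h" "hM ?h" "hN ?h" ?\<alpha> ?\<beta> by (rule C(1))
  have alt: "?\<alpha> i < hK f \<longleftrightarrow> i < hK f" and blt: "lpos g j < hK g \<longleftrightarrow> j < hK g" for i j
    using permutes_lt[OF F(7)] permutes_lt[OF G(4)] by auto
  have ainv: "?\<alpha> (pinv ?\<alpha> i) = i" "pinv ?\<alpha> (?\<alpha> i) = i" for i using permutes_inverses[OF F(7)] by auto
  have binv: "pinv (lpos g) (lpos g i) = i" "lpos g (pinv (lpos g) i) = i" for i using permutes_inverses[OF G(4)] by auto
  have la: "?l (?\<alpha> i) = lpos f i" if "i < hK f" for i using that alt ainv by (simp add: psum_def)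
  have rb: "?r (?\<beta> j) = hK f - m + rpos g j" for j using binv by (simp add: psum_def)
  have lsub: "left_nodes (hM f) (hN f) \<subseteq> {..<hK f}" "right_nodes (hM g) (hN g) \<subseteq> {..<hK g}"
    "left_nodes (hM g) (hN g) \<subseteq> {..<hK g}" "right_nodes (hM f) (hN f) \<subseteq> {..<hK f}"
    using F(11) G(11) by (auto simp: left_nodes_def right_nodes_def)
  have mK: "m \<le> hK f" "m \<le> hK g" "l \<le> hK g" using F G by auto
  \<comment> \<open>All inputs of \<open>g\<close> and, by \<open>sh2\<close>, all outputs of
    \<open>f\<close> are glued. So the interface of the composite is the left one of
    \<open>f\<close> and the right one of \<open>g\<close>.\<close>
  have sh1: "?\<beta> j \<in> ?\<alpha> ` {..<hK f}" if "j \<in> left_nodes (hM g) (hN g)" for j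
  proof -
    have "lpos g j < m" using that left_nodes_lt(1)[OF g] lsub by auto
    then have "?\<beta> j < hK f" using mK by simp
    then show ?thesis unfolding permutes_image[OF F(7)] by simp
  qed
  have sh2: "?\<alpha> i \<in> ?\<beta> ` {..<hK g}" if "i \<in> right_nodes (hM f) (hN f)" for i
  proof -
    have i: "i < hK f" using that lsub by auto
    then have "hK f - m \<le> ?\<alpha> i" using that left_nodes_lt(2)[OF f] by simp
    then have k: "?\<alpha> i - (hK f - m) < m" "?\<alpha> i = hK f - m + (?\<alpha> i - (hK f - m))" using alt[of i] i mK by auto
    have "pinv (lpos g) (?\<alpha> i - (hK f - m)) < hK g"
      using k mK permutes_lt[OF permutes_inv[OF G(4)], of "?\<alpha> i - (hK f - m)"] by simp
    then show ?thesis using k(2) binv(2)[of "?\<alpha> i - (hK f - m)"]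
      by (intro image_eqI[of _ _ "pinv (lpos g) (?\<alpha> i - (hK f - m))"]) auto
  qed
  have left: "left_nodes (hM ?h) (hN ?h) = ?\<alpha> ` left_nodes (hM f) (hN f)"
    unfolding left_nodes_glue using sh1 by auto
  have right: "right_nodes (hM ?h) (hN ?h) = ?\<beta> ` right_nodes (hM g) (hN g)"
    unfolding right_nodes_glue using sh2 by auto
  have "?l ` left_nodes (hM ?h) (hN ?h) = lpos f ` left_nodes (hM f) (hN f)"
    unfolding left image_image using la lsub(1) by (intro image_cong) auto
  then have L: "?l ` left_nodes (hM ?h) (hN ?h) = {..<n}" using F(6) by simp
  have "?r ` right_nodes (hM ?h) (hN ?h) = (+) (hK f - m) ` rpos g ` right_nodes (hM g) (hN g)"
    unfolding right image_image rb ..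
  also have "\<dots> = {hK ?h - l..<hK ?h}" unfolding G(9) image_add_atLeastLessThan C(2) using mK by (simp add: add.commute)
  finally have R: "?r ` right_nodes (hM ?h) (hN ?h) = {hK ?h - l..<hK ?h}" .
  have lK: "l \<le> hK ?h" using mK C(2) by simp
  have h: "is_har Sg n l ?h" and lp: "lpos ?h = ?l" and rp: "rpos ?h = ?r"
    using is_harI[OF har_graph_glue C(5,6,3,4) lK L R] by auto
  have i: "inputs n ?h = map ?\<alpha> (inputs n f)"
    by (rule inputs_eqI[OF h]) (use la lpos_inputs[OF f] lp in simp_all)
  have o: "outputs l ?h = map ?\<beta> (outputs l g)"
    by (rule outputs_eqI[OF h]) (use rb rpos_outputs[OF g] rp mK C(2) in simp_all)
  have mid: "map ?\<alpha> (outputs m f) = map ?\<beta> (inputs m g)"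
    by (rule nth_equalityI) (use rpos_outputs[OF f] lpos_inputs[OF g] in simp_all)
  have w: "wires (inputs n f) (har_edges Sg f) \<subseteq> {..<hK f}" "wires (inputs m g) (har_edges Sg g) \<subseteq> {..<hK g}"
    using har_monogamous(2)[OF f] har_monogamous(2)[OF g] bullets_subset[OF f] bullets_subset[OF g] by auto
  have df: "denotes Sg s (map ?\<alpha> (inputs n f)) (image_mset (hmap ?\<alpha>) (har_edges Sg f)) (map ?\<alpha> (outputs m f))"
    by (rule denotes_rename) (use s inj_on_subset[OF inj_a w(1)] in \<open>auto simp: represents_def\<close>)
  have dg: "denotes Sg t (map ?\<beta> (inputs m g)) (image_mset (hmap ?\<beta>) (har_edges Sg g)) (map ?\<beta> (outputs l g))"
    by (rule denotes_rename) (use t inj_on_subset[OF inj_b w(2)] in \<open>auto simp: represents_def\<close>)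
  have "denotes Sg (TComp s t) (inputs n ?h) (har_edges Sg ?h) (outputs l ?h)"
    unfolding i o hedges_glue
  proof (rule denotes_compI[OF df[unfolded mid] dg])
    show "wires (map ?\<alpha> (inputs n f)) (image_mset (hmap ?\<alpha>) (har_edges Sg f)) \<inter>
        wires (map ?\<beta> (inputs m g)) (image_mset (hmap ?\<beta>) (har_edges Sg g)) = set (map ?\<beta> (inputs m g))"
      by (rule wires_int_cod[OF df[unfolded mid]])
         (use har_monogamous(1)[OF h] in \<open>simp add: i o hedges_glue\<close>)
  qed
  then show ?thesis using h by (simp add: represents_def)
qed

text \<open>Exchanges the adjacent blocks of lengths \<open>b\<close> and \<open>c\<close> that
  follow the first \<open>a\<close> positions. This is the permutation of the correction factors in
  \<open>har_tensor\<close>.\<close>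

definition pblock :: "nat \<Rightarrow> nat \<Rightarrow> nat \<Rightarrow> nat \<Rightarrow> nat" where
  "pblock a b c = psum (a + (b + c)) (psum a id (psig b c)) id"

lemma pblock_eq: "pblock a b c p = (if p < a then p else if p < a + b then p + c else if p < a + b + c then p - b else p)"
  by (auto simp: pblock_def psum_def psig_def)

lemma pblock_permutes: "pblock a b c permutes {..<a + (b + c) + d}"
  unfolding pblock_def by (intro psum_permutes permutes_id psig_permutes)

lemma pblock_mat: "1\<^sub>m a \<oplus>\<^sub>d sigma_mat b c \<oplus>\<^sub>d 1\<^sub>m d = perm_mat (a + (b + c) + d) (pblock a b c)"
  unfolding pblock_def perm_mat_one sigma_perm_mat
  by (simp add: dsum_perm_mat psum_permutes psig_permutes permutes_id)

text \<open>The direct sum of the left orders would place the inputs of \<open>g\<close> behind all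
  of \<open>f\<close>; \<open>tl\<close> moves them to directly after the inputs of
  \<open>f\<close>. Dually, \<open>tr\<close> moves the outputs of \<open>f\<close> past the
  vertices of \<open>g\<close> that are not outputs. The graphs are glued along nothing.\<close>

lemma represents_tensor:
  assumes s: "represents Sg n1 m1 s f" and t: "represents Sg n2 m2 t g"
  shows "represents Sg (n1 + n2) (m1 + m2) (TTens s t) (har_tensor n1 m1 n2 m2 f g)"
proof -
  have f: "is_har Sg n1 m1 f" and g: "is_har Sg n2 m2 g" using s t by (auto simp: represents_def)
  note F = is_harD[OF f] and G = is_harD[OF g]
  let ?h = "har_tensor n1 m1 n2 m2 f g" and ?\<alpha> = "\<lambda>v::nat. v" and ?\<beta> = "\<lambda>v. hK f + v"
  define tl where "tl = pblock n1 (hK f - n1) n2"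
  define tr where "tr = pblock (hK f - m1) m1 (hK g - m2)"
  let ?l = "tl \<circ> psum (hK f) (lpos f) (lpos g)" and ?r = "tr \<circ> psum (hK f) (rpos f) (rpos g)"
  have K: "hK ?h = hK f + hK g" by (simp add: har_tensor_def)
  have Kl: "n1 + (hK f - n1 + n2) + (hK g - n2) = hK ?h" and Kr: "hK f - m1 + (m1 + (hK g - m2)) + m2 = hK ?h"
    using F(2,3) G(2,3) K by auto
  have ptl: "tl permutes {..<hK ?h}" using pblock_permutes[of n1 "hK f - n1" n2 "hK g - n2"] unfolding Kl tl_def .
  have ptr: "tr permutes {..<hK ?h}" using pblock_permutes[of "hK f - m1" m1 "hK g - m2" m2] unfolding Kr tr_def .
  have p: "psum (hK f) (lpos f) (lpos g) permutes {..<hK ?h}" "psum (hK f) (rpos f) (rpos g) permutes {..<hK ?h}"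
    unfolding K using psum_permutes F(4,7) G(4,7) by blast+
  have pl: "?l permutes {..<hK ?h}" by (rule permutes_compose[OF p(1) ptl])
  have pr: "?r permutes {..<hK ?h}" by (rule permutes_compose[OF p(2) ptr])
  have hL: "hL ?h = perm_mat (hK ?h) ?l"
  proof -
    have "hL ?h = perm_mat (hK ?h) tl * perm_mat (hK ?h) (psum (hK f) (lpos f) (lpos g))"
      unfolding tl_def Kl[symmetric] pblock_mat[symmetric]
      unfolding Kl K dsum_perm_mat[OF F(4) G(4), symmetric] F(5)[symmetric] G(5)[symmetric]
      by (simp add: har_tensor_def dcomp_def)
    then show ?thesis using perm_mat_mult[OF ptl] by simp
  qed
  have hR: "hR ?h = perm_mat (hK ?h) ?r"
  proof -
    have "hR ?h = perm_mat (hK ?h) tr * perm_mat (hK ?h) (psum (hK f) (rpos f) (rpos g))"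
      unfolding tr_def Kr[symmetric] pblock_mat[symmetric]
      unfolding Kr K dsum_perm_mat[OF F(7) G(7), symmetric] F(8)[symmetric] G(8)[symmetric]
      by (simp add: har_tensor_def dcomp_def)
    then show ?thesis using perm_mat_mult[OF ptr] by simp
  qed
  have N: "hN ?h = hN f @ hN g" and M: "hM ?h = hM f \<oplus>\<^sub>d hM g" by (simp_all add: har_tensor_def)
  have d: "dim_row (hM f) = hK f" "dim_col (hM f) = hK f" "dim_row (hM g) = hK g" "dim_col (hM g) = hK g"
    using F(10) G(10) by auto
  have Mij: "hM ?h $$ (i, j) = (if i < hK f then if j < hK f then hM f $$ (i, j) else 0
      else if j < hK f then 0 else hM g $$ (i - hK f, j - hK f))" if "i < hK f + hK g" "j < hK f + hK g" for i j
    using that by (auto simp: M dsum_def d)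
  have im: "?\<beta> ` {..<hK g} = {hK f..<hK f + hK g}"
    unfolding lessThan_atLeast0 image_add_atLeastLessThan by (simp add: add.commute)
  interpret gluing Sg "hK f" "hM f" "hN f" "hK g" "hM g" "hN g" "hK ?h" "hM ?h" "hN ?h" ?\<alpha> ?\<beta>
  proof
    show "har_graph Sg (hK f) (hM f) (hN f)" "har_graph Sg (hK g) (hM g) (hN g)" by fact+
    show "?\<alpha> ` {..<hK f} \<union> ?\<beta> ` {..<hK g} = {..<hK ?h}" unfolding im K by auto
    show "hM ?h \<in> carrier_mat (hK ?h) (hK ?h)" unfolding K by (intro carrier_matI) (simp_all add: M dsum_def d)
    show "length (hN ?h) = hK ?h" by (simp add: N K F(11) G(11))
  qed (simp_all add: inj_on_def N nth_append F(11) G(11) Mij)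
  have lsub: "left_nodes (hM f) (hN f) \<subseteq> {..<hK f}" "right_nodes (hM g) (hN g) \<subseteq> {..<hK g}"
    "left_nodes (hM g) (hN g) \<subseteq> {..<hK g}" "right_nodes (hM f) (hN f) \<subseteq> {..<hK f}"
    using F(11) G(11) by (auto simp: left_nodes_def right_nodes_def)
  have la: "?l v = lpos f v" if "v \<in> left_nodes (hM f) (hN f)" for v
    using that lsub left_nodes_lt(1)[OF f, of v] by (auto simp: psum_def tl_def pblock_eq)
  have lb: "?l (hK f + v) = n1 + lpos g v" if "v \<in> left_nodes (hM g) (hN g)" for v
    using that lsub left_nodes_lt(1)[OF g, of v] F(3) by (auto simp: psum_def tl_def pblock_eq)
  \<comment> \<open>The last summand is the number of \<open>v\<close> among the outputs of
    \<open>f\<close>; the block of these outputs now begins after the non-outputs of both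
    graphs.\<close>
  have ra: "?r v = hK f - m1 + (hK g - m2) + (rpos f v - (hK f - m1))" if "v \<in> right_nodes (hM f) (hN f)" for v
  proof -
    have v: "v < hK f" using that lsub by auto
    then have "hK f - m1 \<le> rpos f v" "rpos f v < hK f"
      using that left_nodes_lt(2)[OF f, of v] permutes_lt[OF F(7), of v] by auto
    then show ?thesis using v F(2) by (simp add: psum_def tr_def pblock_eq)
  qed
  have rb: "?r (hK f + v) = hK f + rpos g v" if "v \<in> right_nodes (hM g) (hN g)" for v
  proof -
    have v: "v < hK g" using that lsub by auto
    then have "hK g - m2 \<le> rpos g v" using that left_nodes_lt(2)[OF g, of v] by auto
    then show ?thesis using F(2) by (simp add: psum_def tr_def pblock_eq)
  qed
  have left: "left_nodes (hM ?h) (hN ?h) = left_nodes (hM f) (hN f) \<union> ?\<beta> ` left_nodes (hM g) (hN g)"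
    unfolding left_nodes_glue by auto
  have right: "right_nodes (hM ?h) (hN ?h) = right_nodes (hM f) (hN f) \<union> ?\<beta> ` right_nodes (hM g) (hN g)"
    unfolding right_nodes_glue im using lsub(4) by auto
  have "?l ` left_nodes (hM ?h) (hN ?h) = lpos f ` left_nodes (hM f) (hN f) \<union> (+) n1 ` lpos g ` left_nodes (hM g) (hN g)"
    unfolding left image_Un image_image using la lb by (intro arg_cong2[where f = "(\<union>)"] image_cong HOL.refl) auto
  also have "\<dots> = {..<n1 + n2}" unfolding F(6) G(6) lessThan_atLeast0 image_add_atLeastLessThan by auto
  finally have L: "?l ` left_nodes (hM ?h) (hN ?h) = {..<n1 + n2}" .
  have "?r ` right_nodes (hM ?h) (hN ?h) =
      (\<lambda>i. hK f - m1 + (hK g - m2) + (i - (hK f - m1))) ` rpos f ` right_nodes (hM f) (hN f) \<union>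
      (+) (hK f) ` rpos g ` right_nodes (hM g) (hN g)"
    unfolding right image_Un image_image using ra rb by (intro arg_cong2[where f = "(\<union>)"] image_cong HOL.refl) auto
  also have "\<dots> = {hK ?h - (m1 + m2)..<hK ?h}"
  proof -
    have e: "{hK f - m1..<hK f} = (+) (hK f - m1) ` {0..<m1}"
      unfolding image_add_atLeastLessThan using F(2) by simp
    have "(\<lambda>i. hK f - m1 + (hK g - m2) + (i - (hK f - m1))) ` {hK f - m1..<hK f} =
        (+) (hK f - m1 + (hK g - m2)) ` {0..<m1}"
      unfolding e by (simp only: image_image add_diff_cancel_left')
    also have "\<dots> = {hK f - m1 + (hK g - m2)..<hK f - m1 + (hK g - m2) + m1}"
      unfolding image_add_atLeastLessThan by (simp only: add_0_right add_0_left add.commute)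
    also have "\<dots> = {hK ?h - (m1 + m2)..<hK f + (hK g - m2)}" using F(2) G(2) K by simp
    finally have 1: "(\<lambda>i. hK f - m1 + (hK g - m2) + (i - (hK f - m1))) ` {hK f - m1..<hK f} =
       {hK ?h - (m1 + m2)..<hK f + (hK g - m2)}" .
    have 2: "(+) (hK f) ` {hK g - m2..<hK g} = {hK f + (hK g - m2)..<hK ?h}"
      unfolding image_add_atLeastLessThan K by (simp add: add.commute)
    show ?thesis unfolding F(9) G(9) 1 2 using F(2) G(2) K by (intro ivl_disj_un_two(3)) auto
  qed
  finally have R: "?r ` right_nodes (hM ?h) (hN ?h) = {hK ?h - (m1 + m2)..<hK ?h}" .
  have mK: "m1 + m2 \<le> hK ?h" using F(2) G(2) K by simp
  have h: "is_har Sg (n1 + n2) (m1 + m2) ?h" and lp: "lpos ?h = ?l" and rp: "rpos ?h = ?r"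
    using is_harI[OF har_graph_glue pl pr hL hR mK L R] by auto
  have inf: "inputs n1 f ! i \<in> left_nodes (hM f) (hN f)" if "i < n1" for i
    using inputs_set(2)[OF f] that by (metis length_inputs(1) nth_mem)
  have ing: "inputs n2 g ! i \<in> left_nodes (hM g) (hN g)" if "i < n2" for i
    using inputs_set(2)[OF g] that by (metis length_inputs(1) nth_mem)
  have outf: "outputs m1 f ! i \<in> right_nodes (hM f) (hN f)" if "i < m1" for i
    using inputs_set(4)[OF f] that by (metis length_inputs(2) nth_mem)
  have outg: "outputs m2 g ! i \<in> right_nodes (hM g) (hN g)" if "i < m2" for i
    using inputs_set(4)[OF g] that by (metis length_inputs(2) nth_mem)
  have i: "inputs (n1 + n2) ?h = inputs n1 f @ map ?\<beta> (inputs n2 g)"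
  proof (rule inputs_eqI[OF h])
    fix i assume i: "i < n1 + n2"
    show "lpos ?h ((inputs n1 f @ map ?\<beta> (inputs n2 g)) ! i) = i"
    proof (cases "i < n1")
      case True
      then show ?thesis using la[OF inf[OF True]] lpos_inputs(1)[OF f True] by (simp add: lp nth_append)
    next
      case False
      then have "i - n1 < n2" using i by simp
      then show ?thesis using False lb[OF ing] lpos_inputs(1)[OF g] by (simp add: lp nth_append)
    qed
  qed simp
  have o: "outputs (m1 + m2) ?h = outputs m1 f @ map ?\<beta> (outputs m2 g)"
  proof (rule outputs_eqI[OF h])
    fix i assume i: "i < m1 + m2"
    show "rpos ?h ((outputs m1 f @ map ?\<beta> (outputs m2 g)) ! i) = hK ?h - (m1 + m2) + i"
    proof (cases "i < m1")
      case True
      then show ?thesis using ra[OF outf[OF True]] rpos_outputs(1)[OF f True] F(2) G(2) K by (simp add: rp nth_append)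
    next
      case False
      then have j: "i - m1 < m2" using i by simp
      then show ?thesis using False rb[OF outg[OF j]] rpos_outputs(1)[OF g j] F(2) G(2) K by (simp add: rp nth_append)
    qed
  qed simp
  have w: "wires (inputs n1 f) (har_edges Sg f) \<subseteq> {..<hK f}" "wires (inputs n2 g) (har_edges Sg g) \<subseteq> {..<hK g}"
    using har_monogamous(2)[OF f] har_monogamous(2)[OF g] bullets_subset[OF f] bullets_subset[OF g] by auto
  have "hmap (\<lambda>v. v) = (id :: 'a hedge \<Rightarrow> 'a hedge)" by (auto simp: hmap_def fun_eq_iff)
  then have id: "image_mset (hmap (\<lambda>v. v)) E = E" for E :: "'a hedge multiset" by (simp add: multiset.map_id)
  have df: "denotes Sg s (inputs n1 f) (har_edges Sg f) (outputs m1 f)" using s by (simp add: represents_def)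
  have dg: "denotes Sg t (map ?\<beta> (inputs n2 g)) (image_mset (hmap ?\<beta>) (har_edges Sg g)) (map ?\<beta> (outputs m2 g))"
    by (rule denotes_rename) (use t in \<open>auto simp: represents_def\<close>)
  have "denotes Sg (TTens s t) (inputs (n1 + n2) ?h) (har_edges Sg ?h) (outputs (m1 + m2) ?h)"
    unfolding i o hedges_glue id
    by (rule denotes_tensI[OF df dg]) (use w in \<open>auto simp: wires_hmap\<close>)
  then show ?thesis using h by (simp add: represents_def)
qed

text \<open>The permutations \<open>q\<close> and \<open>q'\<close> fix the interface positions, so
  the interface lists and the hyperedges are all renamed along the same \<open>p\<close>.\<close>

lemma represents_equiv_imp:
  assumes f: "represents Sg n m t f" and g: "is_har Sg n m g" and e: "har_equiv n m f g"
  shows "represents Sg n m t g"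
proof -
  have hf: "is_har Sg n m f" using f by (simp add: represents_def)
  note F = is_harD[OF hf] and G = is_harD[OF g]
  obtain p q q' where K: "hK g = hK f" and p: "p permutes {..<hK f}" and q: "q permutes {..<hK f - n}"
      and q': "q' permutes {..<hK f - m}"
    and M: "hM g = (perm_mat (hK f) p)\<^sup>T \<Zsemi> hM f \<Zsemi> perm_mat (hK f) p"
    and L: "hL g = (perm_mat (hK f) p)\<^sup>T \<Zsemi> hL f \<Zsemi> (1\<^sub>m n \<oplus>\<^sub>d perm_mat (hK f - n) q)"
    and R: "hR g = (perm_mat (hK f) p)\<^sup>T \<Zsemi> hR f \<Zsemi> (perm_mat (hK f - m) q' \<oplus>\<^sub>d 1\<^sub>m m)"
    and N: "hN g = hN f \<Zsemi>\<^sub>l perm_mat (hK f) p"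
    using e unfolding har_equiv_def is_perm_mat_def by metis
  have M': "hM g = reorder p (hM f)" unfolding M by (rule reorder_conj[OF p F(10)])
  have Kn: "n + (hK f - n) = hK f" "hK f - m + m = hK f" using F(2,3) by auto
  let ?q = "psum n id q" and ?q' = "psum (hK f - m) q' id"
  have pq: "?q permutes {..<hK f}" "?q' permutes {..<hK f}"
    using psum_permutes[OF permutes_id q, of n] psum_permutes[OF q' permutes_id, of m] unfolding Kn by auto
  have Q: "1\<^sub>m n \<oplus>\<^sub>d perm_mat (hK f - n) q = perm_mat (hK f) ?q" "perm_mat (hK f - m) q' \<oplus>\<^sub>d 1\<^sub>m m = perm_mat (hK f) ?q'"
    using dsum_perm_mat[OF permutes_id q, of n] dsum_perm_mat[OF q' permutes_id, of m] unfolding Kn perm_mat_one by auto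
  have "hL g = perm_mat (hK g) (?q \<circ> (lpos f \<circ> pinv p))"
    unfolding L Q K F(5) dcomp_def perm_mat_transpose[OF p] perm_mat_mult[OF F(4)] perm_mat_mult[OF pq(1)] ..
  then have lg: "lpos g = ?q \<circ> (lpos f \<circ> pinv p)"
    using lpos_eq permutes_compose[OF permutes_compose[OF permutes_inv[OF p] F(4)] pq(1)] K by metis
  have "hR g = perm_mat (hK g) (?q' \<circ> (rpos f \<circ> pinv p))"
    unfolding R Q K F(8) dcomp_def perm_mat_transpose[OF p] perm_mat_mult[OF F(7)] perm_mat_mult[OF pq(2)] ..
  then have rg: "rpos g = ?q' \<circ> (rpos f \<circ> pinv p)"
    using rpos_eq permutes_compose[OF permutes_compose[OF permutes_inv[OF p] F(7)] pq(2)] K by metis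
  have inv: "pinv p (p v) = v" for v using permutes_inverses[OF p] by simp
  \<comment> \<open>Relabelling vertices is gluing with the empty graph.\<close>
  interpret gluing Sg "hK f" "hM f" "hN f" 0 "0\<^sub>m 0 0" "[]" "hK g" "hM g" "hN g" p "\<lambda>v. v"
  proof
    show "har_graph Sg (hK f) (hM f) (hN f)" by fact
    show "har_graph Sg 0 (0\<^sub>m 0 0) []" using har_graph_discrete(1)[of Sg 0] by simp
    show "inj_on p {..<hK f}" by (rule permutes_inj_on[OF p])
    show "p ` {..<hK f} \<union> (\<lambda>v. v) ` {..<0} = {..<hK g}" using permutes_image[OF p] K by simp
    show "hM g \<in> carrier_mat (hK g) (hK g)" "length (hN g) = hK g" by fact+
    show "hN g ! p i = hN f ! i" if "i < hK f" for i
      using permute_labels_nth[OF p F(11), of "p i"] that permutes_lt[OF p, of i] inv unfolding N by simp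
    show "hM g $$ (p i, p i') = hM f $$ (i, i')" if "i < hK f" "i' < hK f" for i i'
      using reorder_index[OF F(10), of "p i" "p i'" p] that permutes_lt[OF p] inv unfolding M' by simp
  qed auto
  have i: "inputs n g = map p (inputs n f)"
    by (rule inputs_eqI[OF g]) (use lpos_inputs[OF hf] inv in \<open>simp_all add: lg psum_def\<close>)
  have o: "outputs m g = map p (outputs m f)"
    by (rule outputs_eqI[OF g]) (use rpos_outputs[OF hf] inv in \<open>simp_all add: rg psum_def K\<close>)
  have "denotes Sg t (map p (inputs n f)) (image_mset (hmap p) (har_edges Sg f)) (map p (outputs m f))"
    by (rule denotes_rename) (use f permutes_inj_on[OF p] in \<open>auto simp: represents_def\<close>)
  then show ?thesis using g by (simp add: represents_def i o hedges_glue har_graph_discrete(4)[of Sg 0, simplified])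
qed

text \<open>Equal multisets of hyperedges determine a matching of the operation vertices only up to
  choice, since several vertices may carry the same hyperedge; some matching is enough.\<close>

lemma image_mset_eq_bij:
  assumes "finite A" "finite B" "image_mset F (mset_set A) = image_mset G (mset_set B)"
  shows "\<exists>\<kappa>. bij_betw \<kappa> A B \<and> (\<forall>a\<in>A. G (\<kappa> a) = F a)"
  using assms
proof (induction A arbitrary: B rule: finite_induct)
  case empty
  then have "B = {}" by (metis image_mset_is_empty_iff mset_set_empty_iff mset_set.empty)
  then show ?case by (auto simp: bij_betw_def)
next
  case (insert a A)
  have "F a \<in># image_mset G (mset_set B)" using insert.prems(2)[symmetric] insert.hyps by simp
  then obtain b where b: "b \<in> B" "G b = F a" using insert.prems(1) by auto
  have "mset_set B = add_mset b (mset_set (B - {b}))" using b(1) insert.prems(1) by (simp add: mset_set.remove)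
  then have "image_mset F (mset_set A) = image_mset G (mset_set (B - {b}))"
    using insert.prems(2) insert.hyps b(2) by simp
  then obtain \<kappa> where k: "bij_betw \<kappa> A (B - {b})" "\<forall>a\<in>A. G (\<kappa> a) = F a"
    using insert.IH[of "B - {b}"] insert.prems(1) by blast
  have "bij_betw (\<kappa>(a := b)) A (B - {b})"
    using k(1) insert.hyps(2) by (subst bij_betw_cong[of A _ \<kappa>]) auto
  moreover have "bij_betw (\<kappa>(a := b)) {a} {b}" by (simp add: bij_betw_def)
  ultimately have "bij_betw (\<kappa>(a := b)) (A \<union> {a}) ((B - {b}) \<union> {b})" by (rule bij_betw_combine) simp
  then have "bij_betw (\<kappa>(a := b)) (insert a A) B" using b(1) by (simp add: insert_absorb)
  moreover have "\<forall>x\<in>insert a A. G ((\<kappa>(a := b)) x) = F x" using k(2) b(2) insert.hyps(2) by auto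
  ultimately show ?case by blast
qed

text \<open>Supplies the \<open>Q\<close> of \<open>har_equiv\<close>. The shift by \<open>n\<close>
  is due to \<open>Q\<close> numbering the remaining positions from 0.\<close>

lemma permutes_psum_id:
  assumes "p permutes {..<K}" "\<And>i. i < n \<Longrightarrow> p i = i" "n \<le> K"
  shows "\<exists>q. q permutes {..<K - n} \<and> psum n id q = p"
proof -
  have p: "p permutes {n..<K}"
    using assms by (intro permutes_superset[OF assms(1)]) auto
  have ge: "n \<le> p i \<and> p i < K \<longleftrightarrow> n \<le> i \<and> i < K" for i
    using permutes_in_image[OF p, of i] by simp
  let ?q = "\<lambda>i. p (n + i) - n"
  have "?q permutes {..<K - n}"
  proof (rule bij_imp_permutes)
    have "inj_on ?q {..<K - n}"
    proof (rule inj_onI)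
      fix i j assume "i \<in> {..<K - n}" "j \<in> {..<K - n}" "p (n + i) - n = p (n + j) - n"
      moreover have "n \<le> p (n + i)" "n \<le> p (n + j)" using calculation ge[of "n + i"] ge[of "n + j"] assms(3) by auto
      ultimately have "p (n + i) = p (n + j)" by linarith
      then show "i = j" using permutes_inj[OF p] by (metis add_left_cancel injD)
    qed
    moreover have "?q ` {..<K - n} \<subseteq> {..<K - n}"
    proof
      fix y assume "y \<in> ?q ` {..<K - n}"
      then obtain i where "i < K - n" "y = p (n + i) - n" by auto
      then show "y \<in> {..<K - n}" using ge[of "n + i"] by auto
    qed
    ultimately show "bij_betw ?q {..<K - n} {..<K - n}" by (simp add: bij_betw_def endo_inj_surj)
    show "?q x = x" if "x \<notin> {..<K - n}" for x
      using that permutes_not_in[OF p, of "n + x"] by auto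
  qed
  moreover have "psum n id ?q = p"
  proof
    fix i
    show "psum n id ?q i = p i"
    proof (cases "i < n")
      case True
      then show ?thesis using assms(2) by (simp add: psum_def)
    next
      case False
      then have "n \<le> p i" using ge[of i] permutes_not_in[OF p, of i] by (cases "i < K") auto
      then show ?thesis using False by (simp add: psum_def)
    qed
  qed
  ultimately show ?thesis by blast
qed

text \<open>Supplies \<open>Q'\<close>. Here the free positions come at the beginning, so the
  permutation itself serves.\<close>

lemma permutes_psum_id_right:
  assumes "p permutes {..<K}" "\<And>i. i < m \<Longrightarrow> p (K - m + i) = K - m + i" "m \<le> K"
  shows "p permutes {..<K - m} \<and> psum (K - m) p id = p"
proof -
  have fixed: "p x = x" if "\<not> x < K - m" for x
  proof (cases "x < K")
    case True
    then show ?thesis using assms(2)[of "x - (K - m)"] that assms(3) by simp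
  next
    case False
    then show ?thesis using permutes_not_in[OF assms(1)] by simp
  qed
  then have "p permutes {..<K - m}" by (intro permutes_superset[OF assms(1)]) auto
  moreover have "psum (K - m) p id = p" using fixed by (auto simp: psum_def fun_eq_iff)
  ultimately show ?thesis by blast
qed


text \<open>A renaming of wires speaks of \<open>Bullet\<close> vertices only. It is extended to the
  operation vertices by matching equal hyperedges. Matrix entries between the two kinds of vertices
  are then recovered as list positions, and all other entries vanish by bipartiteness.\<close>

lemma isomorphic_har_equiv:
  assumes f: "is_har Sg n m f" and g: "is_har Sg n m g"
    and inj: "inj_on \<rho> (bullets (hN f))" and ins: "inputs n g = map \<rho> (inputs n f)"
    and E: "har_edges Sg g = image_mset (hmap \<rho>) (har_edges Sg f)" and outs: "outputs m g = map \<rho> (outputs m f)"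
  shows "har_equiv n m f g"
proof -
  note F = is_harD[OF f] and G = is_harD[OF g]
  have bul: "bullets (hN g) = \<rho> ` bullets (hN f)"
    using wires_hmap[of \<rho> "inputs n f" "har_edges Sg f"] har_monogamous(2)[OF f] har_monogamous(2)[OF g] ins E by simp
  have bb: "bij_betw \<rho> (bullets (hN f)) (bullets (hN g))" using inj bul by (simp add: bij_betw_def)
  have "image_mset (hmap \<rho> \<circ> circ_edge Sg (hM f) (hN f)) (mset_set (circs (hN f))) =
      image_mset (circ_edge Sg (hM g) (hN g)) (mset_set (circs (hN g)))"
    using E by (simp add: hedges_def multiset.map_comp)
  from image_mset_eq_bij[OF finite_circs(1) finite_circs(1) this] obtain \<kappa> where
    kb: "bij_betw \<kappa> (circs (hN f)) (circs (hN g))" and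
    ke: "\<And>c. c \<in> circs (hN f) \<Longrightarrow> circ_edge Sg (hM g) (hN g) (\<kappa> c) = hmap \<rho> (circ_edge Sg (hM f) (hN f) c)"
    by auto
  have split: "{..<hK f} = bullets (hN f) \<union> circs (hN f)" "{..<hK g} = bullets (hN g) \<union> circs (hN g)"
    "bullets (hN f) \<inter> circs (hN f) = {}" "bullets (hN g) \<inter> circs (hN g) = {}"
    using F(11) G(11) by (auto simp: bullets_def circs_def)
  \<comment> \<open>The last branch, the identity outside the graph, is there to make
    \<open>p\<close> a permutation in the sense of \<open>permutes\<close>.\<close>
  define p where "p v = (if v \<in> bullets (hN f) then \<rho> v else if v < hK f then \<kappa> v else v)" for v
  have p_b: "p v = \<rho> v" if "v \<in> bullets (hN f)" for v using that by (simp add: p_def)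
  have p_c: "p v = \<kappa> v" if "v \<in> circs (hN f)" for v using that split(1,3) by (auto simp: p_def)
  have "bij_betw p (bullets (hN f)) (bullets (hN g))" using bb p_b by (simp cong: bij_betw_cong)
  moreover have "bij_betw p (circs (hN f)) (circs (hN g))" using kb p_c by (simp cong: bij_betw_cong)
  ultimately have pbij: "bij_betw p {..<hK f} {..<hK g}"
    unfolding split(1,2) by (rule bij_betw_combine) (rule split(4))
  then have K: "hK g = hK f" using bij_betw_same_card by fastforce
  have p: "p permutes {..<hK f}"
  proof (rule bij_imp_permutes)
    show "bij_betw p {..<hK f} {..<hK f}" using pbij K by simp
    show "p x = x" if "x \<notin> {..<hK f}" for x using that split(1) by (auto simp: p_def)
  qed
  have plt: "p v < hK f \<longleftrightarrow> v < hK f" for v by (rule permutes_lt[OF p])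
  have inv: "p (pinv p v) = v" "pinv p (p v) = v" for v using permutes_inverses[OF p] by auto
  have cg: "\<kappa> c \<in> circs (hN g)" if "c \<in> circs (hN f)" for c using that kb by (auto simp: bij_betw_def)
  have bg: "\<rho> v \<in> bullets (hN g)" if "v \<in> bullets (hN f)" for v using that bul by simp
  have op: "op_of (hN g ! \<kappa> c) = op_of (hN f ! c)" if "c \<in> circs (hN f)" for c
    using arg_cong[OF ke[OF that], of hlab] by (simp add: circ_edge_def hmap_def)
  have lab: "hN g ! p v = hN f ! v" if "v < hK f" for v
  proof (cases "v \<in> bullets (hN f)")
    case True
    then show ?thesis using bg[OF True] p_b by (simp add: bullets_def)
  next
    case False
    then have c: "v \<in> circs (hN f)" using that split(1) by auto
    then show ?thesis using circ_label[OF c] circ_label[OF cg[OF c]] op[OF c] p_c by simp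
  qed
  \<comment> \<open>Nonzero labels are compared as successors; two numbers with the same
    predecessors in this sense agree also when one of them is 0.\<close>
  have nat_eq: "x = y" if "\<And>k. x = Suc k \<longleftrightarrow> y = Suc k" for x y :: nat using that by (metis not0_implies_Suc)
  have Mcb: "hM g $$ (p c, p u) = hM f $$ (c, u)" "hM g $$ (p u, p c) = hM f $$ (u, c)"
    if c: "c \<in> circs (hN f)" and u: "u \<in> bullets (hN f)" for c u
  proof -
    note P = circ_edge_props[OF F(1) c] and Q = circ_edge_props[OF G(1) cg[OF c]]
    have lt: "u < hK f" "\<rho> u < hK g" using u bg[OF u] split by auto
    have src: "hsrc (circ_edge Sg (hM f) (hN f) c) ! k \<in> bullets (hN f)" if "k < arity Sg (op_of (hN f ! c))" for k
    proof -
      have "hsrc (circ_edge Sg (hM f) (hN f) c) ! k \<in> preds (hM f) c" using that P(1,7) by (metis nth_mem)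
      then show ?thesis using bipartite[OF F(1), of _ c] c split(3) by (auto simp: preds_def)
    qed
    have tgt: "htgt (circ_edge Sg (hM f) (hN f) c) ! k \<in> bullets (hN f)" if "k < coarity Sg (op_of (hN f ! c))" for k
    proof -
      have "htgt (circ_edge Sg (hM f) (hN f) c) ! k \<in> succs (hM f) c" using that P(3,8) by (metis nth_mem)
      then show ?thesis using bipartite[OF F(1), of c] c split(3) by (auto simp: succs_def)
    qed
    \<comment> \<open>The label is \<open>Suc k\<close> exactly if \<open>u\<close> is source number
      \<open>k\<close> of \<open>c\<close>. The source list of the matched vertex is the image under
      \<open>\<rho>\<close>, which is injective on wires, so the position can be read off in both
      graphs.\<close>
    have "hM g $$ (\<kappa> c, \<rho> u) = Suc k \<longleftrightarrow> hM f $$ (c, u) = Suc k" for k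
      using P(5)[OF lt(1), of k] Q(5)[OF lt(2), of k] src[of k] inj_onD[OF inj, of u] u P(7)
      unfolding op[OF c] ke[OF c] by (auto simp: hmap_def)
    then show "hM g $$ (p c, p u) = hM f $$ (c, u)" using p_b[OF u] p_c[OF c] nat_eq by metis
    have "hM g $$ (\<rho> u, \<kappa> c) = Suc k \<longleftrightarrow> hM f $$ (u, c) = Suc k" for k
      using P(6)[OF lt(1), of k] Q(6)[OF lt(2), of k] tgt[of k] inj_onD[OF inj, of u] u P(8)
      unfolding op[OF c] ke[OF c] by (auto simp: hmap_def)
    then show "hM g $$ (p u, p c) = hM f $$ (u, c)" using p_b[OF u] p_c[OF c] nat_eq by metis
  qed
  have zero: "hM h $$ (i, j) = 0" if "har_graph Sg (hK h) (hM h) (hN h)" "i < hK h" "j < hK h"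
    "i \<in> bullets (hN h) \<longleftrightarrow> j \<in> bullets (hN h)" for h i j
    using bipartite[OF that(1), of j i] mem_edges[OF hg_carrier(1)[OF that(1)], of j i] that(2-4)
    by (auto simp: bullets_def circs_def)
  have M: "hM g $$ (p i, p j) = hM f $$ (i, j)" if ij: "i < hK f" "j < hK f" for i j
  proof (cases "i \<in> bullets (hN f) \<longleftrightarrow> j \<in> bullets (hN f)")
    case True
    have "p v \<in> bullets (hN g) \<longleftrightarrow> v \<in> bullets (hN f)" if "v < hK f" for v
      using that lab[OF that] plt[of v] K F(11) G(11) by (simp add: bullets_def)
    then have "hM g $$ (p i, p j) = 0" using zero[OF G(1), of "p i" "p j"] True ij plt K by simp
    then show ?thesis using zero[OF F(1) ij True] by simp
  next
    case False
    then consider "i \<in> bullets (hN f)" "j \<in> circs (hN f)" | "i \<in> circs (hN f)" "j \<in> bullets (hN f)"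
      using ij split(1) by blast
    then show ?thesis using Mcb by cases auto
  qed
  have hM: "hM g = (perm_mat (hK f) p)\<^sup>T \<Zsemi> hM f \<Zsemi> perm_mat (hK f) p"
    unfolding reorder_conj[OF p F(10)]
  proof (rule eq_matI)
    fix i j assume "i < dim_row (reorder p (hM f))" "j < dim_col (reorder p (hM f))"
    then have ij: "i < hK f" "j < hK f" using F(10) by (auto simp: reorder_def)
    then have "pinv p i < hK f" "pinv p j < hK f" using permutes_lt[OF permutes_inv[OF p]] by auto
    then show "hM g $$ (i, j) = reorder p (hM f) $$ (i, j)"
      using M[of "pinv p i" "pinv p j"] reorder_index[OF F(10) ij] inv by simp
  qed (use F(10) G(10) K in \<open>auto simp: reorder_def\<close>)
  have hN: "hN g = hN f \<Zsemi>\<^sub>l perm_mat (hK f) p"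
  proof (rule nth_equalityI)
    fix i assume "i < length (hN g)"
    then have i: "i < hK f" using G(11) K by simp
    then have "pinv p i < hK f" using permutes_lt[OF permutes_inv[OF p]] by auto
    then show "hN g ! i = (hN f \<Zsemi>\<^sub>l perm_mat (hK f) p) ! i"
      using permute_labels_nth[OF p F(11) i] lab[of "pinv p i"] inv by simp
  qed (use F(11) G(11) K in simp)
  have pin: "lpos g (p (pinv (lpos f) i)) = i" if "i < n" for i
  proof -
    have "inputs n f ! i \<in> set (inputs n f)" using that by simp
    then have "inputs n f ! i \<in> bullets (hN f)"
      unfolding inputs_set(2)[OF f] by (simp add: bullets_def left_nodes_def)
    then have "p (inputs n f ! i) = inputs n g ! i" using p_b ins that by simp
    then show ?thesis using lpos_inputs(1)[OF g that] that by (simp add: inputs_def)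
  qed
  have pout: "rpos g (p (pinv (rpos f) (hK f - m + i))) = hK f - m + i" if "i < m" for i
  proof -
    have "outputs m f ! i \<in> set (outputs m f)" using that by simp
    then have "outputs m f ! i \<in> bullets (hN f)"
      unfolding inputs_set(4)[OF f] by (simp add: bullets_def right_nodes_def)
    then have "p (outputs m f ! i) = outputs m g ! i" using p_b outs that by simp
    then show ?thesis using rpos_outputs(1)[OF g that] that K by (simp add: outputs_def)
  qed
  have "lpos g \<circ> (p \<circ> pinv (lpos f)) permutes {..<hK f}"
    using permutes_compose[OF permutes_compose[OF permutes_inv[OF F(4)] p]] G(4) K by simp
  \<comment> \<open>The composite compares the left orders after relabelling by \<open>p\<close>. It
    fixes the first \<open>n\<close> positions because inputs correspond to inputs, and its effect
    elsewhere is the wanted \<open>Q\<close>; the right order is treated alike.\<close>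
  from permutes_psum_id[OF this _ F(3)] obtain q where q: "q permutes {..<hK f - n}"
    "psum n id q = lpos g \<circ> (p \<circ> pinv (lpos f))" using pin by auto
  have "rpos g \<circ> (p \<circ> pinv (rpos f)) permutes {..<hK f}"
    using permutes_compose[OF permutes_compose[OF permutes_inv[OF F(7)] p]] G(7) K by simp
  from permutes_psum_id_right[OF this _ F(2)] obtain q' where q': "q' permutes {..<hK f - m}"
    "psum (hK f - m) q' id = rpos g \<circ> (p \<circ> pinv (rpos f))" using pout by auto
  have Kn: "n + (hK f - n) = hK f" "hK f - m + m = hK f" using F(2,3) by auto
  have Q: "1\<^sub>m n \<oplus>\<^sub>d perm_mat (hK f - n) q = perm_mat (hK f) (lpos g \<circ> (p \<circ> pinv (lpos f)))"
    using dsum_perm_mat[OF permutes_id q(1), of n] unfolding Kn q(2) perm_mat_one .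
  have Q': "perm_mat (hK f - m) q' \<oplus>\<^sub>d 1\<^sub>m m = perm_mat (hK f) (rpos g \<circ> (p \<circ> pinv (rpos f)))"
    using dsum_perm_mat[OF q'(1) permutes_id, of m] unfolding Kn q'(2) perm_mat_one .
  have cl: "lpos g \<circ> (p \<circ> pinv (lpos f)) \<circ> (lpos f \<circ> pinv p) = lpos g"
    using permutes_inverses(2)[OF F(4)] inv by (simp add: fun_eq_iff)
  have cr: "rpos g \<circ> (p \<circ> pinv (rpos f)) \<circ> (rpos f \<circ> pinv p) = rpos g"
    using permutes_inverses(2)[OF F(7)] inv by (simp add: fun_eq_iff)
  have hL: "hL g = (perm_mat (hK f) p)\<^sup>T \<Zsemi> hL f \<Zsemi> (1\<^sub>m n \<oplus>\<^sub>d perm_mat (hK f - n) q)"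
  proof -
    have "lpos g \<circ> (p \<circ> pinv (lpos f)) permutes {..<hK f}" by fact
    from perm_mat_mult[OF this] show ?thesis
      unfolding Q F(5) G(5) K dcomp_def perm_mat_transpose[OF p] perm_mat_mult[OF F(4)] by (simp add: cl)
  qed
  have hR: "hR g = (perm_mat (hK f) p)\<^sup>T \<Zsemi> hR f \<Zsemi> (perm_mat (hK f - m) q' \<oplus>\<^sub>d 1\<^sub>m m)"
  proof -
    have "rpos g \<circ> (p \<circ> pinv (rpos f)) permutes {..<hK f}" by fact
    from perm_mat_mult[OF this] show ?thesis
      unfolding Q' F(8) G(8) K dcomp_def perm_mat_transpose[OF p] perm_mat_mult[OF F(7)] by (simp add: cr)
  qed
  show ?thesis unfolding har_equiv_def is_perm_mat_def
    using K p q(1) q'(1) hM hL hR hN by metis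
qed

lemma represents_unique:
  assumes "represents Sg n m t f" "represents Sg n m t g"
  shows "har_equiv n m f g"
proof -
  have f: "is_har Sg n m f" and g: "is_har Sg n m g" using assms by (auto simp: represents_def)
  obtain \<rho> where "inj_on \<rho> (wires (inputs n f) (har_edges Sg f))" "inputs n g = map \<rho> (inputs n f)"
    "har_edges Sg g = image_mset (hmap \<rho>) (har_edges Sg f)" "outputs m g = map \<rho> (outputs m f)"
    using denotes_unique assms unfolding represents_def by metis
  then show ?thesis using isomorphic_har_equiv[OF f g, of \<rho>] har_monogamous(2)[OF f] by simp
qed

section \<open>The isomorphism\<close>

lemma UN2_const: "\<lbrakk>x \<in> A; y \<in> B; \<And>x y. x \<in> A \<Longrightarrow> y \<in> B \<Longrightarrow> F x y = Z\<rbrakk> \<Longrightarrow> (\<Union>x\<in>A. \<Union>y\<in>B. F x y) = Z"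
  by blast

text \<open>The laws hold for terms by the rules of \<open>free_eq\<close>, so they pass to any
  structure whose data are images of terms under a family of maps constant on
  \<open>free_eq\<close>. This is applied with \<open>free_class\<close> and with
  \<open>hars_of\<close>.\<close>

lemma prop_category_of_terms:
  fixes Sg :: "'o signature" and \<phi> :: "nat \<Rightarrow> nat \<Rightarrow> 'o pterm \<Rightarrow> 'a"
  assumes mor: "\<And>n m. mor D n m = \<phi> n m ` pterms Sg n m"
    and idt: "\<And>n. idt D n = \<phi> n n (TId n)"
    and symm: "\<And>n m. symm D n m = \<phi> (n + m) (m + n) (TSym n m)"
    and cmp: "\<And>n m l s t. s \<in> pterms Sg n m \<Longrightarrow> t \<in> pterms Sg m l \<Longrightarrow>
       cmp D n m l (\<phi> n m s) (\<phi> m l t) = \<phi> n l (TComp s t)"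
    and tns: "\<And>n1 m1 n2 m2 s t. s \<in> pterms Sg n1 m1 \<Longrightarrow> t \<in> pterms Sg n2 m2 \<Longrightarrow>
       tns D n1 m1 n2 m2 (\<phi> n1 m1 s) (\<phi> n2 m2 t) = \<phi> (n1 + n2) (m1 + m2) (TTens s t)"
    and cong: "\<And>n m s t. free_eq Sg n m s t \<Longrightarrow> \<phi> n m s = \<phi> n m t"
  shows "prop_category D"
proof -
  have ty: "TId n \<in> pterms Sg n n" "TSym n m \<in> pterms Sg (n + m) (m + n)" for n m by (auto simp: pterms_def)
  have tyc: "s \<in> pterms Sg n m \<Longrightarrow> t \<in> pterms Sg m l \<Longrightarrow> TComp s t \<in> pterms Sg n l" for s t n m l
    by (auto simp: pterms_def)
  have tyt: "s \<in> pterms Sg n1 m1 \<Longrightarrow> t \<in> pterms Sg n2 m2 \<Longrightarrow> TTens s t \<in> pterms Sg (n1 + n2) (m1 + m2)" for s t n1 m1 n2 m2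
    by (auto simp: pterms_def)
  show ?thesis
  proof
    fix n m k
    show "idt D n \<in> mor D n n" "symm D n m \<in> mor D (n + m) (m + n)"
      unfolding mor idt symm using ty by blast+
    show "tns D n n m m (idt D n) (idt D m) = idt D (n + m)"
      unfolding idt tns[OF ty(1) ty(1)] by (rule cong[OF free_eq.tens_id])
    show "cmp D (n + m) (m + n) (n + m) (symm D n m) (symm D m n) = idt D (n + m)"
      unfolding idt symm cmp[OF ty(2) ty(2)] by (rule cong[OF free_eq.sym_sym])
    have 1: "TSym n k \<in> pterms Sg (n + k) (k + n)" "TSym n m \<in> pterms Sg (n + m) (m + n)" using ty by auto
    have 2: "TTens (TSym n m) (TId k) \<in> pterms Sg (n + m + k) (m + n + k)"
      "TTens (TId m) (TSym n k) \<in> pterms Sg (m + n + k) (m + k + n)"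
      by (auto simp: pterms_def)
    \<comment> \<open>The tensor factors arrive with types bracketed differently from those of the
      composite in \<open>hexagon\<close>; these equations align them.\<close>
    have a: "m + (n + k) = m + n + k" "m + (k + n) = m + k + n" "n + (m + k) = n + m + k" by simp_all
    show "symm D n (m + k) = cmp D (n + m + k) (m + n + k) (m + k + n)
       (tns D (n + m) (m + n) k k (symm D n m) (idt D k)) (tns D m m (n + k) (k + n) (idt D m) (symm D n k))"
      unfolding idt symm tns[OF 1(2) ty(1)] tns[OF ty(1) 1(1)] unfolding a cmp[OF 2]
      by (rule cong[OF free_eq.hexagon])
  next
    fix f n m g l assume "f \<in> mor D n m" "g \<in> mor D m l"
    then show "cmp D n m l f g \<in> mor D n l" unfolding mor using cmp tyc by fastforce
  next
    fix f n1 m1 g n2 m2 assume f: "f \<in> mor D n1 m1" and g: "g \<in> mor D n2 m2"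
    obtain s t where s: "s \<in> pterms Sg n1 m1" "f = \<phi> n1 m1 s" and t: "t \<in> pterms Sg n2 m2" "g = \<phi> n2 m2 t"
      using f g unfolding mor by blast
    show "tns D n1 m1 n2 m2 f g \<in> mor D (n1 + n2) (m1 + m2)"
      unfolding s(2) t(2) tns[OF s(1) t(1)] mor using tyt[OF s(1) t(1)] by (rule imageI)
    show "cmp D (n1 + n2) (m1 + m2) (m2 + m1) (tns D n1 m1 n2 m2 f g) (symm D m1 m2) =
      cmp D (n1 + n2) (n2 + n1) (m2 + m1) (symm D n1 n2) (tns D n2 m2 n1 m1 g f)"
      unfolding s(2) t(2) tns[OF s(1) t(1)] tns[OF t(1) s(1)] symm
        cmp[OF tyt[OF s(1) t(1)] ty(2)] cmp[OF ty(2) tyt[OF t(1) s(1)]]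
      by (rule cong[OF free_eq.sym_natural[OF s(1) t(1)]])
  next
    fix f n m assume f: "f \<in> mor D n m"
    obtain s where s: "s \<in> pterms Sg n m" "f = \<phi> n m s" using f unfolding mor by blast
    show "cmp D n n m (idt D n) f = f" unfolding s(2) idt cmp[OF ty(1) s(1)] by (rule cong[OF free_eq.id_left[OF s(1)]])
    show "cmp D n m m f (idt D m) = f" unfolding s(2) idt cmp[OF s(1) ty(1)] by (rule cong[OF free_eq.id_right[OF s(1)]])
    show "tns D 0 0 n m (idt D 0) f = f" unfolding s(2) idt tns[OF ty(1) s(1)]
      using cong[OF free_eq.unit_left[OF s(1)]] by simp
    show "tns D n m 0 0 f (idt D 0) = f" unfolding s(2) idt tns[OF s(1) ty(1)]
      using cong[OF free_eq.unit_right[OF s(1)]] by simp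
  next
    fix f n m g l h k assume "f \<in> mor D n m" "g \<in> mor D m l" "h \<in> mor D l k"
    then obtain s t u where s: "s \<in> pterms Sg n m" "f = \<phi> n m s" and t: "t \<in> pterms Sg m l" "g = \<phi> m l t"
      and u: "u \<in> pterms Sg l k" "h = \<phi> l k u" unfolding mor by blast
    show "cmp D n l k (cmp D n m l f g) h = cmp D n m k f (cmp D m l k g h)"
      unfolding s(2) t(2) u(2) cmp[OF s(1) t(1)] cmp[OF t(1) u(1)] cmp[OF tyc[OF s(1) t(1)] u(1)] cmp[OF s(1) tyc[OF t(1) u(1)]]
      by (rule cong[OF free_eq.comp_assoc[OF s(1) t(1) u(1)]])
  next
    fix f1 n1 m1 g1 l1 f2 n2 m2 g2 l2
    assume "f1 \<in> mor D n1 m1" "g1 \<in> mor D m1 l1" "f2 \<in> mor D n2 m2" "g2 \<in> mor D m2 l2"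
    then obtain s1 t1 s2 t2 where s1: "s1 \<in> pterms Sg n1 m1" "f1 = \<phi> n1 m1 s1" and t1: "t1 \<in> pterms Sg m1 l1" "g1 = \<phi> m1 l1 t1"
      and s2: "s2 \<in> pterms Sg n2 m2" "f2 = \<phi> n2 m2 s2" and t2: "t2 \<in> pterms Sg m2 l2" "g2 = \<phi> m2 l2 t2"
      unfolding mor by blast
    show "tns D n1 l1 n2 l2 (cmp D n1 m1 l1 f1 g1) (cmp D n2 m2 l2 f2 g2) =
       cmp D (n1 + n2) (m1 + m2) (l1 + l2) (tns D n1 m1 n2 m2 f1 f2) (tns D m1 l1 m2 l2 g1 g2)"
      unfolding s1(2) t1(2) s2(2) t2(2) cmp[OF s1(1) t1(1)] cmp[OF s2(1) t2(1)] tns[OF s1(1) s2(1)] tns[OF t1(1) t2(1)]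
        tns[OF tyc[OF s1(1) t1(1)] tyc[OF s2(1) t2(1)]] cmp[OF tyt[OF s1(1) s2(1)] tyt[OF t1(1) t2(1)]]
      by (rule cong[OF free_eq.interchange[OF s1(1) t1(1) s2(1) t2(1)]])
  next
    fix f n1 m1 g n2 m2 h n3 m3
    assume "f \<in> mor D n1 m1" "g \<in> mor D n2 m2" "h \<in> mor D n3 m3"
    then obtain s t u where s: "s \<in> pterms Sg n1 m1" "f = \<phi> n1 m1 s" and t: "t \<in> pterms Sg n2 m2" "g = \<phi> n2 m2 t"
      and u: "u \<in> pterms Sg n3 m3" "h = \<phi> n3 m3 u" unfolding mor by blast
    show "tns D (n1 + n2) (m1 + m2) n3 m3 (tns D n1 m1 n2 m2 f g) h =
       tns D n1 m1 (n2 + n3) (m2 + m3) f (tns D n2 m2 n3 m3 g h)"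
      unfolding s(2) t(2) u(2) tns[OF s(1) t(1)] tns[OF t(1) u(1)] tns[OF tyt[OF s(1) t(1)] u(1)] tns[OF s(1) tyt[OF t(1) u(1)]]
      using cong[OF free_eq.tens_assoc[OF s(1) t(1) u(1)]] by (simp add: add.assoc)
  qed
qed

section \<open>The free PROP as an image of the terms\<close>

lemma free_class_eq: "t \<in> pterms Sg n m \<Longrightarrow> free_class Sg n m t = cls Sg t"
  by (auto simp: free_class_def free_rel_def cls_def pterms_def dest: free_eq_types)

lemma Free_mor: "mor (Free Sg) n m = free_class Sg n m ` pterms Sg n m"
  by (auto simp: Free_def quotient_def free_class_def)

lemma Free_cmp:
  assumes "s \<in> pterms Sg n m" "t \<in> pterms Sg m l"
  shows "cmp (Free Sg) n m l (free_class Sg n m s) (free_class Sg m l t) = free_class Sg n l (TComp s t)"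
proof -
  have c: "free_class Sg n l (TComp s' t') = cls Sg (TComp s t)" if "s' \<in> cls Sg s" "t' \<in> cls Sg t" for s' t'
  proof -
    have "TComp s' t' \<in> pterms Sg n l" using mem_cls[OF that(1)] mem_cls[OF that(2)] assms by (auto simp: pterms_def)
    then show ?thesis using cls_TComp_cong[OF that] by (simp add: free_class_eq)
  qed
  have "s \<in> cls Sg s" "t \<in> cls Sg t" using assms cls_self by (auto simp: pterms_def)
  then have "(\<Union>s'\<in>cls Sg s. \<Union>t'\<in>cls Sg t. free_class Sg n l (TComp s' t')) = cls Sg (TComp s t)"
    using c by (rule UN2_const)
  moreover have "TComp s t \<in> pterms Sg n l" using assms by (auto simp: pterms_def)
  ultimately show ?thesis using assms by (simp add: Free_def free_class_eq)
qed

lemma Free_tns: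
  assumes "s \<in> pterms Sg n1 m1" "t \<in> pterms Sg n2 m2"
  shows "tns (Free Sg) n1 m1 n2 m2 (free_class Sg n1 m1 s) (free_class Sg n2 m2 t) =
    free_class Sg (n1 + n2) (m1 + m2) (TTens s t)"
proof -
  have c: "free_class Sg (n1 + n2) (m1 + m2) (TTens s' t') = cls Sg (TTens s t)" if "s' \<in> cls Sg s" "t' \<in> cls Sg t" for s' t'
  proof -
    have "TTens s' t' \<in> pterms Sg (n1 + n2) (m1 + m2)" using mem_cls[OF that(1)] mem_cls[OF that(2)] assms by (auto simp: pterms_def)
    then show ?thesis using cls_TTens_cong[OF that] by (simp add: free_class_eq)
  qed
  have "s \<in> cls Sg s" "t \<in> cls Sg t" using assms cls_self by (auto simp: pterms_def)
  then have "(\<Union>s'\<in>cls Sg s. \<Union>t'\<in>cls Sg t. free_class Sg (n1 + n2) (m1 + m2) (TTens s' t')) = cls Sg (TTens s t)"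
    using c by (rule UN2_const)
  moreover have "TTens s t \<in> pterms Sg (n1 + n2) (m1 + m2)" using assms by (auto simp: pterms_def)
  ultimately show ?thesis using assms by (simp add: Free_def free_class_eq)
qed

lemma free_class_cong: "free_eq Sg n m s t \<Longrightarrow> free_class Sg n m s = free_class Sg n m t"
  using free_eq_types[of Sg n m s t] cls_eqI[of Sg n m s t] by (simp add: free_class_eq)

lemma Free_idt: "idt (Free Sg) n = free_class Sg n n (TId n)"
  and Free_symm: "symm (Free Sg) n m = free_class Sg (n + m) (m + n) (TSym n m)"
  by (simp_all add: Free_def)

lemma prop_category_Free: "prop_category (Free Sg)"
  by (rule prop_category_of_terms[where \<phi> = "free_class Sg" and Sg = Sg])
    (simp_all add: Free_mor Free_idt Free_symm Free_cmp Free_tns free_class_cong)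

section \<open>The PROP of HARs as an image of the terms\<close>

definition hars_of :: "'o signature \<Rightarrow> nat \<Rightarrow> nat \<Rightarrow> 'o pterm \<Rightarrow> 'o har set" where
  "hars_of Sg n m t = {f. represents Sg n m t f}"

text \<open>One inclusion is uniqueness of the represented HAR up to equivalence, the other is
  invariance of representation under equivalence.\<close>

lemma har_class_eq: "represents Sg n m t f \<Longrightarrow> har_class Sg n m f = hars_of Sg n m t"
  using represents_unique[of Sg n m t f] represents_equiv_imp[of Sg n m t f]
  by (auto simp: har_class_def har_rel_def hars_of_def represents_def)

text \<open>Ensures that \<open>hars_of\<close> of a well-typed term is inhabited; the unions
  defining the operations of \<open>Har\<close> would otherwise collapse to the empty set.\<close>

lemma representable: "t \<in> pterms Sg n m \<Longrightarrow> \<exists>f. represents Sg n m t f"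
proof (induction t arbitrary: n m)
  case (TId k)
  then show ?case using represents_id by (auto simp: pterms_def)
next
  case (TSym k l)
  then show ?case using represents_sym by (auto simp: pterms_def)
next
  case (TGen g)
  then have "g \<in> ops Sg" "n = arity Sg g" "m = coarity Sg g" by (auto simp: pterms_def)
  then show ?case using represents_gen[of g Sg] by blast
next
  case (TComp s t)
  then have "s \<in> pterms Sg n (tcod Sg s)" "t \<in> pterms Sg (tcod Sg s) m" by (auto simp: pterms_def)
  then show ?case using TComp.IH represents_comp by metis
next
  case (TTens s t)
  then have p: "s \<in> pterms Sg (tdom Sg s) (tcod Sg s)" "t \<in> pterms Sg (tdom Sg t) (tcod Sg t)"
    and e: "n = tdom Sg s + tdom Sg t" "m = tcod Sg s + tcod Sg t" by (auto simp: pterms_def)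
  obtain f g where "represents Sg (tdom Sg s) (tcod Sg s) s f" "represents Sg (tdom Sg t) (tcod Sg t) t g"
    using TTens.IH(1)[OF p(1)] TTens.IH(2)[OF p(2)] by blast
  then show ?case unfolding e using represents_tensor by blast
qed

lemma Har_mor: "mor (Har Sg) n m = hars_of Sg n m ` pterms Sg n m"
proof -
  have "mor (Har Sg) n m = har_class Sg n m ` {f. is_har Sg n m f}"
    by (auto simp: Har_def quotient_def har_class_def)
  also have "\<dots> = hars_of Sg n m ` pterms Sg n m"
  proof (intro equalityI subsetI)
    fix X assume "X \<in> har_class Sg n m ` {f. is_har Sg n m f}"
    then obtain f where f: "is_har Sg n m f" "X = har_class Sg n m f" by blast
    then obtain t where t: "t \<in> pterms Sg n m" "represents Sg n m t f" using har_represented by blast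
    then show "X \<in> hars_of Sg n m ` pterms Sg n m" using f(2) har_class_eq by blast
  next
    fix X assume "X \<in> hars_of Sg n m ` pterms Sg n m"
    then obtain t where t: "t \<in> pterms Sg n m" "X = hars_of Sg n m t" by blast
    obtain f where f: "represents Sg n m t f" using representable[OF t(1)] by blast
    then have "X = har_class Sg n m f" using har_class_eq t(2) by blast
    moreover have "is_har Sg n m f" using f by (simp add: represents_def)
    ultimately show "X \<in> har_class Sg n m ` {f. is_har Sg n m f}" by blast
  qed
  finally show ?thesis .
qed

text \<open>Independence of representatives: the composite of any two HARs representing
  \<open>s\<close> and \<open>t\<close> represents \<open>TComp s t\<close>, so every member of the
  union is the same class.\<close>

lemma Har_cmp:
  assumes "s \<in> pterms Sg n m" "t \<in> pterms Sg m l"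
  shows "cmp (Har Sg) n m l (hars_of Sg n m s) (hars_of Sg m l t) = hars_of Sg n l (TComp s t)"
proof -
  have c: "har_class Sg n l (har_comp m f g) = hars_of Sg n l (TComp s t)"
    if "f \<in> hars_of Sg n m s" "g \<in> hars_of Sg m l t" for f g
    using that represents_comp har_class_eq unfolding hars_of_def mem_Collect_eq by metis
  obtain f g where "f \<in> hars_of Sg n m s" "g \<in> hars_of Sg m l t"
    using representable[OF assms(1)] representable[OF assms(2)] by (auto simp: hars_of_def)
  then have "(\<Union>f\<in>hars_of Sg n m s. \<Union>g\<in>hars_of Sg m l t. har_class Sg n l (har_comp m f g)) = hars_of Sg n l (TComp s t)"
    using c by (rule UN2_const)
  then show ?thesis by (simp add: Har_def)
qed

lemma Har_tns:
  assumes "s \<in> pterms Sg n1 m1" "t \<in> pterms Sg n2 m2"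
  shows "tns (Har Sg) n1 m1 n2 m2 (hars_of Sg n1 m1 s) (hars_of Sg n2 m2 t) = hars_of Sg (n1 + n2) (m1 + m2) (TTens s t)"
proof -
  have c: "har_class Sg (n1 + n2) (m1 + m2) (har_tensor n1 m1 n2 m2 f g) = hars_of Sg (n1 + n2) (m1 + m2) (TTens s t)"
    if "f \<in> hars_of Sg n1 m1 s" "g \<in> hars_of Sg n2 m2 t" for f g
    using that represents_tensor har_class_eq unfolding hars_of_def mem_Collect_eq by metis
  obtain f g where "f \<in> hars_of Sg n1 m1 s" "g \<in> hars_of Sg n2 m2 t"
    using representable[OF assms(1)] representable[OF assms(2)] by (auto simp: hars_of_def)
  then have "(\<Union>f\<in>hars_of Sg n1 m1 s. \<Union>g\<in>hars_of Sg n2 m2 t.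
      har_class Sg (n1 + n2) (m1 + m2) (har_tensor n1 m1 n2 m2 f g)) = hars_of Sg (n1 + n2) (m1 + m2) (TTens s t)"
    using c by (rule UN2_const)
  then show ?thesis by (simp add: Har_def)
qed

lemma Har_idt: "idt (Har Sg) n = hars_of Sg n n (TId n)"
  and Har_symm: "symm (Har Sg) n m = hars_of Sg (n + m) (m + n) (TSym n m)"
  using har_class_eq[OF represents_id] har_class_eq[OF represents_sym] by (simp_all add: Har_def)

lemma singleton_class_eq: "g \<in> ops Sg \<Longrightarrow> singleton_class Sg g = hars_of Sg (arity Sg g) (coarity Sg g) (TGen g)"
  unfolding singleton_class_def by (rule har_class_eq[OF represents_gen])

lemma hars_of_cong: "free_eq Sg n m s t \<Longrightarrow> hars_of Sg n m s = hars_of Sg n m t"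
  using denotes_sound[of Sg n m s t] by (simp add: hars_of_def represents_def)

lemma prop_category_Har: "prop_category (Har Sg)"
  by (rule prop_category_of_terms[where \<phi> = "hars_of Sg" and Sg = Sg])
    (simp_all add: Har_mor Har_idt Har_symm Har_cmp Har_tns hars_of_cong)

text \<open>A single common HAR shows that both terms denote one diagram with identical names, which
  is the hypothesis of \<open>denotes_complete\<close>.\<close>

lemma hars_of_inject:
  assumes "s \<in> pterms Sg n m" "t \<in> pterms Sg n m" "hars_of Sg n m s = hars_of Sg n m t"
  shows "free_class Sg n m s = free_class Sg n m t"
proof -
  obtain f where f: "represents Sg n m s f" using representable[OF assms(1)] by blast
  then have "represents Sg n m t f" using assms(3) by (auto simp: hars_of_def)
  with f have "cls Sg s = cls Sg t"
    using denotes_complete assms(1,2) unfolding represents_def pterms_def by blast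
  then show ?thesis using assms by (simp add: free_class_eq)
qed

section \<open>The interpretation functor, its inverse and its uniqueness\<close>

lemma eval_term_Har: "t \<in> pterms Sg n m \<Longrightarrow> eval_term Sg (Har Sg) (singleton_class Sg) t = hars_of Sg n m t"
proof (induction t arbitrary: n m)
  case (TId k)
  then show ?case by (auto simp: pterms_def Har_idt)
next
  case (TSym k l)
  then show ?case by (auto simp: pterms_def Har_symm)
next
  case (TGen g)
  then show ?case by (auto simp: pterms_def singleton_class_eq)
next
  case (TComp s t)
  then have p: "s \<in> pterms Sg n (tcod Sg s)" "t \<in> pterms Sg (tcod Sg s) m" "tdom Sg s = n" "tcod Sg t = m"
    by (auto simp: pterms_def)
  show ?case using TComp.IH(1)[OF p(1)] TComp.IH(2)[OF p(2)] Har_cmp[OF p(1,2)] p(3,4) by simp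
next
  case (TTens s t)
  then have p: "s \<in> pterms Sg (tdom Sg s) (tcod Sg s)" "t \<in> pterms Sg (tdom Sg t) (tcod Sg t)"
    and e: "n = tdom Sg s + tdom Sg t" "m = tcod Sg s + tcod Sg t" by (auto simp: pterms_def)
  show ?case using TTens.IH(1)[OF p(1)] TTens.IH(2)[OF p(2)] Har_tns[OF p] e by simp
qed

lemma har_interp_class:
  assumes "t \<in> pterms Sg n m"
  shows "har_interp Sg n m (free_class Sg n m t) = hars_of Sg n m t"
proof -
  have "eval_term Sg (Har Sg) (singleton_class Sg) s = hars_of Sg n m t" if "s \<in> free_class Sg n m t" for s
  proof -
    have s: "s \<in> pterms Sg n m" "free_eq Sg n m t s" using that by (auto simp: free_class_def free_rel_def)
    then show ?thesis using eval_term_Har[OF s(1)] hars_of_cong[OF s(2)] by simp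
  qed
  moreover have "t \<in> free_class Sg n m t" using assms cls_self by (auto simp: free_class_eq pterms_def)
  ultimately have "eval_term Sg (Har Sg) (singleton_class Sg) ` free_class Sg n m t = {hars_of Sg n m t}" by auto
  then show ?thesis by (simp add: har_interp_def free_lift_def)
qed

lemma prop_functor_har_interp: "prop_functor (Free Sg) (Har Sg) (har_interp Sg)"
proof -
  interpret F: prop_category "Free Sg" by (rule prop_category_Free)
  interpret H: prop_category "Har Sg" by (rule prop_category_Har)
  have ty: "TId n \<in> pterms Sg n n" "TSym n m \<in> pterms Sg (n + m) (m + n)" for n m by (auto simp: pterms_def)
  show ?thesis
  proof
    show "har_interp Sg n n (idt (Free Sg) n) = idt (Har Sg) n" for n
      unfolding Free_idt Har_idt by (rule har_interp_class[OF ty(1)])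
    show "har_interp Sg (n + m) (m + n) (symm (Free Sg) n m) = symm (Har Sg) n m" for n m
      unfolding Free_symm Har_symm by (rule har_interp_class[OF ty(2)])
    show "har_interp Sg n m X \<in> mor (Har Sg) n m" if "X \<in> mor (Free Sg) n m" for X n m
      using that har_interp_class unfolding Free_mor Har_mor by fastforce
  next
    fix X n m Y l assume "X \<in> mor (Free Sg) n m" "Y \<in> mor (Free Sg) m l"
    then obtain s t where s: "s \<in> pterms Sg n m" "X = free_class Sg n m s" and t: "t \<in> pterms Sg m l" "Y = free_class Sg m l t"
      unfolding Free_mor by blast
    have "TComp s t \<in> pterms Sg n l" using s t by (auto simp: pterms_def)
    then show "har_interp Sg n l (cmp (Free Sg) n m l X Y) = cmp (Har Sg) n m l (har_interp Sg n m X) (har_interp Sg m l Y)"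
      using s t by (simp add: Free_cmp Har_cmp har_interp_class)
  next
    fix X n1 m1 Y n2 m2 assume "X \<in> mor (Free Sg) n1 m1" "Y \<in> mor (Free Sg) n2 m2"
    then obtain s t where s: "s \<in> pterms Sg n1 m1" "X = free_class Sg n1 m1 s"
      and t: "t \<in> pterms Sg n2 m2" "Y = free_class Sg n2 m2 t"
      unfolding Free_mor by blast
    have "TTens s t \<in> pterms Sg (n1 + n2) (m1 + m2)" using s t by (auto simp: pterms_def)
    then show "har_interp Sg (n1 + n2) (m1 + m2) (tns (Free Sg) n1 m1 n2 m2 X Y) =
        tns (Har Sg) n1 m1 n2 m2 (har_interp Sg n1 m1 X) (har_interp Sg n2 m2 Y)"
      using s t by (simp add: Free_tns Har_tns har_interp_class)
  qed
qed

text \<open>A functor that is bijective on every hom-set reflects each operation: the wanted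
  equation for the inverse becomes the functor law once the arguments are written as images.\<close>

lemma prop_functor_inverse:
  assumes F: "prop_functor C D F"
    and bij: "\<And>n m. bij_betw (F n m) (mor C n m) (mor D n m)"
  shows "prop_isomorphism C D F"
proof -
  interpret F: prop_functor C D F by (rule F)
  define G where "G n m = inv_into (mor C n m) (F n m)" for n m
  have GF: "G n m (F n m f) = f" if "f \<in> mor C n m" for n m f
    unfolding G_def using bij that by (meson bij_betw_def inv_into_f_f)
  have FG: "F n m (G n m g) = g" "G n m g \<in> mor C n m" if "g \<in> mor D n m" for n m g
    using bij[of n m] that unfolding G_def bij_betw_def by (auto intro: f_inv_into_f inv_into_into)
  have "prop_functor D C G"
  proof
    show "G n m g \<in> mor C n m" if "g \<in> mor D n m" for g n m using FG(2)[OF that] .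
    show "G n n (idt D n) = idt C n" for n using GF[OF F.dom.idt_mor] F.F_idt by metis
    show "G (n + m) (m + n) (symm D n m) = symm C n m" for n m using GF[OF F.dom.sym_mor] F.F_sym by metis
    show "G n l (cmp D n m l f g) = cmp C n m l (G n m f) (G m l g)" if f: "f \<in> mor D n m" and g: "g \<in> mor D m l" for f g n m l
      using GF[OF F.dom.cmp_mor[OF FG(2)[OF f] FG(2)[OF g]]] F.F_cmp[OF FG(2)[OF f] FG(2)[OF g]] FG(1)[OF f] FG(1)[OF g] by simp
    show "G (n1 + n2) (m1 + m2) (tns D n1 m1 n2 m2 f g) = tns C n1 m1 n2 m2 (G n1 m1 f) (G n2 m2 g)"
      if f: "f \<in> mor D n1 m1" and g: "g \<in> mor D n2 m2" for f g n1 m1 n2 m2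
      using GF[OF F.dom.tns_mor[OF FG(2)[OF f] FG(2)[OF g]]] F.F_tns[OF FG(2)[OF f] FG(2)[OF g]] FG(1)[OF f] FG(1)[OF g] by simp
  qed
  then show ?thesis unfolding prop_isomorphism_def using F GF FG(1) by blast
qed

text \<open>Gives the precise meaning of being freely obtained from the singletons: a functor out of
  the free PROP is fixed by its values on the generators, by induction on a term in the
  class.\<close>

lemma prop_functor_determined:
  assumes F: "prop_functor (Free Sg) D F" and H: "prop_functor (Free Sg) D H"
    and g: "\<And>g. g \<in> ops Sg \<Longrightarrow> F (arity Sg g) (coarity Sg g) (free_gen Sg g) = H (arity Sg g) (coarity Sg g) (free_gen Sg g)"
  shows "t \<in> pterms Sg n m \<Longrightarrow> F n m (free_class Sg n m t) = H n m (free_class Sg n m t)"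
proof (induction t arbitrary: n m)
  interpret F: prop_functor "Free Sg" D F by (rule F)
  interpret H: prop_functor "Free Sg" D H by (rule H)
  {
    case (TId k)
    then have e: "n = k" "m = k" by (auto simp: pterms_def)
    show ?case unfolding e Free_idt[symmetric] F.F_idt H.F_idt ..
  next
    case (TSym k l)
    then have e: "n = k + l" "m = l + k" by (auto simp: pterms_def)
    show ?case unfolding e Free_symm[symmetric] F.F_sym H.F_sym ..
  next
    case (TGen x)
    then show ?case using g[of x] by (auto simp: pterms_def free_gen_def)
  next
    case (TComp s t)
    then have p: "s \<in> pterms Sg n (tcod Sg s)" "t \<in> pterms Sg (tcod Sg s) m" by (auto simp: pterms_def)
    then have c: "free_class Sg n (tcod Sg s) s \<in> mor (Free Sg) n (tcod Sg s)"
      "free_class Sg (tcod Sg s) m t \<in> mor (Free Sg) (tcod Sg s) m" unfolding Free_mor by blast+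
    show ?case unfolding Free_cmp[OF p, symmetric] F.F_cmp[OF c] H.F_cmp[OF c] TComp.IH(1)[OF p(1)] TComp.IH(2)[OF p(2)] ..
  next
    case (TTens s t)
    then have p: "s \<in> pterms Sg (tdom Sg s) (tcod Sg s)" "t \<in> pterms Sg (tdom Sg t) (tcod Sg t)"
      and e: "n = tdom Sg s + tdom Sg t" "m = tcod Sg s + tcod Sg t" by (auto simp: pterms_def)
    then have c: "free_class Sg (tdom Sg s) (tcod Sg s) s \<in> mor (Free Sg) (tdom Sg s) (tcod Sg s)"
      "free_class Sg (tdom Sg t) (tcod Sg t) t \<in> mor (Free Sg) (tdom Sg t) (tcod Sg t)" unfolding Free_mor by blast+
    show ?case unfolding e Free_tns[OF p, symmetric] F.F_tns[OF c] H.F_tns[OF c] TTens.IH(1)[OF p(1)] TTens.IH(2)[OF p(2)] ..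
  }
qed

theorem proposition5p3:
  fixes Sg :: "'o signature"
  shows "prop_isomorphism (Free Sg) (Har Sg) (har_interp Sg)
    \<and> (\<forall>g \<in> ops Sg. har_interp Sg (arity Sg g) (coarity Sg g) (free_gen Sg g) = singleton_class Sg g)
    \<and> (\<forall>F. prop_functor (Free Sg) (Har Sg) F
          \<and> (\<forall>g \<in> ops Sg. F (arity Sg g) (coarity Sg g) (free_gen Sg g) = singleton_class Sg g)
        \<longrightarrow> (\<forall>n m. \<forall>X \<in> mor (Free Sg) n m. F n m X = har_interp Sg n m X))"
proof (intro conjI)
  have "bij_betw (har_interp Sg n m) (mor (Free Sg) n m) (mor (Har Sg) n m)" for n m
    unfolding bij_betw_def
  proof
    show "inj_on (har_interp Sg n m) (mor (Free Sg) n m)"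
    proof (rule inj_onI)
      fix X Y assume "X \<in> mor (Free Sg) n m" "Y \<in> mor (Free Sg) n m" and e: "har_interp Sg n m X = har_interp Sg n m Y"
      then obtain s t where s: "s \<in> pterms Sg n m" "X = free_class Sg n m s" and t: "t \<in> pterms Sg n m" "Y = free_class Sg n m t"
        unfolding Free_mor by blast
      then show "X = Y" using hars_of_inject[OF s(1) t(1)] e by (simp add: har_interp_class)
    qed
    \<comment> \<open>Surjectivity is already contained in \<open>Har_mor\<close>, which presents
      every class of HARs as \<open>hars_of\<close> of a term.\<close>
    show "har_interp Sg n m ` mor (Free Sg) n m = mor (Har Sg) n m"
      unfolding Free_mor Har_mor image_image by (rule image_cong) (simp_all add: har_interp_class)
  qed
  then show "prop_isomorphism (Free Sg) (Har Sg) (har_interp Sg)"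
    by (rule prop_functor_inverse[OF prop_functor_har_interp])
  show gen: "\<forall>g \<in> ops Sg. har_interp Sg (arity Sg g) (coarity Sg g) (free_gen Sg g) = singleton_class Sg g"
  proof
    fix g assume g: "g \<in> ops Sg"
    then have "TGen g \<in> pterms Sg (arity Sg g) (coarity Sg g)" by (simp add: pterms_def)
    then show "har_interp Sg (arity Sg g) (coarity Sg g) (free_gen Sg g) = singleton_class Sg g"
      using g by (simp add: free_gen_def har_interp_class singleton_class_eq)
  qed
  show "\<forall>F. prop_functor (Free Sg) (Har Sg) F
          \<and> (\<forall>g \<in> ops Sg. F (arity Sg g) (coarity Sg g) (free_gen Sg g) = singleton_class Sg g)
        \<longrightarrow> (\<forall>n m. \<forall>X \<in> mor (Free Sg) n m. F n m X = har_interp Sg n m X)"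
  proof (intro allI impI ballI)
    fix F n m X assume F: "prop_functor (Free Sg) (Har Sg) F
          \<and> (\<forall>g \<in> ops Sg. F (arity Sg g) (coarity Sg g) (free_gen Sg g) = singleton_class Sg g)"
      and X: "X \<in> mor (Free Sg) n m"
    obtain t where t: "t \<in> pterms Sg n m" "X = free_class Sg n m t" using X unfolding Free_mor by blast
    show "F n m X = har_interp Sg n m X" unfolding t(2)
      by (rule prop_functor_determined[OF _ prop_functor_har_interp _ t(1)]) (use F gen in auto)
  qed
qed

end
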